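(* Let $\Theta$ be non-trivial, i.e. $P(\Theta\neq0)>0$. Then $X(t)=L(\Theta(t))$ is integrable if and only if $L$ is integrable and $\int_{\{|\theta|>1\}}\mathrm{E}(|L(\theta)|)\,F(d\theta)<\infty$. If $L$ and $\Theta$ (and hence $X$) are integrable, then $$\mathrm{E}X(1)=\mathrm{E}L(1)\,\mathrm{E}\Theta(1)$$ (coordinatewise product). If $j\in\{1,\dots,d\}$ and $X_j=L_j(\Theta_j(\cdot))$ is integrable but $\Theta_j$ is not integrable, then $X_j$ is mean zero.
   Context: Setting. $d\in\mathbb N$; for $j=1,\dots,d$, $H_j$ is a separable (real) Hilbert space and $L_j$ is an $H_j$-valued càdlàg Lévy process; $L_1,\dots,L_d$ are independent. $H:=H_1\times\dots\times H_d$ with $\langle u|v\rangle=\sum_j\langle u_j|v_j\rangle_j$; $L=(L_1,\dots,L_d)$; $L(\theta):=(L_1(\theta_1),\dots,L_d(\theta_d))$ for $\theta\in\mathbb R_+^d$. $\Theta=(\Theta_1,\dots,\Theta_d)$ is an $\mathbb R^d$-valued càdlàg Lévy process, independent of $L$, such that each $\Theta_j$ is a subordinator (nondecreasing real Lévy process); $F$ is the Lévy measure of $\Theta$ (concentrated on $\mathbb R_+^d$). For $a\in\mathbb R^d$, $u\in H$, the product of $a$ and $u$ is $(a_1u_1,\dots,a_du_d)$. A process $Y$ is integrable if $\mathrm{E}|Y(t)|<\infty$ for all $t\ge0$; it is mean zero if it is integrable and $\mathrm{E}Y(t)=0$ for all $t\ge0$.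
   Formalization: "X integrable implies L integrable" is proved only when every Θ_j is non-trivial; under P(Θ≠0)>0 alone it fails (d=2, Θ(t)=(0,t), L_2=0, L_1 not integrable). All else holds as stated; the H_j are closed subspaces of one separable Hilbert space. *)

theory Defs
  imports "HOL-Probability.Probability"
begin

text \<open>The finite product \<open>'h ^ 'd\<close> of a separable space is separable; this makes Borel
  measurability and the Bochner integral on the product Hilbert space available.\<close>

instance vec :: ("{metric_space, second_countable_topology}", finite) second_countable_topology
proof
  obtain B :: "'a set set" where B: "countable B" "topological_basis B"
    using ex_countable_basis by blast
  define K where "K = (\<lambda>f. {x :: 'a ^ 'b. \<forall>i. x $ i \<in> f i}) ` (\<Pi>\<^sub>E i\<in>UNIV. B)"
  have "countable K"
    unfolding K_def by (intro countable_image countable_PiE) (auto simp: B)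
  moreover have "topological_basis K"
  proof (rule topological_basisI)
    fix U assume "U \<in> K"
    then show "open U"
      using topological_basis_open[OF B(2)] by (auto simp: K_def intro!: open_vector_box)
  next
    fix O' and x :: "'a ^ 'b" assume "open O'" "x \<in> O'"
    then obtain A where A: "\<And>i. open (A i)" "\<And>i. x $ i \<in> A i"
        "\<And>y. (\<forall>i. y $ i \<in> A i) \<Longrightarrow> y \<in> O'"
      unfolding open_vec_def by metis
    have "\<exists>b. b \<in> B \<and> x $ i \<in> b \<and> b \<subseteq> A i" for i
      using topological_basisE[OF B(2) A(1) A(2)] by metis
    then obtain b where b: "\<And>i. b i \<in> B" "\<And>i. x $ i \<in> b i" "\<And>i. b i \<subseteq> A i"
      by metis
    then show "\<exists>B'\<in>K. x \<in> B' \<and> B' \<subseteq> O'"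
      unfolding K_def using A(3) by (intro bexI[of _ "{y. \<forall>i. y $ i \<in> b i}"]) (blast, auto)
  qed
  ultimately show "\<exists>B :: ('a ^ 'b) set set. countable B \<and> open = generate_topology B"
    using topological_basis_imp_subbasis by blast
qed

text \<open>Processes are indexed by \<open>real\<close>, but only their values at times \<open>t \<ge> 0\<close> are ever used.\<close>

definition cadlag :: "(real \<Rightarrow> 'b::topological_space) \<Rightarrow> bool" where
  "cadlag f \<longleftrightarrow> (\<forall>t\<ge>0. (f \<longlongrightarrow> f t) (at_right t)) \<and> (\<forall>t>0. \<exists>l. (f \<longlongrightarrow> l) (at_left t))"

text \<open>For \<open>\<tau>\<close> only the values \<open>\<tau> 0 \<le> \<dots> \<le> \<tau> n\<close> matter. In the stationarity clause \<open>X h\<close> stands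
  for the increment \<open>X h - X 0\<close>, as \<open>X 0 = 0\<close> almost surely.\<close>

definition levy_process ::
  "'a measure \<Rightarrow> (real \<Rightarrow> 'a \<Rightarrow> 'b::{real_normed_vector, second_countable_topology}) \<Rightarrow> bool" where
  "levy_process M X \<longleftrightarrow>
     (\<forall>t\<ge>0. X t \<in> borel_measurable M) \<and>
     (AE \<omega> in M. X 0 \<omega> = 0) \<and>
     (\<forall>\<tau> :: nat \<Rightarrow> real. \<forall>n. 0 \<le> \<tau> 0 \<and> mono \<tau> \<longrightarrow>
        prob_space.indep_vars M (\<lambda>_. borel) (\<lambda>i \<omega>. X (\<tau> (Suc i)) \<omega> - X (\<tau> i) \<omega>) {..<n}) \<and>
     (\<forall>s\<ge>0. \<forall>h\<ge>0. distr M borel (\<lambda>\<omega>. X (s + h) \<omega> - X s \<omega>) = distr M borel (X h)) \<and>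
     (\<forall>\<omega>\<in>space M. cadlag (\<lambda>t. X t \<omega>))"

text \<open>Nonnegativity is required on every path (the Levy property only gives \<open>Z 0 = 0\<close> almost
  surely), so that a process on \<open>[0, \<infinity>)\<close> can be evaluated at the random time \<open>Z t \<omega>\<close>.\<close>

definition subordinator :: "'a measure \<Rightarrow> (real \<Rightarrow> 'a \<Rightarrow> real) \<Rightarrow> bool" where
  "subordinator M Z \<longleftrightarrow> levy_process M Z \<and>
     (\<forall>\<omega>\<in>space M. (\<forall>t\<ge>0. 0 \<le> Z t \<omega>) \<and> mono_on {0..} (\<lambda>t. Z t \<omega>))"

definition process_path :: "(real \<Rightarrow> 'a \<Rightarrow> 'b) \<Rightarrow> 'a \<Rightarrow> real \<Rightarrow> 'b" where
  "process_path X \<omega> = (\<lambda>t\<in>{0..}. X t \<omega>)"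

abbreviation path_space :: "(real \<Rightarrow> 'b::topological_space) measure" where
  "path_space \<equiv> PiM {0..} (\<lambda>_. borel)"

text \<open>Independence of two processes with possibly different state spaces, which
  \<open>prob_space.indep_var\<close> does not allow: the sigma-algebras they generate are independent.\<close>

definition indep_processes ::
  "'a measure \<Rightarrow> (real \<Rightarrow> 'a \<Rightarrow> 'b::topological_space) \<Rightarrow> (real \<Rightarrow> 'a \<Rightarrow> 'c::topological_space) \<Rightarrow> bool"
where
  "indep_processes M X Y \<longleftrightarrow> prob_space.indep_set M
     {process_path X -` A \<inter> space M | A. A \<in> sets path_space}
     {process_path Y -` A \<inter> space M | A. A \<in> sets path_space}"

definition jump :: "(real \<Rightarrow> 'a \<Rightarrow> 'b::real_normed_vector) \<Rightarrow> real \<Rightarrow> 'a \<Rightarrow> 'b" where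
  "jump X s \<omega> = X s \<omega> - Lim (at_left s) (\<lambda>r. X r \<omega>)"

text \<open>The Levy measure of a set is the expected number of nonzero jumps in that set
  during the time interval \<open>(0, 1]\<close>.\<close>

definition levy_measure ::
  "'a measure \<Rightarrow> (real \<Rightarrow> 'a \<Rightarrow> 'b::real_normed_vector) \<Rightarrow> 'b measure" where
  "levy_measure M X = measure_of UNIV (sets borel)
     (\<lambda>A. \<integral>\<^sup>+ \<omega>. emeasure (count_space UNIV)
        {s. 0 < s \<and> s \<le> 1 \<and> jump X s \<omega> \<noteq> 0 \<and> jump X s \<omega> \<in> A} \<partial>M)"

text \<open>For a subordination \<open>X t = L (\<Theta> t)\<close> in several coordinates, integrability of \<open>X\<close> gives no
  information on \<open>L j\<close> when the coordinate \<open>\<Theta> t $ j\<close> vanishes identically: with \<open>\<Theta> t = (0, t)\<close>,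
  \<open>L 2 = 0\<close> and \<open>L 1\<close> not integrable, \<open>\<Theta>\<close> is nontrivial and \<open>X = 0\<close> is integrable, but \<open>L\<close>
  is not. The inference from \<open>X\<close> to \<open>L\<close> therefore needs every coordinate of \<open>\<Theta>\<close> to be nontrivial.\<close>

definition nontrivial_process :: "'a measure \<Rightarrow> (real \<Rightarrow> 'a \<Rightarrow> 'b::zero) \<Rightarrow> bool" where
  "nontrivial_process M Y \<longleftrightarrow> measure M {\<omega> \<in> space M. \<exists>t\<ge>0. Y t \<omega> \<noteq> 0} > 0"

definition integrable_process ::
  "'a measure \<Rightarrow> (real \<Rightarrow> 'a \<Rightarrow> 'b::{banach, second_countable_topology}) \<Rightarrow> bool" where
  "integrable_process M Y \<longleftrightarrow> (\<forall>t\<ge>0. integrable M (Y t))"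

definition mean_zero_process ::
  "'a measure \<Rightarrow> (real \<Rightarrow> 'a \<Rightarrow> 'b::{banach, second_countable_topology}) \<Rightarrow> bool" where
  "mean_zero_process M Y \<longleftrightarrow>
     integrable_process M Y \<and> (\<forall>t\<ge>0. integral\<^sup>L M (Y t) = 0)"

definition multi_time ::
  "('d \<Rightarrow> real \<Rightarrow> 'a \<Rightarrow> 'h) \<Rightarrow> real ^ 'd \<Rightarrow> 'a \<Rightarrow> 'h ^ 'd::finite" where
  "multi_time L \<theta> \<omega> = (\<chi> j. L j (\<theta> $ j) \<omega>)"

definition joint_process ::
  "('d \<Rightarrow> real \<Rightarrow> 'a \<Rightarrow> 'h) \<Rightarrow> real \<Rightarrow> 'a \<Rightarrow> 'h ^ 'd::finite" where
  "joint_process L t \<omega> = (\<chi> j. L j t \<omega>)"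

definition subordinated ::
  "('d \<Rightarrow> real \<Rightarrow> 'a \<Rightarrow> 'h) \<Rightarrow> (real \<Rightarrow> 'a \<Rightarrow> real ^ 'd) \<Rightarrow> real \<Rightarrow> 'a \<Rightarrow> 'h ^ 'd::finite" where
  "subordinated L \<Theta> t \<omega> = multi_time L (\<Theta> t \<omega>) \<omega>"

text \<open>A family of separable Hilbert spaces \<open>H j\<close> is represented by closed subspaces of one separable
  Hilbert space \<open>'h\<close>, every such family being isometric to one of this form. Their product
  lies in \<open>'h ^ 'd\<close>, whose inner product is the sum of the coordinatewise ones.\<close>

definition coord_prod :: "real ^ 'd \<Rightarrow> 'h::real_vector ^ 'd \<Rightarrow> 'h ^ 'd::finite" where
  "coord_prod a u = (\<chi> j. (a $ j) *\<^sub>R (u $ j))"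

end

theory Submission
  imports Defs
begin

text \<open>
  Everything is done one coordinate at a time: norms on the product are comparable with the sum of
  the norms of the coordinates, so both integrability of \<open>X = L (\<Theta> \<cdot>)\<close> and finiteness of the integral
  against the Levy measure split into the corresponding statements for \<open>X j t = L j (\<Theta> t $ j)\<close>. Write
  \<open>h\<close> for the function \<open>r \<mapsto> E |L j r|\<close>. By independence and Fubini, \<open>E |X j t| = E h (\<Theta> t $ j)\<close> and
  \<open>E X j t = E \<phi> (\<Theta> t $ j)\<close>, where \<open>\<phi> r = E L j r\<close>; so the theorem is about a numerical
  function evaluated at the time change.

  The function \<open>h\<close> is subadditive, because increments of \<open>L j\<close> are stationary. It is either infinite
  on \<open>(0, \<infinity>)\<close> or finite everywhere: if \<open>s \<le> r\<close>, then \<open>L j r\<close> is \<open>L j s\<close> plus an independent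
  variable that stays in a fixed ball with probability at least \<open>1/2\<close>
  (\<open>moment_bound_earlier\<close>), so \<open>h s\<close> is controlled by \<open>h r\<close>. In the first case \<open>X j\<close> can be integrable
  only if \<open>\<Theta> $ j\<close> vanishes (\<open>integrable_X_dichotomy\<close>). In the second case \<open>\<phi> r = r *\<^sub>R \<phi> 1\<close>, the
  function \<open>h\<close> grows at most linearly, and it satisfies \<open>h s \<le> 2 * h r\<close> for \<open>s \<le> r\<close>
  (\<open>mean_linear\<close>, \<open>moment_quasi_mono\<close>). Linear growth gives integrability of \<open>X j\<close> from that of
  \<open>\<Theta> $ j\<close>, and linearity of \<open>\<phi>\<close> gives \<open>E X j 1 = E (\<Theta> 1 $ j) *\<^sub>R E L j 1\<close>. Since \<open>h r \<ge> r * norm (\<phi> 1)\<close>,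
  an integrable \<open>X j\<close> over a non-integrable \<open>\<Theta> $ j\<close> forces \<open>\<phi> 1 = 0\<close>, that is, mean zero.

  What remains is to compare \<open>E h (\<Theta> 1 $ j)\<close> with the integral of \<open>h (\<theta> $ j)\<close> over \<open>{|\<theta>| > 1}\<close>
  against the Levy measure, that is, with the expected sum of \<open>h\<close> over the large jumps of \<open>\<Theta>\<close> in
  \<open>(0, 1]\<close>. Instead of splitting \<open>\<Theta>\<close> into independent large-jump and small-jump parts, the proof samples
  \<open>\<Theta>\<close> on the grid of mesh \<open>1/n\<close>. For a continuous \<open>f\<close> vanishing near \<open>0\<close>, the sum of \<open>f\<close> over the grid
  increments converges on every path to the sum of \<open>f\<close> over the jumps (\<open>cadlag_grid_sums\<close>), so by
  Fatou's lemma bounds on the expected grid sums that are uniform in \<open>n\<close> pass to the jumps. The uniform bounds come from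
  one inequality (\<open>decoupling\<close>). Let \<open>S\<close> be the coordinate sum of the increment of \<open>\<Theta>\<close> over \<open>[0, 1]\<close>, \<open>S'\<close> the part of
  \<open>S\<close> that comes from outside the \<open>i\<close>-th cell, and \<open>\<xi>\<close> the increment over that cell. As \<open>\<xi>\<close> is independent of the increments on either
  side, \<open>E f \<xi>\<close> is at most a constant times \<open>E (f \<xi> * exp (- S'))\<close>. The weight makes the pathwise
  sums over the cells bounded in both situations that occur: if \<open>f\<close> is carried by large increments,
  \<open>N\<close> of them have weights at most \<open>exp (- (N - 1) / 2)\<close>, so that the weights sum to at most \<open>2\<close>
  while \<open>h \<xi> \<le> 2 * h (\<Theta> 1 $ j)\<close> almost surely (\<open>jump_moment_finite\<close>); if \<open>f\<close> is the \<open>j\<close>-th coordinate cut off to small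
  increments, the sum is at most a constant times \<open>S * exp (- S)\<close>. The latter bounds the mean of what is left of \<open>\<Theta> 1 $ j\<close> after
  the large jumps are removed, and subadditivity of \<open>h\<close> then gives the converse estimate
  (\<open>moment_finite_if_jump_moment_finite\<close>).
\<close>

section \<open>Jumps of cadlag paths seen on a grid\<close>

text \<open>The single-path version of \<^const>\<open>jump\<close>, which depends on no probability space.\<close>
definition path_jump :: "(real \<Rightarrow> 'b::real_normed_vector) \<Rightarrow> real \<Rightarrow> 'b" where
  "path_jump x s = x s - Lim (at_left s) x"

lemma jump_eq_path_jump: "jump X s \<omega> = path_jump (\<lambda>r. X r \<omega>) s"
  by (simp add: jump_def path_jump_def)

definition grid_increment :: "(real \<Rightarrow> 'b::real_normed_vector) \<Rightarrow> nat \<Rightarrow> nat \<Rightarrow> 'b" where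
  "grid_increment x n i = x (real (Suc i) / real n) - x (real i / real n)"

lemma cadlag_tendsto_left:
  fixes x :: "real \<Rightarrow> 'b::t2_space"
  assumes "cadlag x" "0 < s"
  shows "(x \<longlongrightarrow> Lim (at_left s) x) (at_left s)"
proof -
  obtain l where "(x \<longlongrightarrow> l) (at_left s)" using assms unfolding cadlag_def by blast
  then show ?thesis using tendsto_Lim[of "at_left s" x l] by simp
qed

lemma cadlag_continuous_right:
  assumes "cadlag x" "0 \<le> s"
  shows "continuous (at s within {s..}) x"
  using assms by (auto simp: cadlag_def continuous_within at_within_Ici_at_right)

text \<open>The values to the right of \<open>s\<close> are all close to \<open>x s\<close>, those to the left are all close to the left
  limit; only crossing \<open>s\<close> from left to right can cost more than \<open>e\<close>.\<close>
lemma cadlag_local_oscillation: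
  fixes x :: "real \<Rightarrow> 'b::real_normed_vector"
  assumes x: "cadlag x" and s: "0 \<le> s" and e: "0 < e"
  obtains d where "0 < d"
    "\<And>r r'. r \<in> {s..<s+d} \<Longrightarrow> r' \<in> {s..<s+d} \<Longrightarrow> norm (x r - x r') \<le> e"
    "\<And>r r'. 0 \<le> r \<Longrightarrow> 0 \<le> r' \<Longrightarrow> r \<in> {s-d<..<s} \<Longrightarrow> r' \<in> {s-d<..<s} \<Longrightarrow> norm (x r - x r') \<le> e"
proof -
  have close: "norm (a - b) \<le> e" if "dist a l < e/2" "dist b l < e/2" for a b l :: 'b
    using dist_triangle_half_l[of a l e b] that by (simp add: dist_norm dist_commute)
  have "eventually (\<lambda>r. dist (x r) (x s) < e/2) (at_right s)"
    using x s e by (intro tendstoD) (auto simp: cadlag_def)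
  then obtain b where b: "b > s" "\<And>y. s < y \<Longrightarrow> y < b \<Longrightarrow> dist (x y) (x s) < e/2"
    by (auto simp: eventually_at_right[of s "s+1"])
  have b': "dist (x y) (x s) < e/2" if "s \<le> y" "y < b" for y
    using b(2)[of y] that e by (cases "y = s") auto
  obtain a where a: "a < s" "\<And>r r'. 0 \<le> r \<Longrightarrow> 0 \<le> r' \<Longrightarrow> r \<in> {a<..<s} \<Longrightarrow> r' \<in> {a<..<s} \<Longrightarrow> norm (x r - x r') \<le> e"
  proof (cases "s = 0")
    case True
    then show ?thesis by (intro that[of "-1"]) auto
  next
    case False
    then have "0 < s" using s by simp
    have "eventually (\<lambda>r. dist (x r) (Lim (at_left s) x) < e/2) (at_left s)"
      using cadlag_tendsto_left[OF x \<open>0 < s\<close>] e by (intro tendstoD) auto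
    then obtain a where a: "a < s" "\<And>y. a < y \<Longrightarrow> y < s \<Longrightarrow> dist (x y) (Lim (at_left s) x) < e/2"
      by (auto simp: eventually_at_left[of "s-1" s])
    then show ?thesis by (intro that[of a] close[of _ "Lim (at_left s) x"]) auto
  qed
  define d where "d = min (b - s) (s - a)"
  show ?thesis
  proof (rule that[of d])
    show "0 < d" using a b by (simp add: d_def)
    show "norm (x r - x r') \<le> e" if "r \<in> {s..<s+d}" "r' \<in> {s..<s+d}" for r r'
      using that by (intro close[of _ "x s"] b') (auto simp: d_def)
    show "norm (x r - x r') \<le> e" if "0 \<le> r" "0 \<le> r'" "r \<in> {s-d<..<s}" "r' \<in> {s-d<..<s}" for r r'
      using that by (intro a(2)) (auto simp: d_def)
  qed
qed

text \<open>By compactness finitely many of the neighbourhoods above cover \<open>[0, 1]\<close>, and \<open>T\<close> collects their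
  centres. Below the Lebesgue number of the cover, a grid cell lies in one neighbourhood, and unless
  it contains the centre its endpoints lie on the same side of it.\<close>
lemma cadlag_grid_oscillation:
  fixes x :: "real \<Rightarrow> 'b::real_normed_vector"
  assumes x: "cadlag x" and e: "0 < e"
  obtains T where "finite T" "T \<subseteq> {0<..1}"
    "\<And>s. 0 < s \<Longrightarrow> s \<le> 1 \<Longrightarrow> s \<notin> T \<Longrightarrow> norm (path_jump x s) \<le> e"
    "\<forall>\<^sub>F n in sequentially. \<forall>i<n. T \<inter> {real i / real n<..real (Suc i) / real n} = {} \<longrightarrow>
        norm (grid_increment x n i) \<le> e"
proof -
  have "\<forall>s\<in>{0..1}. \<exists>d>0. (\<forall>r\<in>{s..<s+d}. \<forall>r'\<in>{s..<s+d}. norm (x r - x r') \<le> e) \<and>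
     (\<forall>r\<in>{s-d<..<s}. \<forall>r'\<in>{s-d<..<s}. 0 \<le> r \<longrightarrow> 0 \<le> r' \<longrightarrow> norm (x r - x r') \<le> e)"
    proof
    fix s :: real assume "s \<in> {0..1}"
    then obtain d where "0 < d"
      "\<And>r r'. r \<in> {s..<s+d} \<Longrightarrow> r' \<in> {s..<s+d} \<Longrightarrow> norm (x r - x r') \<le> e"
      "\<And>r r'. 0 \<le> r \<Longrightarrow> 0 \<le> r' \<Longrightarrow> r \<in> {s-d<..<s} \<Longrightarrow> r' \<in> {s-d<..<s} \<Longrightarrow> norm (x r - x r') \<le> e"
      using cadlag_local_oscillation[OF x _ e, of s] by auto
    then show "\<exists>d>0. (\<forall>r\<in>{s..<s+d}. \<forall>r'\<in>{s..<s+d}. norm (x r - x r') \<le> e) \<and>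
     (\<forall>r\<in>{s-d<..<s}. \<forall>r'\<in>{s-d<..<s}. 0 \<le> r \<longrightarrow> 0 \<le> r' \<longrightarrow> norm (x r - x r') \<le> e)"
      by blast
  qed
  then obtain d where d': "\<And>s. s \<in> {0..1} \<Longrightarrow> 0 < d s \<and>
     (\<forall>r\<in>{s..<s+d s}. \<forall>r'\<in>{s..<s+d s}. norm (x r - x r') \<le> e) \<and>
     (\<forall>r\<in>{s-d s<..<s}. \<forall>r'\<in>{s-d s<..<s}. 0 \<le> r \<longrightarrow> 0 \<le> r' \<longrightarrow> norm (x r - x r') \<le> e)"
    unfolding bchoice_iff by blast
  have d: "\<And>s. s \<in> {0..1} \<Longrightarrow> 0 < d s"
    "\<And>s r r'. s \<in> {0..1} \<Longrightarrow> r \<in> {s..<s+d s} \<Longrightarrow> r' \<in> {s..<s+d s} \<Longrightarrow> norm (x r - x r') \<le> e"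
    "\<And>s r r'. s \<in> {0..1} \<Longrightarrow> r \<in> {s-d s<..<s} \<Longrightarrow> r' \<in> {s-d s<..<s} \<Longrightarrow> 0 \<le> r \<Longrightarrow> 0 \<le> r'
       \<Longrightarrow> norm (x r - x r') \<le> e"
    using d' by blast+
  obtain S where S: "S \<subseteq> {0..1}" "finite S" "{0..1} \<subseteq> (\<Union>s\<in>S. {s - d s<..<s + d s})"
    using compactE_image[of "{0..1::real}" "{0..1}" "\<lambda>s. {s - d s<..<s + d s}"] d(1)
    by (force intro: compact_Icc)
  have "S \<noteq> {}" using S(3) by force
  obtain l where l: "0 < l" "\<And>A. A \<subseteq> {0..1} \<Longrightarrow> diameter A < l \<Longrightarrow> \<exists>s\<in>S. A \<subseteq> {s - d s<..<s + d s}"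
  proof (rule Lebesgue_number_lemma[of "{0..1::real}" "(\<lambda>s. {s - d s<..<s + d s}) ` S"])
    show "\<And>B. B \<in> (\<lambda>s. {s - d s<..<s + d s}) ` S \<Longrightarrow> open B" by auto
  qed (use S \<open>S \<noteq> {}\<close> in auto)
  show ?thesis
  proof (rule that[of "S \<inter> {0<..1}"])
    show "norm (path_jump x t) \<le> e" if t: "0 < t" "t \<le> 1" "t \<notin> S \<inter> {0<..1}" for t
    proof -
      have "t \<in> (\<Union>s\<in>S. {s - d s<..<s + d s})" using t by (intro subsetD[OF S(3)]) simp
      then obtain s where s: "s \<in> S" "t \<in> {s - d s<..<s + d s}" by blast
      have "s \<in> {0..1}" using s(1) S(1) by (rule subsetD[rotated])
      have "t \<noteq> s" using s(1) t by (metis IntI greaterThanAtMost_iff)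
      have "\<forall>\<^sub>F r in at_left t. norm (x t - x r) \<le> e"
      proof (cases "s < t")
        case True
        have "\<forall>\<^sub>F r in at_left t. r \<in> {s<..<t}" using True by (rule eventually_at_left_real)
        then show ?thesis
          by eventually_elim (use True s \<open>s \<in> {0..1}\<close> in \<open>auto intro!: d(2)[of s]\<close>)
      next
        case False
        have "\<forall>\<^sub>F r in at_left t. r \<in> {max 0 (s - d s)<..<t}"
          using s t by (intro eventually_at_left_real) auto
        then show ?thesis
          by eventually_elim (use False \<open>t \<noteq> s\<close> s \<open>s \<in> {0..1}\<close> in \<open>auto intro!: d(3)[of s]\<close>)
      qed
      moreover have "((\<lambda>r. norm (x t - x r)) \<longlongrightarrow> norm (path_jump x t)) (at_left t)"
        unfolding path_jump_def by (intro tendsto_intros cadlag_tendsto_left x t)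
      ultimately show ?thesis by (intro tendsto_upperbound[where F = "at_left t"]) simp_all
    qed
    have "\<forall>\<^sub>F n in sequentially. 1 / real n < l"
      using l(1) by (intro order_tendstoD[OF lim_1_over_n])
    then show "\<forall>\<^sub>F n in sequentially. \<forall>i<n. (S \<inter> {0<..1}) \<inter> {real i / real n<..real (Suc i) / real n} = {} \<longrightarrow>
        norm (grid_increment x n i) \<le> e"
    proof eventually_elim
      case (elim n)
      show ?case
      proof (intro allI impI)
        fix i assume i: "i < n" "(S \<inter> {0<..1}) \<inter> {real i / real n<..real (Suc i) / real n} = {}"
        define a b where "a = real i / real n" and "b = real (Suc i) / real n"
        have n: "0 < n" using i by simp
        have ab: "0 \<le> a" "a \<le> b" "b \<le> 1" "b - a = 1 / real n"
          using i n by (auto simp: a_def b_def divide_simps)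
        obtain s where s: "s \<in> S" "{a..b} \<subseteq> {s - d s<..<s + d s}"
          using l(2)[of "{a..b}"] ab elim by auto
        have s01: "s \<in> {0..1}" using s(1) S(1) by blast
        have "a \<in> {a..b}" "b \<in> {a..b}" using ab by auto
        then have in': "a \<in> {s - d s<..<s + d s}" "b \<in> {s - d s<..<s + d s}" using s by auto
        have "s \<notin> {a<..b}" using i(2) s(1) s01 ab unfolding a_def[symmetric] b_def[symmetric] by force
        then consider "s \<le> a" | "b < s" by force
        then have "norm (x b - x a) \<le> e"
        proof cases
          case 1
          then show ?thesis using in' ab by (intro d(2)[OF s01]) auto
        next
          case 2
          then show ?thesis using in' ab by (intro d(3)[OF s01]) auto
        qed
        then show "norm (grid_increment x n i) \<le> e" by (simp add: grid_increment_def a_def b_def)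
      qed
    qed
  qed (use S(2) in auto)
qed

text \<open>The number \<open>nat \<lceil>n * s\<rceil> - 1\<close> is the index \<open>i\<close> of the cell \<open>(i/n, (i+1)/n]\<close> that contains \<open>s\<close>.\<close>
lemma grid_index_bounds:
  assumes "0 < n" "0 < s"
  shows "real (nat \<lceil>real n * s\<rceil> - 1) < real n * s" "real n * s \<le> real (nat \<lceil>real n * s\<rceil> - 1) + 1"
proof -
  have "0 < real n * s" using assms by simp
  then have "0 < \<lceil>real n * s\<rceil>" by simp
  then have "int (nat \<lceil>real n * s\<rceil> - 1) + 1 = \<lceil>real n * s\<rceil>" by linarith
  then have "real (nat \<lceil>real n * s\<rceil> - 1) + 1 = of_int \<lceil>real n * s\<rceil>" by linarith
  then show "real (nat \<lceil>real n * s\<rceil> - 1) < real n * s" "real n * s \<le> real (nat \<lceil>real n * s\<rceil> - 1) + 1"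
    by linarith+
qed

text \<open>The cell containing \<open>s\<close> is open on the left and closed on the right, so its left endpoint approaches \<open>s\<close>
  strictly from below and its right endpoint from above or at \<open>s\<close>.\<close>
lemma cadlag_grid_increment_tendsto_jump:
  fixes x :: "real \<Rightarrow> 'b::real_normed_vector"
  assumes x: "cadlag x" and s: "0 < s"
  shows "(\<lambda>n. grid_increment x n (nat \<lceil>real n * s\<rceil> - 1)) \<longlonglongrightarrow> path_jump x s"
proof -
  define j where "j n = nat \<lceil>real n * s\<rceil> - 1" for n
  have j: "real (j n) / real n < s" "s \<le> real (Suc (j n)) / real n" "s - 1 / real n \<le> real (j n) / real n"
    "real (Suc (j n)) / real n \<le> s + 1 / real n" if "n > 0" for n
  proof -
    have "real n * s \<le> real (j n) + 1" "real (j n) < real n * s"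
      using grid_index_bounds[OF that s] by (simp_all add: j_def)
    then show "real (j n) / real n < s" "s \<le> real (Suc (j n)) / real n" "s - 1 / real n \<le> real (j n) / real n"
    "real (Suc (j n)) / real n \<le> s + 1 / real n" using that by (simp_all add: pos_divide_less_eq pos_le_divide_eq pos_divide_le_eq left_diff_distrib distrib_right mult.commute[of s])
  qed
  have "\<forall>\<^sub>F n in sequentially. n > (0::nat)" by (rule eventually_gt_at_top)
  note ev = eventually_mono[OF this]
  have "(\<lambda>n. real (j n) / real n) \<longlonglongrightarrow> s"
  proof (rule tendsto_sandwich[OF _ _ _ tendsto_const])
    show "(\<lambda>n. s - 1 / real n) \<longlonglongrightarrow> s" by (rule tendsto_eq_intros lim_1_over_n refl)+ simp
    show "\<forall>\<^sub>F n in sequentially. s - 1 / real n \<le> real (j n) / real n" by (rule ev) (rule j)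
    show "\<forall>\<^sub>F n in sequentially. real (j n) / real n \<le> s" by (rule ev) (rule less_imp_le[OF j(1)])
  qed
  then have "filterlim (\<lambda>n. real (j n) / real n) (at_left s) sequentially"
    unfolding filterlim_at using j by (auto intro!: ev)
  with cadlag_tendsto_left[OF x s] have left: "(\<lambda>n. x (real (j n) / real n)) \<longlonglongrightarrow> Lim (at_left s) x"
    by (rule filterlim_compose)
  \<comment> \<open>The value at \<open>n = 0\<close>, where the grid point is \<open>0\<close>, is changed so that \<open>b n \<ge> s\<close> for all \<open>n\<close>.\<close>
  define b where "b n = (if n = 0 then s else real (Suc (j n)) / real n)" for n
  have b: "b n = real (Suc (j n)) / real n" if "n > 0" for n using that by (simp add: b_def)
  have "b \<longlonglongrightarrow> s"
  proof (rule tendsto_sandwich[OF _ _ tendsto_const])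
    show "(\<lambda>n. s + 1 / real n) \<longlonglongrightarrow> s" by (rule tendsto_eq_intros lim_1_over_n refl)+ simp
    show "\<forall>\<^sub>F n in sequentially. s \<le> b n" by (rule ev, subst b) (use j in auto)
    show "\<forall>\<^sub>F n in sequentially. b n \<le> s + 1 / real n" by (rule ev, subst b) (use j in auto)
  qed
  moreover have "b n \<in> {s..}" for n
    using j(2)[of n] b[of n] by (cases "n = 0") (auto simp: b_def)
  ultimately have "(\<lambda>n. x (b n)) \<longlonglongrightarrow> x s"
    using continuous_within_tendsto_compose'[OF cadlag_continuous_right[OF x less_imp_le[OF s]]] by blast
  moreover have "\<forall>\<^sub>F n in sequentially. x (b n) = x (real (Suc (j n)) / real n)"
    by (rule ev) (simp add: b)
  ultimately have right: "(\<lambda>n. x (real (Suc (j n)) / real n)) \<longlonglongrightarrow> x s"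
    by (rule Lim_transform_eventually)
  show ?thesis
    using tendsto_diff[OF right left] unfolding grid_increment_def path_jump_def j_def .
qed

text \<open>For a fine grid the points of \<open>T\<close> lie in different cells, the other cells contribute nothing
  because their increments have norm at most \<open>e\<close>, and the increment over the cell of \<open>s\<close> converges
  to the jump at \<open>s\<close>. The set \<open>T\<close> serves all \<open>f\<close> at once and may contain times without a jump.\<close>
lemma cadlag_grid_sums:
  fixes x :: "real \<Rightarrow> 'b::real_normed_vector"
  assumes x: "cadlag x" and e: "0 < e"
  obtains T where "finite T" "T \<subseteq> {0<..1}"
    "\<And>s. 0 < s \<Longrightarrow> s \<le> 1 \<Longrightarrow> s \<notin> T \<Longrightarrow> norm (path_jump x s) \<le> e"
    "\<And>f :: 'b \<Rightarrow> real. continuous_on UNIV f \<Longrightarrow> (\<And>y. norm y \<le> e \<Longrightarrow> f y = 0) \<Longrightarrow>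
       (\<lambda>n. \<Sum>i<n. f (grid_increment x n i)) \<longlonglongrightarrow> (\<Sum>s\<in>T. f (path_jump x s))"
proof -
  obtain T where T: "finite T" "T \<subseteq> {0<..1}"
    "\<And>s. 0 < s \<Longrightarrow> s \<le> 1 \<Longrightarrow> s \<notin> T \<Longrightarrow> norm (path_jump x s) \<le> e"
    "\<forall>\<^sub>F n in sequentially. \<forall>i<n. T \<inter> {real i / real n<..real (Suc i) / real n} = {} \<longrightarrow>
        norm (grid_increment x n i) \<le> e"
    by (rule cadlag_grid_oscillation[OF x e]) (rule that)
  have sep: "\<forall>\<^sub>F n in sequentially. \<forall>s\<in>T. \<forall>t\<in>T. s \<noteq> t \<longrightarrow> 1 / real n < \<bar>s - t\<bar>"
  proof (intro eventually_ball_finite ballI T)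
    fix s t
    show "\<forall>\<^sub>F n in sequentially. s \<noteq> t \<longrightarrow> 1 / real n < \<bar>s - t\<bar>"
      using order_tendstoD(2)[OF lim_1_over_n, of "\<bar>s-t\<bar>"] by (cases "s = t") auto
  qed
  show ?thesis
  proof (rule that[OF T(1-3)])
    fix f :: "'b \<Rightarrow> real"
    assume f: "continuous_on UNIV f" "\<And>y. norm y \<le> e \<Longrightarrow> f y = 0"
    define j where "j n s = nat \<lceil>real n * s\<rceil> - 1" for n s
    have "(\<lambda>n. \<Sum>s\<in>T. f (grid_increment x n (j n s))) \<longlonglongrightarrow> (\<Sum>s\<in>T. f (path_jump x s))"
      unfolding j_def using T(2) f(1)
      by (intro tendsto_sum continuous_on_tendsto_compose[OF f(1)] cadlag_grid_increment_tendsto_jump x) auto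
    moreover have "\<forall>\<^sub>F n in sequentially.
       (\<Sum>s\<in>T. f (grid_increment x n (j n s))) = (\<Sum>i<n. f (grid_increment x n i))"
      using T(4) sep eventually_gt_at_top[of 0]
    proof eventually_elim
      case (elim n)
      have j: "real (j n s) < real n * s" "real n * s \<le> real (j n s) + 1" if "s \<in> T" for s
      proof -
        have "0 < s" using that T(2) by auto
        then show "real (j n s) < real n * s" "real n * s \<le> real (j n s) + 1"
          using grid_index_bounds[of n s] elim(3) by (simp_all add: j_def)
      qed
      have inj: "inj_on (j n) T"
      proof (rule inj_onI, rule ccontr)
        fix s t assume *: "s \<in> T" "t \<in> T" "j n s = j n t" "s \<noteq> t"
        then have "1 < real n * \<bar>s - t\<bar>" using elim(2,3) by (auto simp: field_simps)
        moreover have "real n * \<bar>s - t\<bar> = \<bar>real n * s - real n * t\<bar>"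
          by (simp add: abs_mult flip: right_diff_distrib)
        ultimately show False using j[OF *(1)] j[OF *(2)] *(3) by linarith
      qed
      have range: "j n s < n" if "s \<in> T" for s
      proof -
        have "real n * s \<le> real n * 1" using that T(2) by (intro mult_left_mono) auto
        then show ?thesis using j(1)[OF that] by linarith
      qed
      have "(\<Sum>s\<in>T. f (grid_increment x n (j n s))) = (\<Sum>i\<in>j n ` T. f (grid_increment x n i))"
        using inj by (simp add: sum.reindex)
      also have "\<dots> = (\<Sum>i<n. f (grid_increment x n i))"
      proof (rule sum.mono_neutral_left)
        show "\<forall>i\<in>{..<n} - j n ` T. f (grid_increment x n i) = 0"
        proof
          fix i assume i: "i \<in> {..<n} - j n ` T"
          have "T \<inter> {real i / real n<..real (Suc i) / real n} = {}"
          proof (rule ccontr)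
            assume "\<not> ?thesis"
            then obtain s where s: "s \<in> T" "real i / real n < s" "s \<le> real (Suc i) / real n" by auto
            then have "real i < real n * s" "real n * s \<le> real i + 1" using elim(3) by (simp_all add: field_simps)
            then have "i = j n s" using j[OF s(1)] by linarith
            then show False using i s(1) by auto
          qed
          then show "f (grid_increment x n i) = 0" using elim(1) i f(2) by auto
        qed
      qed (use range in auto)
      finally show ?case .
    qed
    ultimately show "(\<lambda>n. \<Sum>i<n. f (grid_increment x n i)) \<longlonglongrightarrow> (\<Sum>s\<in>T. f (path_jump x s))"
      by (rule Lim_transform_eventually)
  qed
qed

section \<open>Evaluation of paths and independence\<close>

text \<open>Evaluation \<open>(p, r) \<mapsto> p r\<close> is not measurable on the product space of all paths. This limit along dyadic
  times strictly to the right of \<open>r\<close> is measurable, and it agrees with evaluation on cadlag paths.\<close>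
definition path_eval :: "(real \<Rightarrow> 'b::{banach, second_countable_topology}) \<Rightarrow> real \<Rightarrow> 'b" where
  "path_eval p r = lim (\<lambda>n. p (real (Suc (nat \<lfloor>2^n * r\<rfloor>)) / 2^n))"

lemma path_eval_cadlag:
  assumes x: "cadlag x" and r: "0 \<le> r"
  shows "path_eval (restrict x {0..}) r = x r"
proof -
  define q where "q n = real (Suc (nat \<lfloor>2^n * r\<rfloor>)) / 2^n" for n
  have q: "r < q n" "q n \<le> r + (1/2)^n" for n
  proof -
    have "0 \<le> 2^n * r" using r by simp
    then have "real (nat \<lfloor>2^n * r\<rfloor>) = of_int \<lfloor>2^n * r\<rfloor>" by simp
    then have "2^n * r < real (Suc (nat \<lfloor>2^n * r\<rfloor>))" "real (Suc (nat \<lfloor>2^n * r\<rfloor>)) \<le> 2^n * r + 1"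
      by linarith+
    then show "r < q n" "q n \<le> r + (1/2)^n" by (simp_all add: q_def field_simps del: of_nat_Suc)
  qed
  have "q \<longlonglongrightarrow> r"
  proof (rule tendsto_sandwich[OF _ _ tendsto_const])
    have "(\<lambda>n. r + (1/2)^n) \<longlonglongrightarrow> r + 0" by (intro tendsto_intros LIMSEQ_power_zero) auto
    then show "(\<lambda>n. r + (1/2)^n) \<longlonglongrightarrow> r" by simp
    show "\<forall>\<^sub>F n in sequentially. r \<le> q n" by (rule always_eventually) (simp add: q less_imp_le)
    show "\<forall>\<^sub>F n in sequentially. q n \<le> r + (1/2)^n" by (rule always_eventually) (simp add: q)
  qed
  moreover have "continuous (at r within {r..}) x"
    using x r by (auto simp: cadlag_def continuous_within at_within_Ici_at_right)
  ultimately have "(\<lambda>n. x (q n)) \<longlonglongrightarrow> x r"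
    using continuous_within_tendsto_compose'[of r "{r..}" x q] q(1) by (auto intro: less_imp_le)
  moreover have "restrict x {0..} (q n) = x (q n)" for n using q(1)[of n] r by auto
  ultimately show ?thesis unfolding path_eval_def q_def[symmetric] by (simp add: limI)
qed

lemma measurable_path_eval [measurable]:
  "(\<lambda>z :: (real \<Rightarrow> 'b::{banach, second_countable_topology}) \<times> real. path_eval (fst z) (snd z)) \<in> borel_measurable (path_space \<Otimes>\<^sub>M borel)"
  unfolding path_eval_def
proof (rule borel_measurable_lim_metric)
  fix n
  show "(\<lambda>z :: (real \<Rightarrow> 'b) \<times> real. fst z (real (Suc (nat \<lfloor>2^n * snd z\<rfloor>)) / 2^n)) \<in> borel_measurable (path_space \<Otimes>\<^sub>M borel)"
    by (rule measurable_compose_countable[where f = "\<lambda>k z. fst z (real (Suc k) / 2^n)" and g = "\<lambda>z. nat \<lfloor>(2::real)^n * snd z\<rfloor>"])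
      (auto intro!: measurable_compose[OF measurable_fst measurable_component_singleton])
qed

lemma measurable_process_path [measurable]:
  assumes "\<And>t. 0 \<le> t \<Longrightarrow> X t \<in> borel_measurable M"
  shows "process_path X \<in> M \<rightarrow>\<^sub>M path_space"
  unfolding process_path_def using assms by (intro measurable_restrict) auto

text \<open>Independence of the generated sigma-algebras, in the form needed for Fubini: one process as a
  whole against the value of the other at one time.\<close>
lemma (in prob_space) indep_processes_joint_distr:
  fixes X :: "real \<Rightarrow> 'a \<Rightarrow> 'b::topological_space" and Y :: "real \<Rightarrow> 'a \<Rightarrow> 'c::topological_space"
  assumes X: "\<And>t. 0 \<le> t \<Longrightarrow> X t \<in> borel_measurable M" and Y: "\<And>t. 0 \<le> t \<Longrightarrow> Y t \<in> borel_measurable M"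
    and ind: "indep_processes M X Y" and t: "0 \<le> t"
  shows "distr M (path_space \<Otimes>\<^sub>M borel) (\<lambda>\<omega>. (process_path X \<omega>, Y t \<omega>)) =
    distr M path_space (process_path X) \<Otimes>\<^sub>M distr M borel (Y t)"
proof -
  note [measurable] = measurable_process_path[OF X] Y[OF t]
  interpret P: prob_space "distr M path_space (process_path X)" by (rule prob_space_distr) measurable
  interpret Q: prob_space "distr M borel (Y t)" by (rule prob_space_distr) measurable
  show ?thesis
  proof (rule pair_measure_eqI[symmetric])
    fix A B assume "A \<in> sets (distr M path_space (process_path X))" "B \<in> sets (distr M borel (Y t))"
    then have [measurable]: "A \<in> sets path_space" "B \<in> sets borel" by auto
    let ?B = "{p \<in> space path_space. p t \<in> B}"
    have [measurable]: "?B \<in> sets path_space"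
      using t by (auto intro!: measurable_sets_Collect[OF measurable_component_singleton])
    have eq: "process_path Y -` ?B \<inter> space M = Y t -` B \<inter> space M"
      using t by (auto simp: process_path_def space_PiM)
    have "prob ((process_path X -` A \<inter> space M) \<inter> (process_path Y -` ?B \<inter> space M)) =
        prob (process_path X -` A \<inter> space M) * prob (process_path Y -` ?B \<inter> space M)"
      using ind unfolding indep_processes_def
      by (rule indep_setD) (use \<open>A \<in> sets path_space\<close> \<open>?B \<in> sets path_space\<close> in blast)+
    then have "prob ((process_path X -` A \<inter> space M) \<inter> (Y t -` B \<inter> space M)) =
        prob (process_path X -` A \<inter> space M) * prob (Y t -` B \<inter> space M)"
      unfolding eq .
    moreover have "(process_path X -` A \<inter> space M) \<inter> (Y t -` B \<inter> space M) =
       (\<lambda>\<omega>. (process_path X \<omega>, Y t \<omega>)) -` (A \<times> B) \<inter> space M" by auto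
    ultimately show "emeasure (distr M path_space (process_path X)) A * emeasure (distr M borel (Y t)) B =
       emeasure (distr M (path_space \<Otimes>\<^sub>M borel) (\<lambda>\<omega>. (process_path X \<omega>, Y t \<omega>))) (A \<times> B)"
      by (simp add: emeasure_distr emeasure_eq_measure flip: ennreal_mult'')
  qed (auto simp: P.sigma_finite_measure_axioms Q.sigma_finite_measure_axioms)
qed

lemma (in prob_space) nn_integral_product_distr:
  assumes [measurable]: "A \<in> M \<rightarrow>\<^sub>M S" "B \<in> M \<rightarrow>\<^sub>M T"
    and joint: "distr M (S \<Otimes>\<^sub>M T) (\<lambda>\<omega>. (A \<omega>, B \<omega>)) = distr M S A \<Otimes>\<^sub>M distr M T B"
    and G [measurable]: "case_prod G \<in> borel_measurable (S \<Otimes>\<^sub>M T)"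
  shows "(\<integral>\<^sup>+ \<omega>. G (A \<omega>) (B \<omega>) \<partial>M) = (\<integral>\<^sup>+ \<omega>'. (\<integral>\<^sup>+ \<omega>. G (A \<omega>) (B \<omega>') \<partial>M) \<partial>M)"
proof -
  interpret P: prob_space "distr M S A" by (rule prob_space_distr) measurable
  interpret Q: prob_space "distr M T B" by (rule prob_space_distr) measurable
  interpret PQ: pair_sigma_finite "distr M S A" "distr M T B" ..
  have "(\<integral>\<^sup>+ \<omega>. G (A \<omega>) (B \<omega>) \<partial>M) = (\<integral>\<^sup>+ z. case_prod G z \<partial>distr M (S \<Otimes>\<^sub>M T) (\<lambda>\<omega>. (A \<omega>, B \<omega>)))"
    by (subst nn_integral_distr) auto
  also have "\<dots> = (\<integral>\<^sup>+ y. (\<integral>\<^sup>+ p. case_prod G (p, y) \<partial>distr M S A) \<partial>distr M T B)"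
    unfolding joint by (intro PQ.nn_integral_snd[symmetric]) auto
  also have "\<dots> = (\<integral>\<^sup>+ \<omega>'. (\<integral>\<^sup>+ p. G p (B \<omega>') \<partial>distr M S A) \<partial>M)"
    by (simp add: nn_integral_distr)
  also have "\<dots> = (\<integral>\<^sup>+ \<omega>'. (\<integral>\<^sup>+ \<omega>. G (A \<omega>) (B \<omega>') \<partial>M) \<partial>M)"
  proof (rule nn_integral_cong)
    fix \<omega>' assume "\<omega>' \<in> space M"
    then have "B \<omega>' \<in> space T" by (rule measurable_space[OF assms(2)])
    then have "(\<lambda>p. G p (B \<omega>')) \<in> borel_measurable S" using measurable_Pair2[OF G] by simp
    then show "(\<integral>\<^sup>+ p. G p (B \<omega>') \<partial>distr M S A) = (\<integral>\<^sup>+ \<omega>. G (A \<omega>) (B \<omega>') \<partial>M)"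
      by (subst nn_integral_distr) auto
  qed
  finally show ?thesis .
qed

lemma (in prob_space) integral_product_distr:
  fixes G :: "'c \<Rightarrow> 'd \<Rightarrow> 'e::{banach, second_countable_topology}"
  assumes [measurable]: "A \<in> M \<rightarrow>\<^sub>M S" "B \<in> M \<rightarrow>\<^sub>M T"
    and joint: "distr M (S \<Otimes>\<^sub>M T) (\<lambda>\<omega>. (A \<omega>, B \<omega>)) = distr M S A \<Otimes>\<^sub>M distr M T B"
    and G [measurable]: "case_prod G \<in> borel_measurable (S \<Otimes>\<^sub>M T)"
    and int: "integrable M (\<lambda>\<omega>. G (A \<omega>) (B \<omega>))"
  shows "(\<integral> \<omega>. G (A \<omega>) (B \<omega>) \<partial>M) = (\<integral> \<omega>'. (\<integral> \<omega>. G (A \<omega>) (B \<omega>') \<partial>M) \<partial>M)"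
proof -
  interpret P: prob_space "distr M S A" by (rule prob_space_distr) measurable
  interpret Q: prob_space "distr M T B" by (rule prob_space_distr) measurable
  interpret PQ: pair_sigma_finite "distr M S A" "distr M T B" ..
  have J: "integrable (distr M S A \<Otimes>\<^sub>M distr M T B) (case_prod G)"
    unfolding joint[symmetric] using int by (subst integrable_distr_eq) auto
  have "(\<integral> \<omega>. G (A \<omega>) (B \<omega>) \<partial>M) = (\<integral> z. case_prod G z \<partial>distr M (S \<Otimes>\<^sub>M T) (\<lambda>\<omega>. (A \<omega>, B \<omega>)))"
    by (subst integral_distr) auto
  also have "\<dots> = (\<integral> y. (\<integral> p. G p y \<partial>distr M S A) \<partial>distr M T B)"
    unfolding joint using J by (rule PQ.integral_snd[symmetric])
  also have "\<dots> = (\<integral> \<omega>'. (\<integral> p. G p (B \<omega>') \<partial>distr M S A) \<partial>M)"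
    by (simp add: integral_distr)
  also have "\<dots> = (\<integral> \<omega>'. (\<integral> \<omega>. G (A \<omega>) (B \<omega>') \<partial>M) \<partial>M)"
  proof (rule Bochner_Integration.integral_cong)
    fix \<omega>' assume "\<omega>' \<in> space M"
    then have "B \<omega>' \<in> space T" by (rule measurable_space[OF assms(2)])
    then have "(\<lambda>p. G p (B \<omega>')) \<in> borel_measurable S" using measurable_Pair2[OF G] by simp
    then show "(\<integral> p. G p (B \<omega>') \<partial>distr M S A) = (\<integral> \<omega>. G (A \<omega>) (B \<omega>') \<partial>M)"
      by (subst integral_distr) auto
  qed simp
  finally show ?thesis .
qed

section \<open>The jump measure and the Levy measure\<close>

text \<open>The image of counting measure on the jump times in \<open>(0, 1]\<close>; the Levy measure is the mean of this
  random measure.\<close>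
definition jump_measure :: "(real \<Rightarrow> 'b::real_normed_vector) \<Rightarrow> 'b measure" where
  "jump_measure x = distr (count_space {s. 0 < s \<and> s \<le> 1 \<and> path_jump x s \<noteq> 0}) borel (path_jump x)"

lemma sets_jump_measure [simp, measurable_cong]: "sets (jump_measure x) = sets borel"
  by (simp add: jump_measure_def)

lemma space_jump_measure [simp]: "space (jump_measure x) = UNIV"
  by (simp add: jump_measure_def)

lemma borel_measurable_sets_eq_borel:
  "sets N = sets borel \<Longrightarrow> f \<in> borel_measurable borel \<Longrightarrow> f \<in> borel_measurable N"
  using measurable_cong_sets[of N borel borel borel] by simp

lemma emeasure_jump_measure:
  assumes "A \<in> sets borel"
  shows "emeasure (jump_measure x) A = emeasure (count_space UNIV)
    {s. 0 < s \<and> s \<le> 1 \<and> path_jump x s \<noteq> 0 \<and> path_jump x s \<in> A}"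
proof -
  have "path_jump x -` A \<inter> {s. 0 < s \<and> s \<le> 1 \<and> path_jump x s \<noteq> 0} =
      {s. 0 < s \<and> s \<le> 1 \<and> path_jump x s \<noteq> 0 \<and> path_jump x s \<in> A}" by auto
  then show ?thesis
    using assms unfolding jump_measure_def
    by (subst emeasure_distr) (auto, (subst emeasure_count_space, blast)+, simp)
qed

text \<open>Away from \<open>0\<close> only finitely many jumps matter, so an integral against the jump measure is a finite
  sum over any \<open>T\<close> that catches them.\<close>
lemma nn_integral_jump_measure:
  fixes f :: "'b::real_normed_vector \<Rightarrow> ennreal"
  assumes f: "f \<in> borel_measurable borel" "\<And>y. norm y \<le> e \<Longrightarrow> f y = 0" and e: "0 < e"
    and T: "finite T" "T \<subseteq> {0<..1}"
    "\<And>s. 0 < s \<Longrightarrow> s \<le> 1 \<Longrightarrow> s \<notin> T \<Longrightarrow> norm (path_jump x s) \<le> e"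
  shows "(\<integral>\<^sup>+ y. f y \<partial>jump_measure x) = (\<Sum>s\<in>T. f (path_jump x s))"
proof -
  let ?T = "{s\<in>T. path_jump x s \<noteq> 0}"
  have "(\<integral>\<^sup>+ y. f y \<partial>jump_measure x) =
      (\<integral>\<^sup>+ s. f (path_jump x s) \<partial>count_space {s. 0 < s \<and> s \<le> 1 \<and> path_jump x s \<noteq> 0})"
    using f(1) by (simp add: jump_measure_def nn_integral_distr)
  also have "\<dots> = (\<Sum>s\<in>?T. f (path_jump x s))"
    using T f(2) by (intro nn_integral_count_space') auto
  also have "\<dots> = (\<Sum>s\<in>T. f (path_jump x s))"
    using T f(2)[of 0] e by (intro sum.mono_neutral_left) auto
  finally show ?thesis .
qed

lemma emeasure_jump_measure_large_finite:
  fixes x :: "real \<Rightarrow> 'b::real_normed_vector"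
  assumes x: "cadlag x" and e: "0 < e"
  shows "emeasure (jump_measure x) {y. e < norm y} < \<infinity>"
proof -
  obtain T where T: "finite T" "T \<subseteq> {0<..1}"
    "\<And>s. 0 < s \<Longrightarrow> s \<le> 1 \<Longrightarrow> s \<notin> T \<Longrightarrow> norm (path_jump x s) \<le> e"
    by (rule cadlag_grid_oscillation[OF x e]) (rule that)
  have "emeasure (jump_measure x) {y. e < norm y} =
     (\<integral>\<^sup>+ y. indicator {y. e < norm y} y \<partial>jump_measure x)"
    by (intro nn_integral_indicator[symmetric]) simp
  also have "\<dots> = (\<Sum>s\<in>T. indicator {y. e < norm y} (path_jump x s))"
    by (rule nn_integral_jump_measure[OF _ _ e T]) auto
  also have "\<dots> < \<infinity>" using T(1) by (auto simp: indicator_def of_nat_less_top)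
  finally show ?thesis .
qed

lemma grid_sums_tendsto_nn_integral:
  fixes x :: "real \<Rightarrow> 'b::real_normed_vector"
  assumes x: "cadlag x" and e: "0 < e"
    and f: "continuous_on UNIV f" "\<And>y. norm y \<le> e \<Longrightarrow> f y = 0" "\<And>y. 0 \<le> f y"
  shows "(\<lambda>n. \<Sum>i<n. ennreal (f (grid_increment x n i))) \<longlonglongrightarrow> (\<integral>\<^sup>+ y. ennreal (f y) \<partial>jump_measure x)"
proof -
  obtain T where T: "finite T" "T \<subseteq> {0<..1}"
    "\<And>s. 0 < s \<Longrightarrow> s \<le> 1 \<Longrightarrow> s \<notin> T \<Longrightarrow> norm (path_jump x s) \<le> e"
    "\<And>f :: 'b \<Rightarrow> real. continuous_on UNIV f \<Longrightarrow> (\<And>y. norm y \<le> e \<Longrightarrow> f y = 0) \<Longrightarrow>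
       (\<lambda>n. \<Sum>i<n. f (grid_increment x n i)) \<longlonglongrightarrow> (\<Sum>s\<in>T. f (path_jump x s))"
    by (rule cadlag_grid_sums[OF x e]; rule that; auto)
  have [measurable]: "f \<in> borel_measurable borel"
    using f(1) by (rule borel_measurable_continuous_onI)
  have "(\<integral>\<^sup>+ y. ennreal (f y) \<partial>jump_measure x) = (\<Sum>s\<in>T. ennreal (f (path_jump x s)))"
    using f(2) by (intro nn_integral_jump_measure[OF _ _ e T(1-3)]) auto
  moreover have "(\<lambda>n. ennreal (\<Sum>i<n. f (grid_increment x n i))) \<longlonglongrightarrow> ennreal (\<Sum>s\<in>T. f (path_jump x s))"
    by (intro tendsto_ennrealI T(4) f(1,2))
  ultimately show ?thesis using f(3) by (simp add: sum_ennreal)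
qed

locale cadlag_process =
  fixes M :: "'a measure" and X :: "real \<Rightarrow> 'a \<Rightarrow> 'b::{real_normed_vector, second_countable_topology}"
  assumes measurable_X: "0 \<le> t \<Longrightarrow> X t \<in> borel_measurable M"
    and cadlag_X: "\<omega> \<in> space M \<Longrightarrow> cadlag (\<lambda>t. X t \<omega>)"
begin

abbreviation jumps :: "'a \<Rightarrow> 'b measure" where
  "jumps \<omega> \<equiv> jump_measure (\<lambda>t. X t \<omega>)"

lemma measurable_grid_increment [measurable]:
  "(\<lambda>\<omega>. grid_increment (\<lambda>t. X t \<omega>) n i) \<in> borel_measurable M"
  unfolding grid_increment_def by (intro borel_measurable_diff measurable_X) auto

text \<open>The first step to measurability of the jump measure in \<open>\<omega>\<close>: for continuous \<open>f\<close> vanishing near \<open>0\<close> the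
  integral is a limit of grid sums, which are measurable because each of them involves only finitely many times.\<close>
lemma measurable_nn_integral_jumps_continuous:
  assumes e: "0 < e"
    and f: "continuous_on UNIV f" "\<And>y. norm y \<le> e \<Longrightarrow> f y = 0" "\<And>y. 0 \<le> f y"
  shows "(\<lambda>\<omega>. \<integral>\<^sup>+ y. ennreal (f y) \<partial>jumps \<omega>) \<in> borel_measurable M"
proof (rule borel_measurable_LIMSEQ_order)
  have [measurable]: "f \<in> borel_measurable borel"
    using f(1) by (rule borel_measurable_continuous_onI)
  show "(\<lambda>\<omega>. \<Sum>i<n. ennreal (f (grid_increment (\<lambda>t. X t \<omega>) n i))) \<in> borel_measurable M" for n
    by measurable
qed (rule grid_sums_tendsto_nn_integral[OF cadlag_X e f])

lemma measurable_emeasure_jumps_open: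
  assumes e: "0 < e" and U: "open U"
  shows "(\<lambda>\<omega>. emeasure (jumps \<omega>) (U \<inter> {y. e < norm y})) \<in> borel_measurable M"
proof -
  define V where "V = U \<inter> {y::'b. e < norm y}"
  have V: "open V" "0 \<notin> V" unfolding V_def using U e
    by (auto intro!: open_Int open_Collect_less continuous_intros)
  \<comment> \<open>Continuous functions that increase to the indicator of \<open>V\<close>.\<close>
  define f where "f m y = min 1 (real m * infdist y (- V))" for m y
  have f01: "0 \<le> f m y" "f m y \<le> 1" for m y by (auto simp: f_def infdist_nonneg)
  have f_out: "f m y = 0" if "y \<notin> V" for m y using that by (simp add: f_def)
  have f_cont: "continuous_on UNIV (f m)" for m unfolding f_def by (intro continuous_intros)
  have f_mono: "f m y \<le> f n y" if "m \<le> n" for m n y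
    unfolding f_def by (intro min.mono order_refl mult_right_mono) (use that in \<open>auto simp: infdist_nonneg\<close>)
  have f_SUP: "(SUP m. ennreal (f m y)) = indicator V y" for y
  proof (cases "y \<in> V")
    case True
    have "infdist y (- V) \<noteq> 0"
      using in_closed_iff_infdist_zero[of "- V" y] V True by auto
    then have "0 < infdist y (- V)" using infdist_nonneg[of y "- V"] by linarith
    then obtain m where "1 \<le> real m * infdist y (- V)"
      using reals_Archimedean3[of "infdist y (- V)"] by (metis less_imp_le)
    then have "f m y = 1" by (simp add: f_def)
    then have "1 \<le> (SUP m. ennreal (f m y))" by (metis SUP_upper UNIV_I ennreal_1)
    moreover have "(SUP m. ennreal (f m y)) \<le> 1" by (rule SUP_least) (simp add: f01)
    ultimately show ?thesis using True by simp
  qed (simp add: f_out)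
  have "emeasure (jumps \<omega>) V = (SUP m. \<integral>\<^sup>+ y. ennreal (f m y) \<partial>jumps \<omega>)" for \<omega>
  proof -
    have [measurable]: "f m \<in> borel_measurable borel" for m
      using f_cont by (rule borel_measurable_continuous_onI)
    have "emeasure (jumps \<omega>) V = (\<integral>\<^sup>+ y. (SUP m. ennreal (f m y)) \<partial>jumps \<omega>)"
      using V(1) by (simp add: f_SUP nn_integral_indicator)
    also have "\<dots> = (SUP m. \<integral>\<^sup>+ y. ennreal (f m y) \<partial>jumps \<omega>)"
      by (intro nn_integral_monotone_convergence_SUP incseq_SucI le_funI ennreal_leI f_mono)
        (simp_all add: borel_measurable_sets_eq_borel)
    finally show ?thesis .
  qed
  moreover have "(\<lambda>\<omega>. SUP m. \<integral>\<^sup>+ y. ennreal (f m y) \<partial>jumps \<omega>) \<in> borel_measurable M"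
    by (intro borel_measurable_SUP measurable_nn_integral_jumps_continuous[OF e] f_cont f_out f01)
      (auto simp: V_def)
  ultimately show ?thesis unfolding V_def by simp
qed

text \<open>Dynkin's argument from open sets to Borel sets. Complements need a finite measure, which is why jumps
  of norm at most \<open>e\<close> are cut off.\<close>
lemma measurable_emeasure_jumps_large:
  assumes e: "0 < e" and A: "A \<in> sets borel"
  shows "(\<lambda>\<omega>. emeasure (jumps \<omega>) (A \<inter> {y. e < norm y})) \<in> borel_measurable M"
proof -
  let ?W = "{y::'b. e < norm y}"
  have W: "?W \<in> sets borel" by measurable
  have G: "Int_stable {S::'b set. open S}" "{S::'b set. open S} \<subseteq> Pow UNIV"
    by (auto simp: Int_stable_def)
  have "A \<in> sigma_sets UNIV {S. open S}" using A by (simp add: borel_def)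
  with G show ?thesis
  proof (induction A rule: sigma_sets_induct_disjoint)
    case (basic A)
    then show ?case using measurable_emeasure_jumps_open[OF e] by simp
  next
    case empty
    then show ?case by simp
  next
    case (compl A)
    then have A: "A \<in> sets borel" by (simp add: borel_def)
    have "emeasure (jumps \<omega>) ((UNIV - A) \<inter> ?W) = emeasure (jumps \<omega>) (UNIV \<inter> ?W) - emeasure (jumps \<omega>) (A \<inter> ?W)"
      if "\<omega> \<in> space M" for \<omega>
    proof -
      have "emeasure (jumps \<omega>) (A \<inter> ?W) \<le> emeasure (jumps \<omega>) ?W"
        using A W by (intro emeasure_mono) auto
      then have "emeasure (jumps \<omega>) (A \<inter> ?W) \<noteq> \<infinity>"
        using emeasure_jump_measure_large_finite[OF cadlag_X[OF that] e] by (simp add: less_top le_less_trans)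
      then have "emeasure (jumps \<omega>) (?W - A \<inter> ?W) = emeasure (jumps \<omega>) ?W - emeasure (jumps \<omega>) (A \<inter> ?W)"
        using A W by (intro emeasure_Diff) auto
      moreover have "?W - A \<inter> ?W = (UNIV - A) \<inter> ?W" by auto
      ultimately show ?thesis by simp
    qed
    moreover have "(\<lambda>\<omega>. emeasure (jumps \<omega>) (UNIV \<inter> ?W) - emeasure (jumps \<omega>) (A \<inter> ?W)) \<in> borel_measurable M"
      using compl measurable_emeasure_jumps_open[OF e, of UNIV] by (intro borel_measurable_minus_ennreal) auto
    ultimately show ?case by (simp cong: measurable_cong)
  next
    case (union A)
    then have "A i \<in> sigma_sets UNIV {S. open S}" for i by auto
    then have A: "\<And>i. A i \<in> sets borel" by (simp add: borel_def)
    have "emeasure (jumps \<omega>) (\<Union> (range A) \<inter> ?W) = (\<Sum>i. emeasure (jumps \<omega>) (A i \<inter> ?W))" for \<omega>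
    proof -
      have "(\<Sum>i. emeasure (jumps \<omega>) (A i \<inter> ?W)) = emeasure (jumps \<omega>) (\<Union>i. A i \<inter> ?W)"
        using A W union(1) by (intro suminf_emeasure) (auto simp: disjoint_family_on_def)
      moreover have "(\<Union>i. A i \<inter> ?W) = \<Union> (range A) \<inter> ?W" by auto
      ultimately show ?thesis by simp
    qed
    then show ?case using union by simp
  qed
qed

text \<open>The jump measure does not charge \<open>0\<close>, so \<open>A\<close> may be exhausted by the sets of its points of norm
  larger than \<open>1/(k+1)\<close>.\<close>
lemma measurable_emeasure_jumps:
  assumes A: "A \<in> sets borel"
  shows "(\<lambda>\<omega>. emeasure (jumps \<omega>) A) \<in> borel_measurable M"
proof -
  define B where "B k = A \<inter> {y::'b. 1 / real (Suc k) < norm y}" for k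
  have B: "B k \<in> sets borel" for k using A by (simp add: B_def)
  have un: "(\<Union>k. B k) = A - {0}"
  proof (intro equalityI subsetI)
    fix y assume "y \<in> A - {0}"
    then obtain k where "inverse (real (Suc k)) < norm y"
      using reals_Archimedean[of "norm y"] by auto
    then show "y \<in> (\<Union>k. B k)" using \<open>y \<in> A - {0}\<close> by (auto simp: B_def inverse_eq_divide)
  qed (auto simp: B_def)
  have inc: "incseq B"
  proof (rule incseq_SucI)
    show "B k \<le> B (Suc k)" for k
      by (auto simp: B_def elim!: le_less_trans[rotated] intro!: divide_left_mono)
  qed
  have "emeasure (jumps \<omega>) A = (SUP k. emeasure (jumps \<omega>) (B k))" for \<omega>
  proof -
    have "emeasure (jumps \<omega>) A = emeasure (jumps \<omega>) (A - {0})"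
      using A by (subst (1 2) emeasure_jump_measure) (auto intro!: arg_cong2[where f = emeasure])
    also have "\<dots> = (SUP k. emeasure (jumps \<omega>) (B k))"
      unfolding un[symmetric] by (rule SUP_emeasure_incseq[symmetric]) (use B inc in auto)
    finally show ?thesis .
  qed
  moreover have "(\<lambda>\<omega>. SUP k. emeasure (jumps \<omega>) (B k)) \<in> borel_measurable M"
    unfolding B_def by (intro borel_measurable_SUP measurable_emeasure_jumps_large A) auto
  ultimately show ?thesis by simp
qed

lemma sets_levy_measure [simp, measurable_cong]: "sets (levy_measure M X) = sets borel"
  and space_levy_measure [simp]: "space (levy_measure M X) = UNIV"
  unfolding levy_measure_def
  using sets.sigma_sets_eq[of "borel :: 'b measure"] by (simp_all add: sets_measure_of_conv space_measure_of_conv)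

text \<open>The set function that defines the Levy measure is countably additive by monotone convergence,
  once the jump measures of Borel sets are measurable in \<open>\<omega>\<close>.\<close>
lemma emeasure_levy_measure:
  assumes A: "A \<in> sets borel"
  shows "emeasure (levy_measure M X) A = (\<integral>\<^sup>+ \<omega>. emeasure (jumps \<omega>) A \<partial>M)"
proof -
  define \<mu> where "\<mu> A = (\<integral>\<^sup>+ \<omega>. emeasure (count_space UNIV)
        {s. 0 < s \<and> s \<le> 1 \<and> jump X s \<omega> \<noteq> 0 \<and> jump X s \<omega> \<in> A} \<partial>M)" for A
  have \<mu>: "\<mu> A = (\<integral>\<^sup>+ \<omega>. emeasure (jumps \<omega>) A \<partial>M)" if "A \<in> sets borel" for A
    using that by (simp add: \<mu>_def emeasure_jump_measure jump_eq_path_jump)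
  have "emeasure (levy_measure M X) A = \<mu> A"
  proof (rule emeasure_measure_of)
    show "levy_measure M X = measure_of UNIV (sets borel) \<mu>"
      unfolding levy_measure_def \<mu>_def ..
    show "positive (sets (levy_measure M X)) \<mu>" by (simp add: positive_def \<mu>_def)
    show "countably_additive (sets (levy_measure M X)) \<mu>"
    proof (rule countably_additiveI)
      fix B :: "nat \<Rightarrow> 'b set"
      assume B: "range B \<subseteq> sets (levy_measure M X)" "disjoint_family B" "\<Union> (range B) \<in> sets (levy_measure M X)"
      then have B': "B i \<in> sets borel" for i by auto
      have "(\<Sum>i. \<mu> (B i)) = (\<integral>\<^sup>+ \<omega>. (\<Sum>i. emeasure (jumps \<omega>) (B i)) \<partial>M)"
        by (simp add: \<mu> B' nn_integral_suminf measurable_emeasure_jumps)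
      also have "\<dots> = \<mu> (\<Union> (range B))"
        using B by (subst \<mu>) (auto intro!: nn_integral_cong suminf_emeasure)
      finally show "(\<Sum>i. \<mu> (B i)) = \<mu> (\<Union> (range B))" .
    qed
  qed (use A in auto)
  then show ?thesis using A by (simp add: \<mu>)
qed

text \<open>Campbell's formula: integrating against the Levy measure is taking the mean of the sum over the
  jumps. It follows from the case of indicators by linearity and monotone convergence.\<close>
lemma campbell_formula:
  assumes "f \<in> borel_measurable borel"
  shows measurable_nn_integral_jumps: "(\<lambda>\<omega>. \<integral>\<^sup>+ y. f y \<partial>jumps \<omega>) \<in> borel_measurable M" (is "?P f")
    and nn_integral_levy_measure:
      "(\<integral>\<^sup>+ y. f y \<partial>levy_measure M X) = (\<integral>\<^sup>+ \<omega>. (\<integral>\<^sup>+ y. f y \<partial>jumps \<omega>) \<partial>M)" (is "?Q f")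
proof -
  have "?P f \<and> ?Q f" using assms
  proof (induction f rule: borel_measurable_induct)
    case (cong f g)
    then have "f = g" by auto
    then show ?case using cong by simp
  next
    case (set A)
    then show ?case by (simp add: emeasure_levy_measure measurable_emeasure_jumps)
  next
    case (mult u v)
    then have I [measurable]: "(\<lambda>\<omega>. \<integral>\<^sup>+ y. u y \<partial>jumps \<omega>) \<in> borel_measurable M"
      and u: "u \<in> borel_measurable borel" "(\<integral>\<^sup>+ y. u y \<partial>levy_measure M X) = (\<integral>\<^sup>+ \<omega>. (\<integral>\<^sup>+ y. u y \<partial>jumps \<omega>) \<partial>M)"
      by auto
    have lin: "(\<integral>\<^sup>+ y. v * u y \<partial>N) = v * (\<integral>\<^sup>+ y. u y \<partial>N)" if "sets N = sets borel" for N
      by (intro nn_integral_cmult borel_measurable_sets_eq_borel[OF that] u)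
    show ?case
    proof
      show "?P (\<lambda>y. v * u y)" unfolding lin[OF sets_jump_measure] by measurable
      show "?Q (\<lambda>y. v * u y)"
        unfolding lin[OF sets_jump_measure] lin[OF sets_levy_measure] u(2) by (intro nn_integral_cmult[symmetric] I)
    qed
  next
    case (add u v)
    then have I [measurable]: "(\<lambda>\<omega>. \<integral>\<^sup>+ y. u y \<partial>jumps \<omega>) \<in> borel_measurable M"
      "(\<lambda>\<omega>. \<integral>\<^sup>+ y. v y \<partial>jumps \<omega>) \<in> borel_measurable M"
      and u: "u \<in> borel_measurable borel" "(\<integral>\<^sup>+ y. u y \<partial>levy_measure M X) = (\<integral>\<^sup>+ \<omega>. (\<integral>\<^sup>+ y. u y \<partial>jumps \<omega>) \<partial>M)"
      and v: "v \<in> borel_measurable borel" "(\<integral>\<^sup>+ y. v y \<partial>levy_measure M X) = (\<integral>\<^sup>+ \<omega>. (\<integral>\<^sup>+ y. v y \<partial>jumps \<omega>) \<partial>M)"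
      by auto
    have lin: "(\<integral>\<^sup>+ y. v y + u y \<partial>N) = (\<integral>\<^sup>+ y. v y \<partial>N) + (\<integral>\<^sup>+ y. u y \<partial>N)" if "sets N = sets borel" for N
      by (intro nn_integral_add borel_measurable_sets_eq_borel[OF that] u v)
    show ?case
    proof
      show "?P (\<lambda>y. v y + u y)" unfolding lin[OF sets_jump_measure] by measurable
      show "?Q (\<lambda>y. v y + u y)"
        unfolding lin[OF sets_jump_measure] lin[OF sets_levy_measure] u(2) v(2) by (intro nn_integral_add[symmetric] I)
    qed
  next
    case (seq U)
    then have I [measurable]: "(\<lambda>\<omega>. \<integral>\<^sup>+ y. U i y \<partial>jumps \<omega>) \<in> borel_measurable M"
      and U: "U i \<in> borel_measurable borel" "(\<integral>\<^sup>+ y. U i y \<partial>levy_measure M X) = (\<integral>\<^sup>+ \<omega>. (\<integral>\<^sup>+ y. U i y \<partial>jumps \<omega>) \<partial>M)"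
      for i by auto
    have int: "(\<integral>\<^sup>+ y. (SUP i. U i) y \<partial>N) = (SUP i. \<integral>\<^sup>+ y. U i y \<partial>N)" if "sets N = sets borel" for N
      unfolding SUP_apply
      by (intro nn_integral_monotone_convergence_SUP borel_measurable_sets_eq_borel[OF that] U \<open>incseq U\<close>)
    have inc: "incseq (\<lambda>i \<omega>. \<integral>\<^sup>+ y. U i y \<partial>jumps \<omega>)"
    proof (intro monoI le_funI nn_integral_mono)
      show "U i y \<le> U k y" if "i \<le> k" for i k y
        using \<open>incseq U\<close> that by (auto dest: monoD le_funD)
    qed
    show ?case
    proof
      show "?P (SUP i. U i)" unfolding int[OF sets_jump_measure] by measurable
      show "?Q (SUP i. U i)"
        unfolding int[OF sets_jump_measure] int[OF sets_levy_measure] U(2)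
        by (rule nn_integral_monotone_convergence_SUP[OF inc I, symmetric])
    qed
  qed
  then show "?P f" "?Q f" by auto
qed

end

section \<open>Subadditive functions of time\<close>

text \<open>The properties of \<open>r \<mapsto> E |Y r|\<close>, for an integrable Levy process \<open>Y\<close>, that the jump estimates use. The
  function need not be monotone when \<open>Y\<close> has a drift; monotonicity up to a factor \<open>2\<close> replaces it.\<close>
locale quasi_subadditive =
  fixes h :: "real \<Rightarrow> real" and B :: real
  assumes nonneg: "0 \<le> r \<Longrightarrow> 0 \<le> h r"
    and zero: "h 0 = 0"
    and subadditive: "0 \<le> r \<Longrightarrow> 0 \<le> s \<Longrightarrow> h (r + s) \<le> h r + h s"
    and quasi_mono: "0 \<le> s \<Longrightarrow> s \<le> r \<Longrightarrow> h s \<le> 2 * h r"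
    and bound: "0 \<le> s \<Longrightarrow> s \<le> 1 \<Longrightarrow> h s \<le> B"
begin

lemma B_nonneg: "0 \<le> B"
  using nonneg[of 0] bound[of 0] by simp

lemma linear_bound:
  assumes "0 \<le> r"
  shows "h r \<le> B * (1 + r)"
proof -
  have step: "h (real n + f) \<le> B * (real n + 1)" if "0 \<le> f" "f \<le> 1" for n f
  proof (induction n)
    case (Suc n)
    have "h (real (Suc n) + f) = h ((real n + f) + 1)" by (simp add: algebra_simps)
    also have "\<dots> \<le> h (real n + f) + h 1" using that by (intro subadditive) auto
    also have "\<dots> \<le> B * (real n + 1) + B" using Suc bound[of 1] by simp
    finally show ?case by (simp add: algebra_simps)
  qed (use that bound in auto)
  define n f where "n = nat \<lfloor>r\<rfloor>" and "f = r - real n"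
  have "real n = of_int \<lfloor>r\<rfloor>" using assms by (simp add: n_def)
  then have f: "0 \<le> f" "f \<le> 1" "real n \<le> r" unfolding f_def by linarith+
  have "h r \<le> B * (real n + 1)" using step[OF f(1,2), of n] by (simp add: f_def)
  also have "\<dots> \<le> B * (1 + r)" using f B_nonneg by (intro mult_left_mono) auto
  finally show ?thesis .
qed

lemma sum_le:
  assumes "finite T" "\<And>s. s \<in> T \<Longrightarrow> 0 \<le> a s"
  shows "h (\<Sum>s\<in>T. a s) \<le> (\<Sum>s\<in>T. h (a s))"
  using assms
proof (induction T)
  case (insert s T)
  have "h (\<Sum>s\<in>insert s T. a s) = h (a s + (\<Sum>s\<in>T. a s))" using insert by simp
  also have "\<dots> \<le> h (a s) + h (\<Sum>s\<in>T. a s)" using insert by (intro subadditive sum_nonneg) auto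
  also have "\<dots> \<le> h (a s) + (\<Sum>s\<in>T. h (a s))" using insert by auto
  finally show ?case using insert by simp
qed (simp add: zero)

text \<open>Grid sums converge to sums over jumps only for continuous functions, so \<open>h\<close> is replaced by a comparable
  continuous function. The infimal convolution \<open>k r = inf\<^sub>s (h s + B * |r - s|)\<close> is Lipschitz and at most \<open>h\<close>; for
  the lower bound, \<open>h r\<close> is compared with \<open>h s\<close> by subadditivity and linear growth if \<open>s \<le> r\<close>, and by
  quasi-monotonicity if \<open>r < s\<close>.\<close>
lemma continuous_minorant:
  obtains k :: "real \<Rightarrow> real" where "continuous_on UNIV k" "\<And>r. 0 \<le> k r"
    "\<And>r. 0 \<le> r \<Longrightarrow> k r \<le> h r" "\<And>r. 0 \<le> r \<Longrightarrow> h r \<le> 2 * k r + B"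
proof -
  define k where "k r = (INF s\<in>{0..}. h s + B * \<bar>r - s\<bar>)" for r
  have ge: "0 \<le> h s + B * \<bar>r - s\<bar>" if "s \<in> {0..}" for r s
    using nonneg[of s] B_nonneg that by auto
  then have bdd: "bdd_below ((\<lambda>s. h s + B * \<bar>r - s\<bar>) ` {0..})" for r
    by (intro bdd_belowI2[of _ 0]) auto
  have k_le: "k r \<le> h s + B * \<bar>r - s\<bar>" if "0 \<le> s" for r s
    unfolding k_def using that by (intro cINF_lower bdd) auto
  have lip: "k r \<le> k r' + B * \<bar>r - r'\<bar>" for r r'
  proof -
    have "k r - B * \<bar>r - r'\<bar> \<le> k r'"
      unfolding k_def[of r']
    proof (rule cINF_greatest)
      fix s :: real assume s: "s \<in> {0..}"
      have "B * \<bar>r - s\<bar> \<le> B * (\<bar>r - r'\<bar> + \<bar>r' - s\<bar>)" using B_nonneg by (intro mult_left_mono) auto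
      then show "k r - B * \<bar>r - r'\<bar> \<le> h s + B * \<bar>r' - s\<bar>"
        using k_le[of s r] s by (simp add: algebra_simps)
    qed auto
    then show ?thesis by simp
  qed
  have "B-lipschitz_on UNIV k"
  proof (rule lipschitz_onI)
    fix r r' show "dist (k r) (k r') \<le> B * dist r r'"
      using lip[of r r'] lip[of r' r] by (simp add: dist_real_def abs_minus_commute)
  qed (rule B_nonneg)
  then have "continuous_on UNIV k" by (rule lipschitz_on_continuous_on)
  moreover have "0 \<le> k r" for r
    unfolding k_def by (intro cINF_greatest ge) auto
  moreover have "k r \<le> h r" if "0 \<le> r" for r using k_le[OF that, of r] by simp
  moreover have "h r \<le> 2 * k r + B" if r: "0 \<le> r" for r
  proof -
    have "(h r - B) / 2 \<le> k r"
      unfolding k_def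
    proof (rule cINF_greatest)
      fix s :: real assume "s \<in> {0..}"
      then have s: "0 \<le> s" by simp
      have "h r \<le> 2 * (h s + B * \<bar>r - s\<bar>) + B"
      proof (cases "s \<le> r")
        case True
        have "h r \<le> h s + h (r - s)" using subadditive[of s "r - s"] s True by simp
        also have "h (r - s) \<le> B + B * \<bar>r - s\<bar>" using linear_bound[of "r - s"] True by (simp add: algebra_simps)
        finally show ?thesis using nonneg[OF s] mult_nonneg_nonneg[OF B_nonneg abs_ge_zero[of "r - s"]]
          by (simp only: distrib_left) linarith
      next
        case False
        then have "h r \<le> 2 * h s" using quasi_mono[of r s] r by simp
        moreover have "0 \<le> B * \<bar>r - s\<bar>" using B_nonneg by simp
        ultimately show ?thesis using B_nonneg by (simp only: distrib_left)
      qed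
      then show "(h r - B) / 2 \<le> h s + B * \<bar>r - s\<bar>" by simp
    qed auto
    then show ?thesis by simp
  qed
  ultimately show ?thesis by (rule that)
qed

end

section \<open>First moments of a Levy process\<close>

lemma cadlag_bounded:
  fixes x :: "real \<Rightarrow> 'b::real_normed_vector"
  assumes x: "cadlag x"
  obtains K where "\<And>r. 0 \<le> r \<Longrightarrow> r \<le> t \<Longrightarrow> norm (x r) \<le> K"
proof -
  have "\<exists>d>0. \<exists>C. \<forall>r\<in>{s-d<..<s+d}. 0 \<le> r \<longrightarrow> norm (x r) \<le> C" if s: "s \<in> {0..t}" for s
  proof -
    obtain d where d: "0 < d"
      "\<And>r r'. r \<in> {s..<s+d} \<Longrightarrow> r' \<in> {s..<s+d} \<Longrightarrow> norm (x r - x r') \<le> 1"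
      "\<And>r r'. 0 \<le> r \<Longrightarrow> 0 \<le> r' \<Longrightarrow> r \<in> {s-d<..<s} \<Longrightarrow> r' \<in> {s-d<..<s} \<Longrightarrow> norm (x r - x r') \<le> 1"
      by (rule cadlag_local_oscillation[OF x _ zero_less_one, of s]) (use s in auto)
    define a where "a = max 0 (s - d/2)"
    have "norm (x r) \<le> norm (x s) + norm (x a) + 1" if r: "r \<in> {s-d<..<s+d}" "0 \<le> r" for r
    proof (cases "s \<le> r")
      case True
      then have "norm (x r - x s) \<le> 1" using r d(1) by (intro d(2)) auto
      then show ?thesis using norm_triangle_sub[of "x r" "x s"] norm_ge_zero[of "x a"] by linarith
    next
      case False
      then have "norm (x r - x a) \<le> 1" using r d(1) by (intro d(3)) (auto simp: a_def)
      then show ?thesis using norm_triangle_sub[of "x r" "x a"] norm_ge_zero[of "x s"] by linarith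
    qed
    then show ?thesis using d(1) by blast
  qed
  then have "\<exists>d C. \<forall>s\<in>{0..t}. 0 < d s \<and> (\<forall>r\<in>{s - d s<..<s + d s}. 0 \<le> r \<longrightarrow> norm (x r) \<le> C s)"
    by metis
  then obtain d C where dC: "\<And>s. s \<in> {0..t} \<Longrightarrow> 0 < d s"
    "\<And>s r. s \<in> {0..t} \<Longrightarrow> r \<in> {s - d s<..<s + d s} \<Longrightarrow> 0 \<le> r \<Longrightarrow> norm (x r) \<le> C s" by blast
  obtain S where S: "S \<subseteq> {0..t}" "finite S" "{0..t} \<subseteq> (\<Union>s\<in>S. {s - d s<..<s + d s})"
    using compactE_image[of "{0..t}" "{0..t}" "\<lambda>s. {s - d s<..<s + d s}"] dC(1)
    by (force intro: compact_Icc)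
  show ?thesis
  proof
    fix r assume r: "0 \<le> r" "r \<le> t"
    have "r \<in> (\<Union>s\<in>S. {s - d s<..<s + d s})" using r by (intro subsetD[OF S(3)]) simp
    then obtain s where s: "s \<in> S" "r \<in> {s - d s<..<s + d s}" by blast
    have "norm (x r) \<le> C s" using s S(1) r(1) by (intro dC(2)) auto
    also have "\<dots> \<le> Max (C ` S)" using s S(2) by (intro Max_ge) auto
    finally show "norm (x r) \<le> Max (C ` S)" .
  qed
qed

locale levy = prob_space M for M :: "'a measure" +
  fixes Y :: "real \<Rightarrow> 'a \<Rightarrow> 'b::{banach, second_countable_topology}"
  assumes levy: "levy_process M Y"

sublocale levy \<subseteq> cadlag_process M Y
  using levy unfolding levy_process_def by unfold_locales auto

context levy
begin

lemmas measurable_Y = measurable_X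

lemma start_zero: "AE \<omega> in M. Y 0 \<omega> = 0"
  using levy unfolding levy_process_def by blast

lemma distr_increment:
  "0 \<le> s \<Longrightarrow> 0 \<le> u \<Longrightarrow> distr M borel (\<lambda>\<omega>. Y (s + u) \<omega> - Y s \<omega>) = distr M borel (Y u)"
  using levy unfolding levy_process_def by blast

lemma nn_integral_increment:
  assumes "0 \<le> s" "s \<le> t" "f \<in> borel_measurable borel"
  shows "(\<integral>\<^sup>+ \<omega>. f (Y t \<omega> - Y s \<omega>) \<partial>M) = (\<integral>\<^sup>+ \<omega>. f (Y (t - s) \<omega>) \<partial>M)"
proof -
  have [measurable]: "Y t \<in> borel_measurable M" "Y s \<in> borel_measurable M" "Y (t - s) \<in> borel_measurable M"
    using assms by (auto intro: measurable_Y)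
  have "(\<integral>\<^sup>+ \<omega>. f (Y t \<omega> - Y s \<omega>) \<partial>M) = (\<integral>\<^sup>+ y. f y \<partial>distr M borel (\<lambda>\<omega>. Y (s + (t - s)) \<omega> - Y s \<omega>))"
    using assms(3) by (subst nn_integral_distr) auto
  also have "\<dots> = (\<integral>\<^sup>+ \<omega>. f (Y (t - s) \<omega>) \<partial>M)"
    using assms by (subst distr_increment) (auto simp: nn_integral_distr)
  finally show ?thesis .
qed

lemma integral_increment:
  assumes "0 \<le> s" "s \<le> t"
  shows "(\<integral> \<omega>. Y t \<omega> - Y s \<omega> \<partial>M) = (\<integral> \<omega>. Y (t - s) \<omega> \<partial>M)"
proof -
  have [measurable]: "Y t \<in> borel_measurable M" "Y s \<in> borel_measurable M" "Y (t - s) \<in> borel_measurable M"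
    using assms by (auto intro: measurable_Y)
  have "(\<integral> \<omega>. Y t \<omega> - Y s \<omega> \<partial>M) = (\<integral> y. y \<partial>distr M borel (\<lambda>\<omega>. Y (s + (t - s)) \<omega> - Y s \<omega>))"
    by (subst integral_distr) auto
  also have "\<dots> = (\<integral> \<omega>. Y (t - s) \<omega> \<partial>M)"
    using assms by (subst distr_increment) (auto simp: integral_distr)
  finally show ?thesis .
qed

lemma indep_vars_increments:
  assumes "0 \<le> \<tau> 0" "mono \<tau>"
  shows "indep_vars (\<lambda>_. borel) (\<lambda>i \<omega>. Y (\<tau> (Suc i)) \<omega> - Y (\<tau> i) \<omega>) {..<n}"
  using levy assms unfolding levy_process_def by blast

text \<open>The middle increment is separated from the two around it; this is the independence that the
  decoupling inequality needs.\<close>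
lemma nn_integral_three_increments:
  assumes "0 \<le> r" "r \<le> s" "s \<le> t" "t \<le> u"
    and [measurable]: "f \<in> borel_measurable borel" "g \<in> borel_measurable borel" "k \<in> borel_measurable borel"
  shows "(\<integral>\<^sup>+ \<omega>. f (Y s \<omega> - Y r \<omega>) * g (Y t \<omega> - Y s \<omega>) * k (Y u \<omega> - Y t \<omega>) \<partial>M) =
    (\<integral>\<^sup>+ \<omega>. f (Y s \<omega> - Y r \<omega>) \<partial>M) * (\<integral>\<^sup>+ \<omega>. g (Y t \<omega> - Y s \<omega>) \<partial>M) * (\<integral>\<^sup>+ \<omega>. k (Y u \<omega> - Y t \<omega>) \<partial>M)"
proof -
  define \<tau> :: "nat \<Rightarrow> real" where "\<tau> i = (if i = 0 then r else if i = 1 then s else if i = 2 then t else u)" for i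
  have "0 \<le> \<tau> 0" "mono \<tau>" using assms by (auto simp: \<tau>_def mono_def)
  then have I: "indep_vars (\<lambda>_. borel) (\<lambda>i \<omega>. Y (\<tau> (Suc i)) \<omega> - Y (\<tau> i) \<omega>) {..<3}"
    by (rule indep_vars_increments)
  define F where "F i = (if i = 0 then f else if i = 1 then g else k)" for i :: nat
  have "indep_vars (\<lambda>_. borel) (\<lambda>i \<omega>. F i (Y (\<tau> (Suc i)) \<omega> - Y (\<tau> i) \<omega>)) {..<3}"
    by (rule indep_vars_compose2[OF I]) (auto simp: F_def)
  then have "(\<integral>\<^sup>+ \<omega>. (\<Prod>i\<in>{..<3}. F i (Y (\<tau> (Suc i)) \<omega> - Y (\<tau> i) \<omega>)) \<partial>M) =
      (\<Prod>i\<in>{..<3}. \<integral>\<^sup>+ \<omega>. F i (Y (\<tau> (Suc i)) \<omega> - Y (\<tau> i) \<omega>) \<partial>M)"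
    by (intro indep_vars_nn_integral) auto
  then show ?thesis by (simp add: numeral_3_eq_3 F_def \<tau>_def mult.assoc)
qed

lemma indep_var_increments:
  assumes "0 \<le> r" "r \<le> s" "s \<le> t"
  shows "indep_var borel (\<lambda>\<omega>. Y t \<omega> - Y s \<omega>) borel (\<lambda>\<omega>. Y s \<omega> - Y r \<omega>)"
proof -
  define \<tau> :: "nat \<Rightarrow> real" where "\<tau> i = (if i = 0 then r else if i = 1 then s else t)" for i
  define Z where "Z i \<omega> = Y (\<tau> (Suc i)) \<omega> - Y (\<tau> i) \<omega>" for i \<omega>
  have "0 \<le> \<tau> 0" "mono \<tau>" using assms by (auto simp: \<tau>_def mono_def)
  then have "indep_vars (\<lambda>_. borel) Z {..<2}" unfolding Z_def by (rule indep_vars_increments)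
  then have "indep_var (PiM {1} (\<lambda>_. borel)) (\<lambda>\<omega>. restrict (\<lambda>i. Z i \<omega>) {1}) (PiM {0} (\<lambda>_. borel)) (\<lambda>\<omega>. restrict (\<lambda>i. Z i \<omega>) {0})"
    by (rule indep_var_restrict) auto
  then have "indep_var borel ((\<lambda>p. p 1) \<circ> (\<lambda>\<omega>. restrict (\<lambda>i. Z i \<omega>) {1})) borel ((\<lambda>p. p 0) \<circ> (\<lambda>\<omega>. restrict (\<lambda>i. Z i \<omega>) {0}))"
    by (rule indep_var_compose) (auto intro: measurable_component_singleton)
  then show ?thesis by (simp add: comp_def Z_def \<tau>_def)
qed

definition moment :: "real \<Rightarrow> ennreal" where
  "moment t = (\<integral>\<^sup>+ \<omega>. ennreal (norm (Y t \<omega>)) \<partial>M)"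

lemma moment_0: "moment 0 = 0"
proof -
  have "moment 0 = (\<integral>\<^sup>+ \<omega>. 0 \<partial>M)"
    unfolding moment_def by (rule nn_integral_cong_AE) (use start_zero in eventually_elim, simp)
  then show ?thesis by simp
qed

lemma integrable_iff_moment: "0 \<le> t \<Longrightarrow> integrable M (Y t) \<longleftrightarrow> moment t < \<infinity>"
  unfolding moment_def by (simp add: integrable_iff_bounded measurable_Y)

lemma moment_increment: "0 \<le> s \<Longrightarrow> s \<le> t \<Longrightarrow> (\<integral>\<^sup>+ \<omega>. ennreal (norm (Y t \<omega> - Y s \<omega>)) \<partial>M) = moment (t - s)"
  unfolding moment_def by (rule nn_integral_increment) auto

lemma moment_add:
  assumes "0 \<le> s" "0 \<le> t"
  shows "moment (s + t) \<le> moment s + moment t"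
proof -
  have [measurable]: "Y (s + t) \<in> borel_measurable M" "Y s \<in> borel_measurable M"
    using assms by (auto intro: measurable_Y)
  have "moment (s + t) \<le> (\<integral>\<^sup>+ \<omega>. ennreal (norm (Y s \<omega>)) + ennreal (norm (Y (s + t) \<omega> - Y s \<omega>)) \<partial>M)"
    unfolding moment_def
    by (intro nn_integral_mono) (auto simp flip: ennreal_plus intro!: ennreal_leI norm_triangle_sub)
  also have "\<dots> = moment s + moment t"
    using moment_increment[of s "s + t"] assms by (subst nn_integral_add) (auto simp: moment_def)
  finally show ?thesis .
qed

lemma moment_mult: "0 \<le> t \<Longrightarrow> moment (real n * t) \<le> of_nat n * moment t"
proof (induction n)
  case (Suc n)
  have "moment (real (Suc n) * t) = moment (real n * t + t)" by (simp add: algebra_simps)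
  also have "\<dots> \<le> of_nat n * moment t + moment t"
    using Suc by (intro order_trans[OF moment_add] add_mono) auto
  finally show ?case by (simp add: algebra_simps)
qed (simp add: moment_0)

text \<open>A cadlag path is bounded on \<open>[0, t]\<close>. If no \<open>K\<close> worked, there would be times \<open>s k\<close> with
  \<open>P (norm (Y (s k)) \<le> k) < 1/2\<close>, although these events eventually hold on each path, so that their
  probabilities tend to \<open>1\<close>.\<close>
lemma tight_on_bounded_time:
  "\<exists>K\<ge>0. \<forall>s\<in>{0..t}. prob {\<omega>\<in>space M. norm (Y s \<omega>) \<le> K} \<ge> 1/2"
proof (rule ccontr)
  assume *: "\<not> ?thesis"
  have "\<exists>s\<in>{0..t}. prob {\<omega>\<in>space M. norm (Y s \<omega>) \<le> real k} < 1/2" for k :: nat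
  proof -
    have "\<not> (0 \<le> real k \<and> (\<forall>s\<in>{0..t}. 1 / 2 \<le> prob {\<omega> \<in> space M. norm (Y s \<omega>) \<le> real k}))" using * by blast
    then show ?thesis by (auto simp: not_le)
  qed
  then obtain s where s: "\<And>k. s k \<in> {0..t}" "\<And>k. prob {\<omega>\<in>space M. norm (Y (s k) \<omega>) \<le> real k} < 1/2"
    by metis
  have [measurable]: "Y (s k) \<in> borel_measurable M" for k using s(1)[of k] by (intro measurable_Y) auto
  have "(\<lambda>k. \<integral> \<omega>. indicator {\<omega>\<in>space M. norm (Y (s k) \<omega>) \<le> real k} \<omega> \<partial>M) \<longlonglongrightarrow> (\<integral> \<omega>. (1::real) \<partial>M)"
  proof (rule integral_dominated_convergence[where w = "\<lambda>_. 1"])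
    show "AE \<omega> in M. (\<lambda>k. indicator {\<omega>\<in>space M. norm (Y (s k) \<omega>) \<le> real k} \<omega>) \<longlonglongrightarrow> (1::real)"
    proof (rule AE_I2)
      fix \<omega> assume \<omega>: "\<omega> \<in> space M"
      obtain K where K: "\<And>r. 0 \<le> r \<Longrightarrow> r \<le> t \<Longrightarrow> norm (Y r \<omega>) \<le> K"
        using cadlag_bounded[OF cadlag_X[OF \<omega>]] by blast
      have "\<forall>\<^sub>F k in sequentially. K \<le> real k"
        by (metis eventually_sequentiallyI of_nat_mono order_trans real_arch_simple)
      then have "\<forall>\<^sub>F k in sequentially. indicator {\<omega>\<in>space M. norm (Y (s k) \<omega>) \<le> real k} \<omega> = (1::real)"
      proof eventually_elim
        case (elim k)
        have "norm (Y (s k) \<omega>) \<le> K" using s(1)[of k] by (intro K) auto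
        then show ?case using \<omega> elim by simp
      qed
      then show "(\<lambda>k. indicator {\<omega>\<in>space M. norm (Y (s k) \<omega>) \<le> real k} \<omega>) \<longlonglongrightarrow> (1::real)"
        by (rule tendsto_eventually)
    qed
  qed auto
  moreover have "(\<integral> \<omega>. indicator {\<omega>\<in>space M. norm (Y (s k) \<omega>) \<le> real k} \<omega> \<partial>M) =
      prob {\<omega>\<in>space M. norm (Y (s k) \<omega>) \<le> real k}" for k
    by (auto intro!: arg_cong[where f = prob])
  ultimately have "(\<lambda>k. prob {\<omega>\<in>space M. norm (Y (s k) \<omega>) \<le> real k}) \<longlonglongrightarrow> 1"
    by (simp add: prob_space)
  from order_tendstoD(1)[OF this, of "1/2"] obtain k
    where "1/2 < prob {\<omega>\<in>space M. norm (Y (s k) \<omega>) \<le> real k}"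
    by (auto simp: eventually_sequentially)
  with s(2)[of k] show False by simp
qed

text \<open>On the event that the increment \<open>Y t - Y s\<close> stays in a ball of radius \<open>K\<close>, which is independent of
  \<open>Y s\<close> and has probability at least \<open>1/2\<close> for a \<open>K\<close> not depending on \<open>s\<close>, the norm of \<open>Y s\<close> is at most
  \<open>norm (Y t) + K\<close>. In particular, finiteness of the
  first moment passes from \<open>t\<close> to all earlier times.\<close>
lemma moment_bound_earlier:
  "\<exists>K\<ge>0. \<forall>s\<in>{0..t}. moment s \<le> 2 * moment t + ennreal K"
proof -
  obtain K where K: "K \<ge> 0" "\<And>s. s \<in> {0..t} \<Longrightarrow> prob {\<omega>\<in>space M. norm (Y s \<omega>) \<le> K} \<ge> 1/2"
    using tight_on_bounded_time[of t] by blast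
  have "moment s \<le> 2 * moment t + ennreal (2 * K)" if s: "s \<in> {0..t}" for s
  proof -
    have [measurable]: "Y s \<in> borel_measurable M" "Y t \<in> borel_measurable M" "Y (t - s) \<in> borel_measurable M"
       "Y 0 \<in> borel_measurable M" using s by (auto intro: measurable_Y)
    let ?I = "\<lambda>y. indicator {y. norm y \<le> K} y :: ennreal"
    have "(\<integral>\<^sup>+ \<omega>. ?I (Y t \<omega> - Y s \<omega>) \<partial>M) = (\<integral>\<^sup>+ \<omega>. ?I (Y (t - s) \<omega>) \<partial>M)"
      using s by (intro nn_integral_increment) auto
    also have "\<dots> = (\<integral>\<^sup>+ \<omega>. indicator {\<omega>\<in>space M. norm (Y (t - s) \<omega>) \<le> K} \<omega> \<partial>M)"
      by (intro nn_integral_cong) (auto simp: indicator_def)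
    also have "\<dots> = prob {\<omega>\<in>space M. norm (Y (t - s) \<omega>) \<le> K}"
      by (subst nn_integral_indicator) (auto simp: emeasure_eq_measure)
    also have "\<dots> \<ge> ennreal (1/2)" using s K(2)[of "t - s"] by (intro ennreal_leI) auto
    finally have half: "ennreal (1/2) \<le> (\<integral>\<^sup>+ \<omega>. ?I (Y t \<omega> - Y s \<omega>) \<partial>M)" .
    have "moment s = (\<integral>\<^sup>+ \<omega>. ennreal (norm (Y s \<omega> - Y 0 \<omega>)) \<partial>M)"
      using moment_increment[of 0 s] s by simp
    then have "ennreal (1/2) * moment s \<le> (\<integral>\<^sup>+ \<omega>. ennreal (norm (Y s \<omega> - Y 0 \<omega>)) \<partial>M) * (\<integral>\<^sup>+ \<omega>. ?I (Y t \<omega> - Y s \<omega>) \<partial>M)"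
      using half by (subst mult.commute) (auto intro: mult_left_mono)
    also have "\<dots> = (\<integral>\<^sup>+ \<omega>. ennreal (norm (Y s \<omega> - Y 0 \<omega>)) * ?I (Y t \<omega> - Y s \<omega>) \<partial>M)"
      using nn_integral_three_increments[of 0 s t t "\<lambda>y. ennreal (norm y)" ?I "\<lambda>_. 1"] s
      by (simp add: emeasure_space_1)
    also have "\<dots> \<le> (\<integral>\<^sup>+ \<omega>. ennreal (norm (Y t \<omega>)) + ennreal K \<partial>M)"
    proof (rule nn_integral_mono_AE)
      show "AE \<omega> in M. ennreal (norm (Y s \<omega> - Y 0 \<omega>)) * ?I (Y t \<omega> - Y s \<omega>) \<le> ennreal (norm (Y t \<omega>)) + ennreal K"
        using start_zero
      proof eventually_elim
        case (elim \<omega>)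
        show ?case
        proof (cases "norm (Y t \<omega> - Y s \<omega>) \<le> K")
          case True
          then have "norm (Y s \<omega>) \<le> norm (Y t \<omega>) + K"
            using norm_triangle_sub[of "Y s \<omega>" "Y t \<omega>"] by (simp add: norm_minus_commute)
          then show ?thesis using True elim K(1) by (simp add: ennreal_leI flip: ennreal_plus)
        qed simp
      qed
    qed
    also have "\<dots> = moment t + ennreal K"
      by (subst nn_integral_add) (auto simp: moment_def emeasure_space_1)
    finally have "2 * (ennreal (1/2) * moment s) \<le> 2 * (moment t + ennreal K)"
      by (intro mult_left_mono) auto
    moreover have "2 * (ennreal (1/2) * moment s) = moment s"
    proof -
      have "2 * ennreal (1/2) = ennreal (2 * (1/2))" by (subst ennreal_mult) auto
      then show ?thesis by (simp add: mult.assoc[symmetric])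
    qed
    moreover have "2 * ennreal K = ennreal (2 * K)" using K(1) by (simp add: ennreal_mult)
    ultimately show ?thesis by (simp add: distrib_left)
  qed
  then show ?thesis using K(1) by (intro exI[of _ "2 * K"]) auto
qed

text \<open>Subadditivity reaches arbitrarily late times and the preceding bound comes back to all earlier ones.\<close>
lemma integrable_process_if_moment_finite:
  assumes "0 < t" "moment t < \<infinity>"
  shows "integrable_process M Y"
  unfolding integrable_process_def
proof (intro allI impI)
  fix s :: real assume s: "0 \<le> s"
  obtain n where n: "s \<le> real n * t" using reals_Archimedean3[OF assms(1)] by (metis less_imp_le)
  obtain K where "moment s \<le> 2 * moment (real n * t) + ennreal K"
    using moment_bound_earlier[of "real n * t"] s n by (metis atLeastAtMost_iff)
  also have "\<dots> \<le> 2 * (of_nat n * moment t) + ennreal K"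
    using assms(1) by (intro add_right_mono mult_left_mono moment_mult) auto
  also have "\<dots> < \<infinity>" using assms(2) by (simp add: ennreal_mult_less_top of_nat_less_top)
  finally show "integrable M (Y s)" using s by (simp add: integrable_iff_moment)
qed

end

locale integrable_levy = levy +
  assumes integrable_Y': "integrable_process M Y"
begin

lemma integrable_Y: "0 \<le> t \<Longrightarrow> integrable M (Y t)"
  using integrable_Y' by (simp add: integrable_process_def)

lemma moment_eq: "0 \<le> t \<Longrightarrow> moment t = ennreal (\<integral> \<omega>. norm (Y t \<omega>) \<partial>M)"
  unfolding moment_def by (intro nn_integral_eq_integral integrable_norm integrable_Y) auto

lemma mean_add:
  assumes "0 \<le> s" "0 \<le> t"
  shows "(\<integral> \<omega>. Y (s + t) \<omega> \<partial>M) = (\<integral> \<omega>. Y s \<omega> \<partial>M) + (\<integral> \<omega>. Y t \<omega> \<partial>M)"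
  using integral_increment[of s "s + t"] assms by (simp add: integrable_Y algebra_simps)

lemma mean_mult: "0 \<le> t \<Longrightarrow> (\<integral> \<omega>. Y (real n * t) \<omega> \<partial>M) = real n *\<^sub>R (\<integral> \<omega>. Y t \<omega> \<partial>M)"
proof (induction n)
  case 0
  have "(\<integral> \<omega>. Y 0 \<omega> \<partial>M) = (\<integral> \<omega>. 0 \<partial>M)"
    using start_zero by (intro integral_cong_AE) (auto intro: measurable_Y)
  then show ?case by simp
next
  case (Suc n)
  have "(\<integral> \<omega>. Y (real (Suc n) * t) \<omega> \<partial>M) = (\<integral> \<omega>. Y (real n * t + t) \<omega> \<partial>M)" by (simp add: algebra_simps)
  also have "\<dots> = real n *\<^sub>R (\<integral> \<omega>. Y t \<omega> \<partial>M) + (\<integral> \<omega>. Y t \<omega> \<partial>M)"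
    using Suc by (subst mean_add) auto
  finally show ?case by (simp add: algebra_simps)
qed

lemma norm_mean_le: "norm (\<integral> \<omega>. Y t \<omega> \<partial>M) \<le> (\<integral> \<omega>. norm (Y t \<omega>) \<partial>M)"
  by (rule integral_norm_bound)

lemma moment_bounded_unit_interval:
  obtains B where "\<And>s. 0 \<le> s \<Longrightarrow> s \<le> 1 \<Longrightarrow> (\<integral> \<omega>. norm (Y s \<omega>) \<partial>M) \<le> B"
proof -
  obtain K where K: "K \<ge> 0" "\<And>s. s \<in> {0..1} \<Longrightarrow> moment s \<le> 2 * moment 1 + ennreal K"
    using moment_bound_earlier[of 1] by blast
  show ?thesis
  proof (rule that)
    fix s :: real assume s: "0 \<le> s" "s \<le> 1"
    then have "ennreal (\<integral> \<omega>. norm (Y s \<omega>) \<partial>M) \<le> 2 * ennreal (\<integral> \<omega>. norm (Y 1 \<omega>) \<partial>M) + ennreal K"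
      using K(2)[of s] by (simp add: moment_eq)
    also have "\<dots> = ennreal (2 * (\<integral> \<omega>. norm (Y 1 \<omega>) \<partial>M) + K)"
      using K(1) by (simp add: ennreal_mult ennreal_plus)
    finally show "(\<integral> \<omega>. norm (Y s \<omega>) \<partial>M) \<le> 2 * (\<integral> \<omega>. norm (Y 1 \<omega>) \<partial>M) + K"
      using K(1) by (subst (asm) ennreal_le_iff) auto
  qed
qed

text \<open>The mean is additive in time and bounded on \<open>[0, 1]\<close>. Writing \<open>n * t = p + f\<close> with \<open>p\<close> a natural number
  and \<open>f \<in> [0, 1]\<close> shows that \<open>n\<close> times the deviation from linearity stays bounded as \<open>n\<close> grows.\<close>
lemma mean_linear:
  assumes t: "0 \<le> t"
  shows "(\<integral> \<omega>. Y t \<omega> \<partial>M) = t *\<^sub>R (\<integral> \<omega>. Y 1 \<omega> \<partial>M)"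
proof -
  define \<phi> where "\<phi> s = (\<integral> \<omega>. Y s \<omega> \<partial>M)" for s
  obtain B where B: "\<And>s. 0 \<le> s \<Longrightarrow> s \<le> 1 \<Longrightarrow> (\<integral> \<omega>. norm (Y s \<omega>) \<partial>M) \<le> B"
    by (rule moment_bounded_unit_interval) (rule that)
  have le: "norm (\<phi> s) \<le> B" if "0 \<le> s" "s \<le> 1" for s
    using norm_mean_le[of s] B[OF that] unfolding \<phi>_def by linarith
  have B0: "0 \<le> B" using le[of 0] norm_ge_zero[of "\<phi> 0"] by linarith
  have main: "real n * norm (\<phi> t - t *\<^sub>R \<phi> 1) \<le> 2 * B" for n
  proof -
    define p f where "p = nat \<lfloor>real n * t\<rfloor>" and "f = real n * t - real p"
    have "real p = of_int \<lfloor>real n * t\<rfloor>" using t by (simp add: p_def)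
    then have f: "0 \<le> f" "f \<le> 1" unfolding f_def by linarith+
    have "real n *\<^sub>R \<phi> t = \<phi> (real n * t)" using t by (simp add: mean_mult \<phi>_def)
    also have "\<dots> = \<phi> (real p * 1 + f)" by (simp add: f_def)
    also have "\<dots> = real p *\<^sub>R \<phi> 1 + \<phi> f"
      using f mean_mult[of 1 p] unfolding \<phi>_def by (subst mean_add) auto
    finally have "real n *\<^sub>R (\<phi> t - t *\<^sub>R \<phi> 1) = \<phi> f - f *\<^sub>R \<phi> 1"
      by (simp add: f_def algebra_simps)
    then have "real n * norm (\<phi> t - t *\<^sub>R \<phi> 1) = norm (\<phi> f - f *\<^sub>R \<phi> 1)"
      by (metis abs_of_nat norm_scaleR)
    also have "\<dots> \<le> norm (\<phi> f) + f * norm (\<phi> 1)" using f norm_triangle_ineq4[of "\<phi> f" "f *\<^sub>R \<phi> 1"] by simp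
    also have "\<dots> \<le> B + 1 * B" using f le[of 1] B0 by (intro add_mono le mult_mono) auto
    finally show ?thesis by simp
  qed
  have "norm (\<phi> t - t *\<^sub>R \<phi> 1) = 0"
  proof (rule ccontr)
    assume "norm (\<phi> t - t *\<^sub>R \<phi> 1) \<noteq> 0"
    then have "0 < norm (\<phi> t - t *\<^sub>R \<phi> 1)" by simp
    from reals_Archimedean3[OF this, rule_format, of "2 * B"] main show False by (meson not_le)
  qed
  then show ?thesis by (simp add: \<phi>_def)
qed

text \<open>By Jensen's inequality for the independent increment \<open>W = Y t - Y s\<close>, \<open>E |Y s + E W| \<le> E |Y t|\<close>, and the
  error \<open>|E W|\<close> is at most \<open>|E (Y t)| \<le> E |Y t|\<close> because the mean is linear in time.\<close>
lemma moment_quasi_mono: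
  assumes "0 \<le> s" "s \<le> t"
  shows "(\<integral> \<omega>. norm (Y s \<omega>) \<partial>M) \<le> 2 * (\<integral> \<omega>. norm (Y t \<omega>) \<partial>M)"
proof -
  have "0 \<le> t" using assms by simp
  have [measurable]: "Y s \<in> borel_measurable M" "Y t \<in> borel_measurable M" "Y 0 \<in> borel_measurable M"
    using assms by (auto intro: measurable_Y)
  define W where "W \<omega> = Y t \<omega> - Y s \<omega>" for \<omega>
  define V where "V \<omega> = Y s \<omega> - Y 0 \<omega>" for \<omega>
  have [measurable]: "V \<in> borel_measurable M" "W \<in> borel_measurable M" unfolding V_def W_def by measurable
  have W: "integrable M W"
    unfolding W_def using assms by (intro Bochner_Integration.integrable_diff integrable_Y) auto
  define m where "m = (\<integral> \<omega>. W \<omega> \<partial>M)"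
  have m: "norm m \<le> (\<integral> \<omega>. norm (Y t \<omega>) \<partial>M)"
  proof -
    have "m = (t - s) *\<^sub>R (\<integral> \<omega>. Y 1 \<omega> \<partial>M)"
      using integral_increment[OF assms] mean_linear[of "t - s"] assms by (simp add: m_def W_def)
    then have "norm m \<le> t * norm (\<integral> \<omega>. Y 1 \<omega> \<partial>M)"
      using assms by (simp add: mult_right_mono)
    also have "\<dots> = norm (\<integral> \<omega>. Y t \<omega> \<partial>M)" using mean_linear[OF \<open>0 \<le> t\<close>] \<open>0 \<le> t\<close> by simp
    finally show ?thesis using norm_mean_le[of t] by (rule order_trans)
  qed
  have joint: "distr M (borel \<Otimes>\<^sub>M borel) (\<lambda>\<omega>. (W \<omega>, V \<omega>)) = distr M borel W \<Otimes>\<^sub>M distr M borel V"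
    using indep_var_increments[of 0 s t] assms unfolding indep_var_distribution_eq W_def V_def by auto
  have "(\<integral>\<^sup>+ \<omega>. ennreal (norm (Y s \<omega>)) \<partial>M) = (\<integral>\<^sup>+ \<omega>. ennreal (norm (V \<omega>)) \<partial>M)"
    by (rule nn_integral_cong_AE) (use start_zero in eventually_elim, simp add: V_def)
  also have "\<dots> \<le> (\<integral>\<^sup>+ \<omega>'. (\<integral>\<^sup>+ \<omega>. ennreal (norm (V \<omega>' + W \<omega>)) \<partial>M) + ennreal (norm m) \<partial>M)"
  proof (rule nn_integral_mono)
    fix \<omega>'
    have "norm (V \<omega>') \<le> norm (V \<omega>' + m) + norm m" using norm_triangle_ineq4[of "V \<omega>' + m" m] by simp
    then have "ennreal (norm (V \<omega>')) \<le> ennreal (norm (V \<omega>' + m)) + ennreal (norm m)"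
      by (simp add: ennreal_leI flip: ennreal_plus)
    also have "V \<omega>' + m = (\<integral> \<omega>. V \<omega>' + W \<omega> \<partial>M)" using W by (simp add: m_def prob_space)
    also have "ennreal (norm (\<integral> \<omega>. V \<omega>' + W \<omega> \<partial>M)) \<le> (\<integral>\<^sup>+ \<omega>. ennreal (norm (V \<omega>' + W \<omega>)) \<partial>M)"
      using W by (intro integral_norm_bound_ennreal) auto
    finally show "ennreal (norm (V \<omega>')) \<le> (\<integral>\<^sup>+ \<omega>. ennreal (norm (V \<omega>' + W \<omega>)) \<partial>M) + ennreal (norm m)"
      by (simp add: add_right_mono)
  qed
  also have "\<dots> = (\<integral>\<^sup>+ \<omega>'. (\<integral>\<^sup>+ \<omega>. ennreal (norm (V \<omega>' + W \<omega>)) \<partial>M) \<partial>M) + ennreal (norm m)"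
    by (subst nn_integral_add) (auto simp: emeasure_space_1)
  also have "(\<integral>\<^sup>+ \<omega>'. (\<integral>\<^sup>+ \<omega>. ennreal (norm (V \<omega>' + W \<omega>)) \<partial>M) \<partial>M) = (\<integral>\<^sup>+ \<omega>. ennreal (norm (V \<omega> + W \<omega>)) \<partial>M)"
    using nn_integral_product_distr[OF _ _ joint, where G = "\<lambda>w v. ennreal (norm (v + w))"] by simp
  also have "\<dots> = (\<integral>\<^sup>+ \<omega>. ennreal (norm (Y t \<omega>)) \<partial>M)"
    by (rule nn_integral_cong_AE) (use start_zero in eventually_elim, simp add: V_def W_def)
  finally have "moment s \<le> moment t + ennreal (norm m)" by (simp add: moment_def)
  then have "ennreal (\<integral> \<omega>. norm (Y s \<omega>) \<partial>M) \<le> ennreal ((\<integral> \<omega>. norm (Y t \<omega>) \<partial>M) + norm m)"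
    using assms by (simp add: moment_eq ennreal_plus)
  then have "(\<integral> \<omega>. norm (Y s \<omega>) \<partial>M) \<le> (\<integral> \<omega>. norm (Y t \<omega>) \<partial>M) + norm m"
    by (subst (asm) ennreal_le_iff) auto
  with m show ?thesis by simp
qed

end

section \<open>Decoupling the increments of the time change\<close>

lemma borel_measurable_vec_nth:
  "f \<in> borel_measurable M \<Longrightarrow> (\<lambda>x. f x $ j) \<in> borel_measurable M"
  by (rule borel_measurable_continuous_on[where f = "\<lambda>y. y $ j"]) (auto intro: continuous_intros)

locale increasing_levy = levy M \<Theta> for M :: "'a measure" and \<Theta> :: "real \<Rightarrow> 'a \<Rightarrow> real ^ 'd::finite" +
  assumes mono_coord: "\<omega> \<in> space M \<Longrightarrow> 0 \<le> s \<Longrightarrow> s \<le> t \<Longrightarrow> \<Theta> s \<omega> $ j \<le> \<Theta> t \<omega> $ j"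
begin

text \<open>On vectors with nonnegative coordinates this is the \<open>\<ell>\<^sup>1\<close> norm, but it is additive; the increments of
  \<open>\<Theta>\<close> over the cells of a grid therefore add up to \<open>gain\<close>.\<close>
definition total :: "real ^ 'd \<Rightarrow> real" where "total y = (\<Sum>j\<in>UNIV. y $ j)"

abbreviation \<xi> :: "nat \<Rightarrow> nat \<Rightarrow> 'a \<Rightarrow> real ^ 'd" where
  "\<xi> n i \<omega> \<equiv> grid_increment (\<lambda>t. \<Theta> t \<omega>) n i"

definition gain :: "'a \<Rightarrow> real" where "gain \<omega> = total (\<Theta> 1 \<omega> - \<Theta> 0 \<omega>)"

lemma total_measurable [measurable]: "total \<in> borel_measurable borel"
  unfolding total_def by (intro borel_measurable_sum borel_measurable_continuous_onI continuous_intros)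

lemma measurable_coord [measurable]:
  "0 \<le> t \<Longrightarrow> (\<lambda>\<omega>. \<Theta> t \<omega> $ j) \<in> borel_measurable M"
  by (rule borel_measurable_vec_nth[OF measurable_Y])

lemma total_diff: "total (x - y) = total x - total y"
  by (simp add: total_def sum_subtractf)

lemma total_mono: "\<omega> \<in> space M \<Longrightarrow> 0 \<le> s \<Longrightarrow> s \<le> t \<Longrightarrow> total (\<Theta> s \<omega>) \<le> total (\<Theta> t \<omega>)"
  unfolding total_def by (intro sum_mono mono_coord)

lemma coord_le_total: "(\<And>i. 0 \<le> y $ i) \<Longrightarrow> y $ j \<le> total y"
  unfolding total_def by (intro member_le_sum) auto

lemma norm_le_total: "(\<And>j. 0 \<le> y $ j) \<Longrightarrow> norm y \<le> total y"
  using norm_le_l1_cart[of y] by (simp add: total_def)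

lemma increment_nonneg: "\<omega> \<in> space M \<Longrightarrow> 0 \<le> \<xi> n i \<omega> $ j"
  unfolding grid_increment_def by (auto intro!: mono_coord divide_right_mono)

lemma total_increment_nonneg: "\<omega> \<in> space M \<Longrightarrow> 0 \<le> total (\<xi> n i \<omega>)"
  unfolding total_def by (intro sum_nonneg increment_nonneg)

lemma gain_nonneg: "\<omega> \<in> space M \<Longrightarrow> 0 \<le> gain \<omega>"
  using total_mono[of \<omega> 0 1] by (simp add: gain_def total_diff)

lemma gain_measurable [measurable]: "gain \<in> borel_measurable M"
  unfolding gain_def using measurable_Y[of 0] measurable_Y[of 1] by measurable

lemma sum_increments:
  assumes "0 < n" shows "(\<Sum>i<n. \<xi> n i \<omega>) = \<Theta> 1 \<omega> - \<Theta> 0 \<omega>"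
  using assms sum_lessThan_telescope[of "\<lambda>i. \<Theta> (real i / real n) \<omega>" n]
  unfolding grid_increment_def by simp

lemma sum_increments_coord: "0 < n \<Longrightarrow> (\<Sum>i<n. \<xi> n i \<omega> $ j) = \<Theta> 1 \<omega> $ j - \<Theta> 0 \<omega> $ j"
  using arg_cong[OF sum_increments, of n "\<lambda>y. y $ j" \<omega>] by simp

lemma sum_total_increments: "0 < n \<Longrightarrow> (\<Sum>i<n. total (\<xi> n i \<omega>)) = gain \<omega>"
  unfolding total_def gain_def by (subst sum.swap) (simp add: sum_increments_coord)

lemma increment_coord_le:
  assumes "\<omega> \<in> space M" "i < n" shows "\<xi> n i \<omega> $ j \<le> \<Theta> 1 \<omega> $ j - \<Theta> 0 \<omega> $ j"
proof -
  have "\<xi> n i \<omega> $ j \<le> (\<Sum>i<n. \<xi> n i \<omega> $ j)"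
    using assms by (intro member_le_sum increment_nonneg) auto
  then show ?thesis using assms by (simp add: sum_increments_coord)
qed

lemma jump_nonneg:
  assumes \<omega>: "\<omega> \<in> space M" and s: "0 < s"
  shows "0 \<le> path_jump (\<lambda>t. \<Theta> t \<omega>) s $ j"
proof (rule tendsto_lowerbound)
  show "(\<lambda>n. \<xi> n (nat \<lceil>real n * s\<rceil> - 1) \<omega> $ j) \<longlonglongrightarrow> path_jump (\<lambda>t. \<Theta> t \<omega>) s $ j"
    by (intro tendsto_vec_nth cadlag_grid_increment_tendsto_jump cadlag_X \<omega> s)
qed (use increment_nonneg[OF \<omega>] in auto)

text \<open>The Laplace transform of \<open>gain\<close> at \<open>1\<close>; it is positive whatever the moments of \<open>\<Theta>\<close> are.\<close>
definition laplace :: ennreal where "laplace = (\<integral>\<^sup>+ \<omega>. ennreal (exp (- gain \<omega>)) \<partial>M)"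

lemma laplace_bounds: "laplace \<noteq> 0" "laplace \<noteq> \<infinity>"
proof -
  have "laplace \<noteq> 0"
  proof
    assume "laplace = 0"
    then have "AE \<omega> in M. ennreal (exp (- gain \<omega>)) = 0"
      unfolding laplace_def by (subst (asm) nn_integral_0_iff_AE) auto
    then have "AE \<omega> in M. False" by eventually_elim (simp add: ennreal_eq_0_iff not_le)
    then show False by simp
  qed
  moreover have "laplace \<le> (\<integral>\<^sup>+ \<omega>. 1 \<partial>M)"
    unfolding laplace_def by (intro nn_integral_mono) (simp add: gain_nonneg ennreal_le_1)
  ultimately show "laplace \<noteq> 0" "laplace \<noteq> \<infinity>" by (auto simp: emeasure_space_1 top_unique)
qed

text \<open>The weight is \<open>exp\<close> of minus the total increment outside the \<open>i\<close>-th cell, which splits into the parts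
  before and after the cell. Both are independent of the increment over the cell, and each of the two factors has mean at least
  \<^const>\<open>laplace\<close>.\<close>
lemma decoupling:
  assumes i: "i < n" and f [measurable]: "f \<in> borel_measurable borel"
  shows "laplace * laplace * (\<integral>\<^sup>+ \<omega>. f (\<xi> n i \<omega>) \<partial>M) \<le> (\<integral>\<^sup>+ \<omega>. f (\<xi> n i \<omega>) * ennreal (exp (total (\<xi> n i \<omega>) - gain \<omega>)) \<partial>M)"
proof -
  define a b where "a = real i / real n" and "b = real (Suc i) / real n"
  have ab: "0 \<le> a" "a \<le> b" "b \<le> 1" using i by (auto simp: a_def b_def divide_simps)
  have \<xi>: "\<xi> n i \<omega> = \<Theta> b \<omega> - \<Theta> a \<omega>" for \<omega> by (simp add: grid_increment_def a_def b_def)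
  define E where "E y = ennreal (exp (- total y))" for y
  have [measurable]: "E \<in> borel_measurable borel" unfolding E_def by measurable
  have E1: "laplace \<le> (\<integral>\<^sup>+ \<omega>. E (\<Theta> a \<omega> - \<Theta> 0 \<omega>) \<partial>M)"
    unfolding laplace_def E_def gain_def total_diff
    by (intro nn_integral_mono ennreal_leI) (use ab total_mono[of _ a 1] in auto)
  have E2: "laplace \<le> (\<integral>\<^sup>+ \<omega>. E (\<Theta> 1 \<omega> - \<Theta> b \<omega>) \<partial>M)"
    unfolding laplace_def E_def gain_def total_diff
    by (intro nn_integral_mono ennreal_leI) (use ab total_mono[of _ 0 b] in auto)
  have "laplace * (\<integral>\<^sup>+ \<omega>. f (\<xi> n i \<omega>) \<partial>M) * laplace \<le>
     (\<integral>\<^sup>+ \<omega>. E (\<Theta> a \<omega> - \<Theta> 0 \<omega>) \<partial>M) * (\<integral>\<^sup>+ \<omega>. f (\<xi> n i \<omega>) \<partial>M) * (\<integral>\<^sup>+ \<omega>. E (\<Theta> 1 \<omega> - \<Theta> b \<omega>) \<partial>M)"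
    by (intro mult_mono E1 E2) auto
  also have "\<dots> = (\<integral>\<^sup>+ \<omega>. E (\<Theta> a \<omega> - \<Theta> 0 \<omega>) * f (\<xi> n i \<omega>) * E (\<Theta> 1 \<omega> - \<Theta> b \<omega>) \<partial>M)"
    unfolding \<xi> by (rule nn_integral_three_increments[symmetric]) (use ab in auto)
  also have "\<dots> = (\<integral>\<^sup>+ \<omega>. f (\<xi> n i \<omega>) * ennreal (exp (total (\<xi> n i \<omega>) - gain \<omega>)) \<partial>M)"
  proof (rule nn_integral_cong)
    fix \<omega>
    have "E (\<Theta> a \<omega> - \<Theta> 0 \<omega>) * E (\<Theta> 1 \<omega> - \<Theta> b \<omega>) = ennreal (exp (total (\<xi> n i \<omega>) - gain \<omega>))"
      by (simp add: E_def \<xi> gain_def total_diff flip: ennreal_mult exp_add)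
    moreover have "E (\<Theta> a \<omega> - \<Theta> 0 \<omega>) * f (\<xi> n i \<omega>) * E (\<Theta> 1 \<omega> - \<Theta> b \<omega>) =
        f (\<xi> n i \<omega>) * (E (\<Theta> a \<omega> - \<Theta> 0 \<omega>) * E (\<Theta> 1 \<omega> - \<Theta> b \<omega>))"
      by (simp only: ac_simps)
    ultimately show "E (\<Theta> a \<omega> - \<Theta> 0 \<omega>) * f (\<xi> n i \<omega>) * E (\<Theta> 1 \<omega> - \<Theta> b \<omega>) =
        f (\<xi> n i \<omega>) * ennreal (exp (total (\<xi> n i \<omega>) - gain \<omega>))"
      by (simp only:)
  qed
  finally have main: "laplace * (\<integral>\<^sup>+ \<omega>. f (\<xi> n i \<omega>) \<partial>M) * laplace \<le>
    (\<integral>\<^sup>+ \<omega>. f (\<xi> n i \<omega>) * ennreal (exp (total (\<xi> n i \<omega>) - gain \<omega>)) \<partial>M)" .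
  have "laplace * laplace * x = laplace * x * laplace" for x by (simp only: ac_simps)
  with main show ?thesis by (simp only:)
qed

text \<open>The purpose of the weight: a bound on the weighted sums along each path gives a bound on the expected
  unweighted sums that is uniform in the mesh of the grid.\<close>
lemma sum_increments_bounded:
  assumes [measurable]: "f \<in> borel_measurable borel"
    and g: "(\<integral>\<^sup>+ \<omega>. g \<omega> \<partial>M) < \<infinity>"
    and le: "\<And>n \<omega>. \<omega> \<in> space M \<Longrightarrow> 0 < n \<Longrightarrow>
      (\<Sum>i<n. f (\<xi> n i \<omega>) * ennreal (exp (total (\<xi> n i \<omega>) - gain \<omega>))) \<le> g \<omega>"
  shows "\<exists>C<\<infinity>. \<forall>n. (\<integral>\<^sup>+ \<omega>. (\<Sum>i<n. f (\<xi> n i \<omega>)) \<partial>M) \<le> C"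
proof (intro exI[of _ "(\<integral>\<^sup>+ \<omega>. g \<omega> \<partial>M) / (laplace * laplace)"] conjI allI)
  show "(\<integral>\<^sup>+ \<omega>. g \<omega> \<partial>M) / (laplace * laplace) < \<infinity>"
    using g laplace_bounds by (auto simp: ennreal_divide_eq_top_iff simp flip: less_top)
  fix n
  show "(\<integral>\<^sup>+ \<omega>. (\<Sum>i<n. f (\<xi> n i \<omega>)) \<partial>M) \<le> (\<integral>\<^sup>+ \<omega>. g \<omega> \<partial>M) / (laplace * laplace)"
  proof (cases "n = 0")
    case False
    have "(\<integral>\<^sup>+ \<omega>. (\<Sum>i<n. f (\<xi> n i \<omega>)) \<partial>M) * (laplace * laplace) = laplace * laplace * (\<Sum>i<n. \<integral>\<^sup>+ \<omega>. f (\<xi> n i \<omega>) \<partial>M)"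
      by (subst nn_integral_sum) (auto simp: mult.commute)
    also have "\<dots> = (\<Sum>i<n. laplace * laplace * (\<integral>\<^sup>+ \<omega>. f (\<xi> n i \<omega>) \<partial>M))" by (rule sum_distrib_left)
    also have "\<dots> \<le> (\<Sum>i<n. \<integral>\<^sup>+ \<omega>. f (\<xi> n i \<omega>) * ennreal (exp (total (\<xi> n i \<omega>) - gain \<omega>)) \<partial>M)"
      by (intro sum_mono decoupling) auto
    also have "\<dots> = (\<integral>\<^sup>+ \<omega>. (\<Sum>i<n. f (\<xi> n i \<omega>) * ennreal (exp (total (\<xi> n i \<omega>) - gain \<omega>))) \<partial>M)"
      by (subst nn_integral_sum) auto
    also have "\<dots> \<le> (\<integral>\<^sup>+ \<omega>. g \<omega> \<partial>M)" using False by (intro nn_integral_mono le) auto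
    finally have "(\<integral>\<^sup>+ \<omega>. (\<Sum>i<n. f (\<xi> n i \<omega>)) \<partial>M) * (laplace * laplace) / (laplace * laplace) \<le> (\<integral>\<^sup>+ \<omega>. g \<omega> \<partial>M) / (laplace * laplace)"
      by (rule divide_right_mono_ennreal)
    then show ?thesis using laplace_bounds by (subst (asm) mult_divide_eq_ennreal) (auto simp: ennreal_mult_eq_top_iff)
  qed simp
qed

text \<open>If \<open>N\<close> cells have increments larger than \<open>1/2\<close>, then outside any one of them the total increment is at least
  \<open>(N - 1) / 2\<close>. So the sum is at most \<open>N * exp (- (N - 1) / 2)\<close>, and \<open>exp x \<ge> 1 + x\<close> bounds this
  by \<open>2 * N / (N + 1)\<close>.\<close>
lemma sum_large_increments_weight:
  assumes \<omega>: "\<omega> \<in> space M" and n: "0 < n"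
  shows "(\<Sum>i | i < n \<and> 1/2 < norm (\<xi> n i \<omega>). exp (total (\<xi> n i \<omega>) - gain \<omega>)) \<le> 2"
proof -
  define I where "I = {i. i < n \<and> 1/2 < norm (\<xi> n i \<omega>)}"
  define N where "N = real (card I)"
  have I: "finite I" "I \<subseteq> {..<n}" by (auto simp: I_def)
  have "exp (total (\<xi> n i \<omega>) - gain \<omega>) \<le> 2 / (N + 1)" if i: "i \<in> I" for i
  proof -
    have "card I \<ge> 1" using i I(1) by (metis One_nat_def Suc_leI card_gt_0_iff empty_iff)
    then have "(N - 1) / 2 = (\<Sum>k\<in>I - {i}. 1/2)" using i I(1) by (simp add: N_def card_Diff_singleton of_nat_diff)
    also have "\<dots> \<le> (\<Sum>k\<in>I - {i}. total (\<xi> n k \<omega>))"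
    proof (rule sum_mono)
      fix k assume "k \<in> I - {i}"
      then have "1/2 < norm (\<xi> n k \<omega>)" by (simp add: I_def)
      with norm_le_total[OF increment_nonneg[OF \<omega>], of n k] show "1/2 \<le> total (\<xi> n k \<omega>)" by linarith
    qed
    also have "\<dots> \<le> (\<Sum>k\<in>{..<n} - {i}. total (\<xi> n k \<omega>))"
      using I by (intro sum_mono2 total_increment_nonneg \<omega>) auto
    also have "\<dots> = gain \<omega> - total (\<xi> n i \<omega>)"
      using sum_total_increments[OF n, of \<omega>] i I by (subst sum_diff1) auto
    finally have gain: "(N - 1) / 2 \<le> gain \<omega> - total (\<xi> n i \<omega>)" .
    have "(N + 1) / 2 = 1 + (N - 1) / 2" by (simp add: field_simps)
    also have "\<dots> \<le> exp ((N - 1) / 2)" by (rule exp_ge_add_one_self)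
    also have "\<dots> \<le> exp (gain \<omega> - total (\<xi> n i \<omega>))" using gain by simp
    finally have "(N + 1) / 2 \<le> exp (gain \<omega> - total (\<xi> n i \<omega>))" .
    then have "1 / exp (gain \<omega> - total (\<xi> n i \<omega>)) \<le> 1 / ((N + 1) / 2)"
      by (intro divide_left_mono) (auto simp: N_def)
    then show ?thesis by (simp add: exp_diff)
  qed
  then have "(\<Sum>i\<in>I. exp (total (\<xi> n i \<omega>) - gain \<omega>)) \<le> (\<Sum>i\<in>I. 2 / (N + 1))" by (rule sum_mono)
  also have "\<dots> = 2 * (N / (N + 1))" by (simp add: N_def)
  also have "\<dots> \<le> 2 * 1" by (intro mult_left_mono) (auto simp: N_def)
  finally show ?thesis by (simp add: I_def)
qed

text \<open>One half of the comparison between \<open>\<Theta> 1\<close> and its large jumps. The continuous \<open>f\<close> dominates \<open>h\<close> on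
  vectors of norm larger than \<open>1\<close> and lives on those of norm larger than \<open>1/2\<close>; there \<open>f \<xi> \<le> 4 * h D + B\<close> for
  every increment \<open>\<xi>\<close>, where \<open>D\<close> is the increment of \<open>\<Theta> $ j\<close> over \<open>[0, 1]\<close>, and the weights sum to at most
  \<open>2\<close>.\<close>
lemma jump_moment_finite:
  assumes "quasi_subadditive h B" and [measurable]: "h \<in> borel_measurable borel"
    and h: "(\<integral>\<^sup>+ \<omega>. ennreal (h (\<Theta> 1 \<omega> $ j - \<Theta> 0 \<omega> $ j)) \<partial>M) < \<infinity>"
  shows "(\<integral>\<^sup>+ \<omega>. (\<integral>\<^sup>+ y. ennreal (h (max 0 (y $ j))) * indicator {y. 1 < norm y} y \<partial>jumps \<omega>) \<partial>M) < \<infinity>"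
proof -
  interpret h: quasi_subadditive h B by fact
  obtain k where k: "continuous_on UNIV k" "\<And>r. 0 \<le> k r"
    "\<And>r. 0 \<le> r \<Longrightarrow> k r \<le> h r" "\<And>r. 0 \<le> r \<Longrightarrow> h r \<le> 2 * k r + B"
    by (rule h.continuous_minorant) (rule that)
  define wt where "wt y = min 1 (max 0 (2 * norm y - 1))" for y :: "real ^ 'd"
  define f where "f y = wt y * (2 * k (max 0 (y $ j)) + B)" for y :: "real ^ 'd"
  have wt: "0 \<le> wt y" "wt y \<le> 1" "norm y \<le> 1/2 \<Longrightarrow> wt y = 0" "1 < norm y \<Longrightarrow> wt y = 1" for y
    by (auto simp: wt_def)
  have f: "continuous_on UNIV f" "\<And>y. norm y \<le> 1/2 \<Longrightarrow> f y = 0" "\<And>y. 0 \<le> f y"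
  proof -
    have "continuous_on UNIV (\<lambda>y :: real ^ 'd. k (max 0 (y $ j)))"
      by (rule continuous_on_compose2[OF k(1)]) (auto intro!: continuous_intros)
    then show "continuous_on UNIV f" unfolding f_def wt_def by (intro continuous_intros)
  qed (use wt k(2) h.B_nonneg in \<open>auto simp: f_def\<close>)
  have [measurable]: "f \<in> borel_measurable borel" using f(1) by (rule borel_measurable_continuous_onI)
  let ?g = "\<lambda>\<omega>. 8 * ennreal (h (\<Theta> 1 \<omega> $ j - \<Theta> 0 \<omega> $ j)) + ennreal (2 * B)"
  have "\<exists>C<\<infinity>. \<forall>n. (\<integral>\<^sup>+ \<omega>. (\<Sum>i<n. ennreal (f (\<xi> n i \<omega>))) \<partial>M) \<le> C"
  proof (rule sum_increments_bounded)
    have "(\<integral>\<^sup>+ \<omega>. ?g \<omega> \<partial>M) = 8 * (\<integral>\<^sup>+ \<omega>. ennreal (h (\<Theta> 1 \<omega> $ j - \<Theta> 0 \<omega> $ j)) \<partial>M) + ennreal (2 * B)"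
      by (subst nn_integral_add) (auto simp: nn_integral_cmult emeasure_space_1)
    also have "\<dots> < \<infinity>" using h by (simp add: ennreal_mult_less_top)
    finally show "(\<integral>\<^sup>+ \<omega>. ?g \<omega> \<partial>M) < \<infinity>" .
  next
    fix n \<omega> assume \<omega>: "\<omega> \<in> space M" and n: "0 < (n::nat)"
    define D where "D = \<Theta> 1 \<omega> $ j - \<Theta> 0 \<omega> $ j"
    have D: "0 \<le> D" using mono_coord[OF \<omega>, of 0 1 j] by (simp add: D_def)
    have "(\<Sum>i<n. f (\<xi> n i \<omega>) * exp (total (\<xi> n i \<omega>) - gain \<omega>)) =
        (\<Sum>i | i < n \<and> 1/2 < norm (\<xi> n i \<omega>). f (\<xi> n i \<omega>) * exp (total (\<xi> n i \<omega>) - gain \<omega>))"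
    proof (rule sum.mono_neutral_right)
      show "\<forall>i\<in>{..<n} - {i. i < n \<and> 1/2 < norm (\<xi> n i \<omega>)}. f (\<xi> n i \<omega>) * exp (total (\<xi> n i \<omega>) - gain \<omega>) = 0"
      proof
        fix i assume "i \<in> {..<n} - {i. i < n \<and> 1/2 < norm (\<xi> n i \<omega>)}"
        then have "norm (\<xi> n i \<omega>) \<le> 1/2" by auto
        from f(2)[OF this] show "f (\<xi> n i \<omega>) * exp (total (\<xi> n i \<omega>) - gain \<omega>) = 0" by simp
      qed
    qed auto
    also have "\<dots> \<le> (\<Sum>i | i < n \<and> 1/2 < norm (\<xi> n i \<omega>). (4 * h D + B) * exp (total (\<xi> n i \<omega>) - gain \<omega>))"
    proof (intro sum_mono mult_right_mono)
      fix i assume i: "i \<in> {i. i < n \<and> 1/2 < norm (\<xi> n i \<omega>)}"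
      have x: "0 \<le> \<xi> n i \<omega> $ j" "\<xi> n i \<omega> $ j \<le> D"
        using increment_nonneg[OF \<omega>] increment_coord_le[OF \<omega>] i by (auto simp: D_def)
      have "f (\<xi> n i \<omega>) \<le> 1 * (2 * k (max 0 (\<xi> n i \<omega> $ j)) + B)"
        unfolding f_def using wt k(2) h.B_nonneg by (intro mult_right_mono) auto
      also have "\<dots> \<le> 4 * h D + B"
        using k(3)[OF x(1)] h.quasi_mono[OF x] x(1) by (simp add: max_def)
      finally show "f (\<xi> n i \<omega>) \<le> 4 * h D + B" .
    qed auto
    also have "\<dots> \<le> (4 * h D + B) * 2"
      unfolding sum_distrib_left[symmetric] using h.nonneg[OF D] h.B_nonneg
      by (intro mult_left_mono sum_large_increments_weight \<omega> n) auto
    finally have "ennreal (\<Sum>i<n. f (\<xi> n i \<omega>) * exp (total (\<xi> n i \<omega>) - gain \<omega>)) \<le> ennreal (8 * h D + 2 * B)"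
      by (intro ennreal_leI) simp
    moreover have "ennreal (8 * h D) = 8 * ennreal (h D)" using h.nonneg[OF D] by (subst ennreal_mult) auto
    ultimately show "(\<Sum>i<n. ennreal (f (\<xi> n i \<omega>)) * ennreal (exp (total (\<xi> n i \<omega>) - gain \<omega>))) \<le> ?g \<omega>"
      using f(3) h.nonneg[OF D] h.B_nonneg
      by (simp add: D_def ennreal_plus ennreal_mult flip: sum_ennreal ennreal_mult)
  qed measurable
  then obtain C where C: "C < \<infinity>" "\<And>n. (\<integral>\<^sup>+ \<omega>. (\<Sum>i<n. ennreal (f (\<xi> n i \<omega>))) \<partial>M) \<le> C" by blast
  have "(\<integral>\<^sup>+ \<omega>. (\<integral>\<^sup>+ y. ennreal (h (max 0 (y $ j))) * indicator {y. 1 < norm y} y \<partial>jumps \<omega>) \<partial>M) \<le>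
      (\<integral>\<^sup>+ \<omega>. (\<integral>\<^sup>+ y. ennreal (f y) \<partial>jumps \<omega>) \<partial>M)"
  proof (intro nn_integral_mono)
    fix y :: "real ^ 'd"
    show "ennreal (h (max 0 (y $ j))) * indicator {y. 1 < norm y} y \<le> ennreal (f y)"
      using k(4)[of "max 0 (y $ j)"] wt(4)[of y] by (auto simp: indicator_def f_def intro!: ennreal_leI)
  qed
  also have "\<dots> = (\<integral>\<^sup>+ \<omega>. liminf (\<lambda>n. \<Sum>i<n. ennreal (f (\<xi> n i \<omega>))) \<partial>M)"
  proof (rule nn_integral_cong)
    fix \<omega> assume "\<omega> \<in> space M"
    from grid_sums_tendsto_nn_integral[OF cadlag_X[OF this], of "1/2" f] f
    show "(\<integral>\<^sup>+ y. ennreal (f y) \<partial>jumps \<omega>) = liminf (\<lambda>n. \<Sum>i<n. ennreal (f (\<xi> n i \<omega>)))"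
      by (intro lim_imp_Liminf[symmetric]) auto
  qed
  also have "\<dots> \<le> liminf (\<lambda>n. \<integral>\<^sup>+ \<omega>. (\<Sum>i<n. ennreal (f (\<xi> n i \<omega>))) \<partial>M)"
    by (intro nn_integral_liminf) auto
  also have "\<dots> \<le> C" using C(2) by (intro Liminf_le) auto
  finally show ?thesis using C(1) by simp
qed

text \<open>Over the cells with an increment of norm at most \<open>2\<close>, hence of total at most \<open>2 * CARD('d)\<close>, the weight
  is at most a constant times \<open>exp (- gain)\<close>, and \<open>gain * exp (- gain) \<le> 1\<close>. In the limit this bounds the
  mean of the sum of the drift and the small jumps.\<close>
lemma small_increments_bounded:
  assumes u: "\<And>y. (\<And>i. 0 \<le> y $ i) \<Longrightarrow> u y \<le> y $ j" "\<And>y. 2 < norm y \<Longrightarrow> u y = 0"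
    and [measurable]: "u \<in> borel_measurable borel"
  shows "\<exists>C<\<infinity>. \<forall>n. (\<integral>\<^sup>+ \<omega>. (\<Sum>i<n. ennreal (u (\<xi> n i \<omega>))) \<partial>M) \<le> C"
proof (rule sum_increments_bounded)
  let ?b = "exp (2 * real CARD('d))"
  show "(\<integral>\<^sup>+ \<omega>. ennreal ?b \<partial>M) < \<infinity>" by (simp add: emeasure_space_1)
  fix n \<omega> assume \<omega>: "\<omega> \<in> space M" and n: "0 < (n::nat)"
  have "(\<Sum>i<n. ennreal (u (\<xi> n i \<omega>)) * ennreal (exp (total (\<xi> n i \<omega>) - gain \<omega>))) \<le>
      (\<Sum>i<n. ennreal (total (\<xi> n i \<omega>) * (?b * exp (- gain \<omega>))))"
  proof (rule sum_mono)
    fix i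
    show "ennreal (u (\<xi> n i \<omega>)) * ennreal (exp (total (\<xi> n i \<omega>) - gain \<omega>)) \<le> ennreal (total (\<xi> n i \<omega>) * (?b * exp (- gain \<omega>)))"
    proof (cases "norm (\<xi> n i \<omega>) \<le> 2")
      case True
      have "total (\<xi> n i \<omega>) \<le> (\<Sum>j\<in>(UNIV :: 'd set). 2)"
        unfolding total_def
      proof (rule sum_mono)
        show "\<xi> n i \<omega> $ k \<le> 2" for k
          using component_le_norm_cart[of "\<xi> n i \<omega>" k] True by linarith
      qed
      then have "exp (total (\<xi> n i \<omega>) - gain \<omega>) \<le> ?b * exp (- gain \<omega>)"
        by (simp add: mult.commute flip: exp_add)
      moreover have "u (\<xi> n i \<omega>) \<le> total (\<xi> n i \<omega>)"
        using u(1)[OF increment_nonneg[OF \<omega>]] coord_le_total[OF increment_nonneg[OF \<omega>]] by (rule order_trans)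
      ultimately have "ennreal (u (\<xi> n i \<omega>)) * ennreal (exp (total (\<xi> n i \<omega>) - gain \<omega>)) \<le>
         ennreal (total (\<xi> n i \<omega>)) * ennreal (?b * exp (- gain \<omega>))"
        by (intro mult_mono ennreal_leI) auto
      also have "\<dots> = ennreal (total (\<xi> n i \<omega>) * (?b * exp (- gain \<omega>)))"
        using total_increment_nonneg[OF \<omega>] by (intro ennreal_mult[symmetric]) auto
      finally show ?thesis .
    qed (simp add: u(2))
  qed
  also have "\<dots> = ennreal ((\<Sum>i<n. total (\<xi> n i \<omega>)) * (?b * exp (- gain \<omega>)))"
    using total_increment_nonneg[OF \<omega>] by (subst sum_ennreal) (auto simp: sum_distrib_right)
  also have "\<dots> \<le> ennreal ?b"
  proof (rule ennreal_leI)
    have "gain \<omega> * exp (- gain \<omega>) \<le> 1"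
    proof -
      have "gain \<omega> \<le> exp (gain \<omega>)" using exp_ge_add_one_self[of "gain \<omega>"] by linarith
      then show ?thesis by (simp add: exp_minus field_simps)
    qed
    then have "?b * (gain \<omega> * exp (- gain \<omega>)) \<le> ?b * 1" by (intro mult_left_mono) auto
    then show "(\<Sum>i<n. total (\<xi> n i \<omega>)) * (?b * exp (- gain \<omega>)) \<le> ?b"
      unfolding sum_total_increments[OF n] by (simp only: ac_simps mult_1_right)
  qed
  finally show "(\<Sum>i<n. ennreal (u (\<xi> n i \<omega>)) * ennreal (exp (total (\<xi> n i \<omega>) - gain \<omega>))) \<le> ennreal ?b" .
qed measurable

text \<open>The other half of the comparison. The cutoff \<open>wt\<close> rises from \<open>0\<close> at norm \<open>1\<close> to \<open>1\<close> at norm \<open>2\<close> and splits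
  the increment of \<open>\<Theta> $ j\<close> over \<open>[0, 1]\<close> into a finite sum of \<open>wt y * y $ j\<close> over the jumps \<open>y\<close> and a
  nonnegative remainder \<open>z\<close>. On the first part \<open>h\<close> is estimated by subadditivity and quasi-monotonicity.
  On the second it grows at most linearly, and \<open>z\<close> has finite mean by Fatou's lemma and the bound on small
  increments.\<close>
lemma moment_finite_if_jump_moment_finite:
  assumes "quasi_subadditive h B" and [measurable]: "h \<in> borel_measurable borel"
    and jumps_h: "(\<integral>\<^sup>+ \<omega>. (\<integral>\<^sup>+ y. ennreal (h (max 0 (y $ j))) * indicator {y. 1 < norm y} y \<partial>jumps \<omega>) \<partial>M) < \<infinity>"
  shows "(\<integral>\<^sup>+ \<omega>. ennreal (h (\<Theta> 1 \<omega> $ j - \<Theta> 0 \<omega> $ j)) \<partial>M) < \<infinity>"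
proof -
  interpret h: quasi_subadditive h B by fact
  define wt where "wt y = min 1 (max 0 (norm y - 1))" for y :: "real ^ 'd"
  have wt: "0 \<le> wt y" "wt y \<le> 1" "norm y \<le> 1 \<Longrightarrow> wt y = 0" "2 < norm y \<Longrightarrow> wt y = 1" for y
    by (auto simp: wt_def)
  define f where "f y = wt y * y $ j" for y
  define u where "u y = (1 - wt y) * y $ j" for y
  have f: "continuous_on UNIV f" "\<And>y. norm y \<le> 1 \<Longrightarrow> f y = 0"
    unfolding f_def wt_def by (auto intro!: continuous_intros)
  have "continuous_on UNIV u" unfolding u_def wt_def by (auto intro!: continuous_intros)
  then have [measurable]: "u \<in> borel_measurable borel" by (rule borel_measurable_continuous_onI)
  have coord [measurable]: "(\<lambda>y :: real ^ 'd. y $ j) \<in> borel_measurable borel"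
    by (intro borel_measurable_continuous_onI continuous_intros)
  have u_nonneg: "0 \<le> u y" if "\<And>i. 0 \<le> y $ i" for y
    unfolding u_def using wt[of y] that[of j] by simp
  have u_le: "u y \<le> y $ j" if "\<And>i. 0 \<le> y $ i" for y
    using mult_right_mono[of "1 - wt y" 1 "y $ j"] wt(1)[of y] that[of j] by (simp add: u_def)
  obtain C where C: "C < \<infinity>" "\<And>n. (\<integral>\<^sup>+ \<omega>. (\<Sum>i<n. ennreal (u (\<xi> n i \<omega>))) \<partial>M) \<le> C"
    using small_increments_bounded[of u j] u_le wt(4) by (auto simp: u_def)
  define S where "S \<omega> = liminf (\<lambda>n. \<Sum>i<n. ennreal (u (\<xi> n i \<omega>)))" for \<omega>
  have [measurable]: "S \<in> borel_measurable M" unfolding S_def by measurable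
  let ?J = "\<lambda>\<omega>. \<integral>\<^sup>+ y. ennreal (h (max 0 (y $ j))) * indicator {y. 1 < norm y} y \<partial>jumps \<omega>"
  have [measurable]: "?J \<in> borel_measurable M" by (rule measurable_nn_integral_jumps) measurable
  have main: "ennreal (h (\<Theta> 1 \<omega> $ j - \<Theta> 0 \<omega> $ j)) \<le> (2 * ?J \<omega> + ennreal B) + ennreal B * S \<omega>"
    if \<omega>: "\<omega> \<in> space M" for \<omega>
  proof -
    define x where "x = (\<lambda>t. \<Theta> t \<omega>)"
    have x: "cadlag x" unfolding x_def by (rule cadlag_X[OF \<omega>])
    obtain T where T: "finite T" "T \<subseteq> {0<..1}"
      "\<And>s. 0 < s \<Longrightarrow> s \<le> 1 \<Longrightarrow> s \<notin> T \<Longrightarrow> norm (path_jump x s) \<le> 1"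
      "\<And>f :: real ^ 'd \<Rightarrow> real. continuous_on UNIV f \<Longrightarrow> (\<And>y. norm y \<le> 1 \<Longrightarrow> f y = 0) \<Longrightarrow>
       (\<lambda>n. \<Sum>i<n. f (grid_increment x n i)) \<longlonglongrightarrow> (\<Sum>s\<in>T. f (path_jump x s))"
      by (rule cadlag_grid_sums[OF x zero_less_one]; rule that; auto)
    have pos: "0 \<le> path_jump x s $ i" if "s \<in> T" for s i
      using jump_nonneg[OF \<omega>, of s] that T(2) by (auto simp: x_def)
    define D z where "D = \<Theta> 1 \<omega> $ j - \<Theta> 0 \<omega> $ j" and "z = D - (\<Sum>s\<in>T. f (path_jump x s))"
    have "(\<lambda>n. D - (\<Sum>i<n. f (grid_increment x n i))) \<longlonglongrightarrow> z"
      unfolding z_def by (intro tendsto_intros T(4) f)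
    moreover have "\<forall>\<^sub>F n in sequentially. D - (\<Sum>i<n. f (grid_increment x n i)) = (\<Sum>i<n. u (\<xi> n i \<omega>))"
      using eventually_gt_at_top[of 0]
    proof eventually_elim
      case (elim n)
      have "(\<Sum>i<n. u (\<xi> n i \<omega>)) = (\<Sum>i<n. \<xi> n i \<omega> $ j) - (\<Sum>i<n. f (grid_increment x n i))"
        unfolding sum_subtractf[symmetric] by (simp add: u_def f_def x_def algebra_simps)
      then show ?case using sum_increments_coord[OF elim, of \<omega> j] by (simp add: D_def)
    qed
    ultimately have z: "(\<lambda>n. \<Sum>i<n. u (\<xi> n i \<omega>)) \<longlonglongrightarrow> z" by (rule Lim_transform_eventually)
    have z0: "0 \<le> z"
      by (rule tendsto_lowerbound[OF z]) (auto intro!: always_eventually sum_nonneg u_nonneg increment_nonneg \<omega>)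
    have "(\<lambda>n. \<Sum>i<n. ennreal (u (\<xi> n i \<omega>))) \<longlonglongrightarrow> ennreal z"
      using tendsto_ennrealI[OF z] by (subst sum_ennreal) (auto intro!: u_nonneg increment_nonneg \<omega>)
    then have S: "S \<omega> = ennreal z" unfolding S_def by (intro lim_imp_Liminf) auto
    have J: "?J \<omega> = (\<Sum>s\<in>T. ennreal (h (max 0 (path_jump x s $ j))) * indicator {y. 1 < norm y} (path_jump x s))"
      unfolding x_def[symmetric] by (rule nn_integral_jump_measure[OF _ _ zero_less_one T(1-3)]) auto
    have fpos: "0 \<le> f (path_jump x s)" "f (path_jump x s) \<le> path_jump x s $ j" if "s \<in> T" for s
      using pos[OF that, of j] wt[of "path_jump x s"] by (auto simp: f_def intro: mult_left_le_one_le)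
    have "h D = h ((\<Sum>s\<in>T. f (path_jump x s)) + z)" by (simp add: z_def)
    also have "\<dots> \<le> h (\<Sum>s\<in>T. f (path_jump x s)) + h z"
      using fpos z0 by (intro h.subadditive sum_nonneg) auto
    also have "\<dots> \<le> (\<Sum>s\<in>T. h (f (path_jump x s))) + B * (1 + z)"
      using fpos z0 T(1) by (intro add_mono h.sum_le h.linear_bound) auto
    finally have "ennreal (h D) \<le> ennreal ((\<Sum>s\<in>T. h (f (path_jump x s))) + B * (1 + z))" by (rule ennreal_leI)
    also have "\<dots> = (\<Sum>s\<in>T. ennreal (h (f (path_jump x s)))) + (ennreal B + ennreal B * ennreal z)"
      using fpos z0 h.B_nonneg h.nonneg
      by (simp add: ennreal_plus sum_nonneg distrib_left flip: sum_ennreal ennreal_mult)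
    also have "(\<Sum>s\<in>T. ennreal (h (f (path_jump x s)))) \<le> 2 * ?J \<omega>"
      unfolding J sum_distrib_left
    proof (rule sum_mono)
      fix s assume s: "s \<in> T"
      show "ennreal (h (f (path_jump x s))) \<le> 2 * (ennreal (h (max 0 (path_jump x s $ j))) * indicator {y. 1 < norm y} (path_jump x s))"
      proof (cases "1 < norm (path_jump x s)")
        case True
        have "ennreal (h (f (path_jump x s))) \<le> ennreal (2 * h (path_jump x s $ j))"
          by (intro ennreal_leI h.quasi_mono fpos s)
        also have "\<dots> = 2 * ennreal (h (path_jump x s $ j))"
          using h.nonneg[OF pos[OF s, of j]] by (subst ennreal_mult) auto
        finally show ?thesis using True pos[OF s, of j] by (simp add: max_def)
      next
        case False
        then show ?thesis by (simp add: f(2) h.zero)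
      qed
    qed
    finally show ?thesis unfolding S D_def by (simp add: add.assoc add_right_mono)
  qed
  have "(\<integral>\<^sup>+ \<omega>. S \<omega> \<partial>M) \<le> liminf (\<lambda>n. \<integral>\<^sup>+ \<omega>. (\<Sum>i<n. ennreal (u (\<xi> n i \<omega>))) \<partial>M)"
    unfolding S_def by (intro nn_integral_liminf) measurable
  also have "\<dots> \<le> C" using C(2) by (intro Liminf_le) auto
  finally have S: "(\<integral>\<^sup>+ \<omega>. S \<omega> \<partial>M) < \<infinity>" using C(1) by simp
  define J where "J = ?J"
  have J [measurable]: "J \<in> borel_measurable M" "(\<integral>\<^sup>+ \<omega>. J \<omega> \<partial>M) < \<infinity>"
    unfolding J_def by fact+
  have "(\<integral>\<^sup>+ \<omega>. ennreal (h (\<Theta> 1 \<omega> $ j - \<Theta> 0 \<omega> $ j)) \<partial>M) \<le>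
      (\<integral>\<^sup>+ \<omega>. (2 * J \<omega> + ennreal B) + ennreal B * S \<omega> \<partial>M)"
    unfolding J_def by (rule nn_integral_mono) (rule main)
  also have "\<dots> = (2 * (\<integral>\<^sup>+ \<omega>. J \<omega> \<partial>M) + ennreal B) + ennreal B * (\<integral>\<^sup>+ \<omega>. S \<omega> \<partial>M)"
    by (simp add: nn_integral_add nn_integral_cmult emeasure_space_1)
  also have "\<dots> < \<infinity>" using J(2) S by (simp add: ennreal_mult_less_top)
  finally show ?thesis .
qed

end

section \<open>Subordination in several coordinates\<close>

lemma bounded_linear_axis: "bounded_linear (axis j :: 'b::real_normed_vector \<Rightarrow> 'b ^ 'n::finite)"
proof (rule bounded_linear_intro[where K = 1])
  fix x y :: 'b and r :: real
  show "axis j (x + y) = (axis j x + axis j y :: 'b ^ 'n)" by (simp add: axis_def vec_eq_iff)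
  show "axis j (r *\<^sub>R x) = (r *\<^sub>R axis j x :: 'b ^ 'n)" by (simp add: axis_def vec_eq_iff)
  have "norm (axis j x :: 'b ^ 'n) \<le> (\<Sum>i\<in>UNIV. norm ((axis j x :: 'b ^ 'n) $ i))"
    unfolding norm_vec_def by (rule L2_set_le_sum) simp
  also have "\<dots> = (\<Sum>i\<in>UNIV. if i = j then norm x else 0)" by (intro sum.cong) (auto simp: axis_def)
  finally show "norm (axis j x :: 'b ^ 'n) \<le> norm x * 1" by simp
qed

lemma vec_lambda_eq_sum_axis: "(\<chi> j. f j) = (\<Sum>j\<in>UNIV. axis j (f j :: 'b::real_normed_vector))"
  by (simp add: vec_eq_iff axis_def if_distrib[of "\<lambda>v. v $ _"] sum.delta cong: if_cong)

lemma borel_measurable_vec_lambda: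
  fixes f :: "'n::finite \<Rightarrow> 'a \<Rightarrow> 'b::{real_normed_vector, second_countable_topology}"
  assumes "\<And>j. f j \<in> borel_measurable M"
  shows "(\<lambda>x. \<chi> j. f j x) \<in> borel_measurable M"
  unfolding vec_lambda_eq_sum_axis
  by (intro borel_measurable_sum borel_measurable_continuous_on[OF _ assms]
      linear_continuous_on bounded_linear_axis)

lemma integrable_vec_iff:
  fixes f :: "'a \<Rightarrow> 'b::{banach, second_countable_topology} ^ 'n::finite"
  shows "integrable M f \<longleftrightarrow> (\<forall>j. integrable M (\<lambda>x. f x $ j))"
proof safe
  fix j assume "integrable M f"
  then show "integrable M (\<lambda>x. f x $ j)"
    by (rule integrable_bounded_linear[OF bounded_linear_vec_nth])
next
  assume "\<forall>j. integrable M (\<lambda>x. f x $ j)"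
  then have "integrable M (\<lambda>x. \<Sum>j\<in>UNIV. axis j (f x $ j))"
    by (intro Bochner_Integration.integrable_sum integrable_bounded_linear[OF bounded_linear_axis]) auto
  then show "integrable M f" by (simp flip: vec_lambda_eq_sum_axis)
qed

lemma norm_vec_le_sum: "norm (x :: 'b::real_normed_vector ^ 'n::finite) \<le> (\<Sum>j\<in>UNIV. norm (x $ j))"
  unfolding norm_vec_def by (rule L2_set_le_sum) simp

locale subordination = T: increasing_levy M \<Theta>
  for M :: "'a measure" and \<Theta> :: "real \<Rightarrow> 'a \<Rightarrow> real ^ 'd::finite" +
  fixes L :: "'d \<Rightarrow> real \<Rightarrow> 'a \<Rightarrow> 'h::{banach, second_countable_topology}"
  assumes levy_L: "levy_process M (L j)"
    and indep_L_\<Theta>: "indep_processes M (joint_process L) \<Theta>"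
    and \<Theta>_nonneg: "\<omega> \<in> space M \<Longrightarrow> 0 \<le> t \<Longrightarrow> 0 \<le> \<Theta> t \<omega> $ j"
begin

sublocale L: levy M "L j" for j
  by unfold_locales (rule levy_L)

abbreviation X :: "'d \<Rightarrow> real \<Rightarrow> 'a \<Rightarrow> 'h" where
  "X j t \<omega> \<equiv> L j (\<Theta> t \<omega> $ j) \<omega>"

lemma joint_measurable: "0 \<le> t \<Longrightarrow> joint_process L t \<in> borel_measurable M"
  unfolding joint_process_def by (intro borel_measurable_vec_lambda L.measurable_Y)

lemma joint_cadlag:
  assumes "\<omega> \<in> space M" shows "cadlag (\<lambda>t. joint_process L t \<omega>)"
  unfolding cadlag_def joint_process_def
proof safe
  fix t :: real assume "0 \<le> t"
  then show "((\<lambda>t. \<chi> j. L j t \<omega>) \<longlongrightarrow> (\<chi> j. L j t \<omega>)) (at_right t)"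
    using L.cadlag_X[OF assms] by (intro tendsto_vec_lambda) (auto simp: cadlag_def)
next
  fix t :: real assume "0 < t"
  then have "\<forall>j. \<exists>l. ((\<lambda>t. L j t \<omega>) \<longlongrightarrow> l) (at_left t)"
    using L.cadlag_X[OF assms] by (auto simp: cadlag_def)
  then obtain l where "\<And>j. ((\<lambda>t. L j t \<omega>) \<longlongrightarrow> l j) (at_left t)" by metis
  then have "((\<lambda>t. \<chi> j. L j t \<omega>) \<longlongrightarrow> (\<chi> j. l j)) (at_left t)" by (intro tendsto_vec_lambda)
  then show "\<exists>l. ((\<lambda>t. \<chi> j. L j t \<omega>) \<longlongrightarrow> l) (at_left t)" by blast
qed

lemma eval_joint:
  assumes "\<omega> \<in> space M" "0 \<le> r"
  shows "path_eval (process_path (joint_process L) \<omega>) r $ j = L j r \<omega>"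
  unfolding process_path_def
  using path_eval_cadlag[OF joint_cadlag[OF assms(1)] assms(2)] by (simp add: joint_process_def)

lemma eval_measurable [measurable]:
  "(\<lambda>z. path_eval (fst z) (snd z $ j) $ j) \<in> borel_measurable
     ((path_space :: (real \<Rightarrow> 'h ^ 'd) measure) \<Otimes>\<^sub>M (borel :: (real ^ 'd) measure))"
proof -
  have [measurable]: "(\<lambda>z. snd z $ j) \<in> borel_measurable
     ((path_space :: (real \<Rightarrow> 'h ^ 'd) measure) \<Otimes>\<^sub>M (borel :: (real ^ 'd) measure))"
    by (rule borel_measurable_vec_nth) measurable
  have "(\<lambda>z. (fst z, snd z $ j)) \<in> (path_space :: (real \<Rightarrow> 'h ^ 'd) measure) \<Otimes>\<^sub>M (borel :: (real ^ 'd) measure)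
      \<rightarrow>\<^sub>M path_space \<Otimes>\<^sub>M borel" by measurable
  from measurable_compose[OF this measurable_path_eval] show ?thesis
    by (intro borel_measurable_vec_nth) simp
qed

lemma path_measurable [measurable]: "process_path (joint_process L) \<in> M \<rightarrow>\<^sub>M path_space"
  by (rule measurable_process_path[OF joint_measurable])

lemma joint_distr:
  "0 \<le> t \<Longrightarrow> distr M (path_space \<Otimes>\<^sub>M borel) (\<lambda>\<omega>. (process_path (joint_process L) \<omega>, \<Theta> t \<omega>)) =
    distr M path_space (process_path (joint_process L)) \<Otimes>\<^sub>M distr M borel (\<Theta> t)"
  by (rule T.indep_processes_joint_distr[OF joint_measurable T.measurable_Y indep_L_\<Theta>])

lemma X_eq_eval:
  "\<omega> \<in> space M \<Longrightarrow> 0 \<le> t \<Longrightarrow> X j t \<omega> = path_eval (process_path (joint_process L) \<omega>) (\<Theta> t \<omega> $ j) $ j"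
  by (simp add: eval_joint \<Theta>_nonneg)

lemma X_measurable:
  assumes "0 \<le> t" shows "X j t \<in> borel_measurable M"
proof -
  have [measurable]: "\<Theta> t \<in> borel_measurable M" using assms by (rule T.measurable_Y)
  have "(\<lambda>\<omega>. (process_path (joint_process L) \<omega>, \<Theta> t \<omega>)) \<in> M \<rightarrow>\<^sub>M path_space \<Otimes>\<^sub>M borel" by measurable
  from measurable_compose[OF this eval_measurable[of j]] show ?thesis
    using X_eq_eval[OF _ assms] by (simp cong: measurable_cong)
qed

text \<open>Conditioning on the time change: given \<open>\<Theta>\<close>, the process \<open>L j\<close> is evaluated at a deterministic time.\<close>
lemma moment_X:
  assumes t: "0 \<le> t"
  shows "(\<integral>\<^sup>+ \<omega>. ennreal (norm (X j t \<omega>)) \<partial>M) = (\<integral>\<^sup>+ \<omega>. L.moment j (\<Theta> t \<omega> $ j) \<partial>M)"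
proof -
  have "(\<integral>\<^sup>+ \<omega>. ennreal (norm (X j t \<omega>)) \<partial>M) =
     (\<integral>\<^sup>+ \<omega>. ennreal (norm (path_eval (process_path (joint_process L) \<omega>) (\<Theta> t \<omega> $ j) $ j)) \<partial>M)"
    using t by (intro nn_integral_cong) (simp add: X_eq_eval)
  also have "\<dots> = (\<integral>\<^sup>+ \<omega>'. (\<integral>\<^sup>+ \<omega>. ennreal (norm (path_eval (process_path (joint_process L) \<omega>) (\<Theta> t \<omega>' $ j) $ j)) \<partial>M) \<partial>M)"
    by (rule T.nn_integral_product_distr[OF path_measurable T.measurable_Y[OF t] joint_distr[OF t],
         where G = "\<lambda>p \<theta>. ennreal (norm (path_eval p (\<theta> $ j) $ j))"])
      (use eval_measurable[of j] in \<open>auto simp: case_prod_beta'\<close>)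
  also have "\<dots> = (\<integral>\<^sup>+ \<omega>. L.moment j (\<Theta> t \<omega> $ j) \<partial>M)"
    unfolding L.moment_def using t by (intro nn_integral_cong) (simp add: eval_joint \<Theta>_nonneg)
  finally show ?thesis .
qed

lemma mean_X:
  assumes t: "0 \<le> t" and int: "integrable M (X j t)"
  shows "(\<integral> \<omega>. X j t \<omega> \<partial>M) = (\<integral> \<omega>'. (\<integral> \<omega>. L j (\<Theta> t \<omega>' $ j) \<omega> \<partial>M) \<partial>M)"
proof -
  have eq: "(\<integral> \<omega>. X j t \<omega> \<partial>M) =
     (\<integral> \<omega>. path_eval (process_path (joint_process L) \<omega>) (\<Theta> t \<omega> $ j) $ j \<partial>M)"
    using t by (intro Bochner_Integration.integral_cong) (auto simp: X_eq_eval)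
  have "integrable M (\<lambda>\<omega>. path_eval (process_path (joint_process L) \<omega>) (\<Theta> t \<omega> $ j) $ j)"
    by (rule Bochner_Integration.integrable_cong[THEN iffD1, OF refl _ int]) (simp add: X_eq_eval t)
  then have "(\<integral> \<omega>. path_eval (process_path (joint_process L) \<omega>) (\<Theta> t \<omega> $ j) $ j \<partial>M) =
      (\<integral> \<omega>'. (\<integral> \<omega>. path_eval (process_path (joint_process L) \<omega>) (\<Theta> t \<omega>' $ j) $ j \<partial>M) \<partial>M)"
    by (intro T.integral_product_distr[OF path_measurable T.measurable_Y[OF t] joint_distr[OF t],
         where G = "\<lambda>p \<theta>. path_eval p (\<theta> $ j) $ j"])
      (use eval_measurable[of j] in \<open>auto simp: case_prod_beta'\<close>)
  also have "\<dots> = (\<integral> \<omega>'. (\<integral> \<omega>. L j (\<Theta> t \<omega>' $ j) \<omega> \<partial>M) \<partial>M)"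
    using t by (intro Bochner_Integration.integral_cong refl) (simp add: eval_joint \<Theta>_nonneg)
  finally show ?thesis unfolding eq .
qed

text \<open>Truncation at \<open>0\<close> discards the negative times, at which nothing is known about \<open>L j\<close>.\<close>
lemma moment_measurable [measurable]: "(\<lambda>r. L.moment j (max 0 r)) \<in> borel_measurable borel"
proof -
  have [measurable]: "process_path (L j) \<in> M \<rightarrow>\<^sub>M path_space"
    by (rule measurable_process_path[OF L.measurable_Y])
  have "(\<lambda>z. (process_path (L j) (snd z), max 0 (fst z))) \<in> (borel :: real measure) \<Otimes>\<^sub>M M \<rightarrow>\<^sub>M path_space \<Otimes>\<^sub>M borel"
    by measurable
  from measurable_compose[OF this measurable_path_eval]
  have [measurable]: "(\<lambda>z. path_eval (process_path (L j) (snd z)) (max 0 (fst z))) \<in> borel_measurable ((borel :: real measure) \<Otimes>\<^sub>M M)"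
    by simp
  have "L.moment j (max 0 r) = (\<integral>\<^sup>+ \<omega>. ennreal (norm (path_eval (process_path (L j) \<omega>) (max 0 r))) \<partial>M)" for r
    unfolding L.moment_def process_path_def
    by (intro nn_integral_cong) (simp add: path_eval_cadlag[OF L.cadlag_X])
  moreover have "(\<lambda>r. \<integral>\<^sup>+ \<omega>. ennreal (norm (path_eval (process_path (L j) \<omega>) (max 0 r))) \<partial>M) \<in> borel_measurable borel"
    by (rule T.borel_measurable_nn_integral) (simp add: case_prod_beta')
  ultimately show ?thesis by simp
qed

lemma integrable_X_iff: "0 \<le> t \<Longrightarrow> integrable M (X j t) \<longleftrightarrow> (\<integral>\<^sup>+ \<omega>. L.moment j (\<Theta> t \<omega> $ j) \<partial>M) < \<infinity>"
  by (simp add: integrable_iff_bounded X_measurable moment_X)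

text \<open>If \<open>L j\<close> is not integrable, its first moment is infinite at every positive time, so \<open>\<Theta> t $ j\<close> must
  vanish almost surely for each \<open>t\<close>. Monotone paths make one null set, coming from integer times, enough.\<close>
lemma integrable_X_dichotomy:
  assumes int: "integrable_process M (X j)" and not_int: "\<not> integrable_process M (L j)"
  shows "AE \<omega> in M. \<forall>t\<ge>0. \<Theta> t \<omega> $ j = 0"
proof -
  have "AE \<omega> in M. \<Theta> (real n) \<omega> $ j = 0" for n
  proof -
    have "(\<integral>\<^sup>+ \<omega>. L.moment j (\<Theta> (real n) \<omega> $ j) \<partial>M) = (\<integral>\<^sup>+ \<omega>. L.moment j (max 0 (\<Theta> (real n) \<omega> $ j)) \<partial>M)"
      by (intro nn_integral_cong) (simp add: \<Theta>_nonneg max_def)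
    moreover have "(\<integral>\<^sup>+ \<omega>. L.moment j (\<Theta> (real n) \<omega> $ j) \<partial>M) < \<infinity>"
      using int integrable_X_iff[of "real n" j] by (simp add: integrable_process_def)
    moreover have "(\<lambda>\<omega>. L.moment j (max 0 (\<Theta> (real n) \<omega> $ j))) \<in> borel_measurable M"
      using T.measurable_coord[of "real n" j] by (intro measurable_compose[OF _ moment_measurable]) simp
    ultimately have "AE \<omega> in M. L.moment j (max 0 (\<Theta> (real n) \<omega> $ j)) \<noteq> \<infinity>"
      by (intro nn_integral_PInf_AE) auto
    with AE_space show ?thesis
    proof eventually_elim
      case (elim \<omega>)
      show ?case
      proof (rule ccontr)
        assume "\<Theta> (real n) \<omega> $ j \<noteq> 0"
        then have pos: "0 < \<Theta> (real n) \<omega> $ j" using \<Theta>_nonneg[OF elim(1), of "real n" j] by simp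
        then have "L.moment j (\<Theta> (real n) \<omega> $ j) < \<infinity>" using elim(2) by (simp add: max_def less_top)
        from L.integrable_process_if_moment_finite[OF pos this] not_int show False by simp
      qed
    qed
  qed
  then have "AE \<omega> in M. \<forall>n. \<Theta> (real n) \<omega> $ j = 0" by (simp add: AE_all_countable)
  with AE_space show ?thesis
  proof eventually_elim
    case (elim \<omega>)
    show ?case
    proof (intro allI impI antisym)
      fix t :: real assume t: "0 \<le> t"
      obtain n where "t \<le> real n" using real_arch_simple by blast
      then show "\<Theta> t \<omega> $ j \<le> 0" using T.mono_coord[OF elim(1) t, of "real n" j] elim(2) by simp
    qed (rule \<Theta>_nonneg[OF elim(1)])
  qed
qed

definition mean_norm :: "'d \<Rightarrow> real \<Rightarrow> real" where
  "mean_norm j r = enn2real (L.moment j (max 0 r))"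

lemma mean_norm_measurable [measurable]: "mean_norm j \<in> borel_measurable borel"
  unfolding mean_norm_def by measurable

lemma mean_norm_quasi_subadditive:
  assumes "integrable_process M (L j)"
  obtains B where "quasi_subadditive (mean_norm j) B"
proof -
  interpret Lj: integrable_levy M "L j" by unfold_locales (rule assms)
  have h: "mean_norm j r = (\<integral> \<omega>. norm (L j r \<omega>) \<partial>M)" if "0 \<le> r" for r
    using that by (simp add: mean_norm_def max_def Lj.moment_eq)
  obtain B where B: "\<And>s. 0 \<le> s \<Longrightarrow> s \<le> 1 \<Longrightarrow> (\<integral> \<omega>. norm (L j s \<omega>) \<partial>M) \<le> B"
    by (rule Lj.moment_bounded_unit_interval) (rule that)
  have "quasi_subadditive (mean_norm j) B"
  proof
    show "mean_norm j 0 = 0" by (simp add: mean_norm_def L.moment_0)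
    show "mean_norm j (r + s) \<le> mean_norm j r + mean_norm j s" if "0 \<le> r" "0 \<le> s" for r s
      using L.moment_add[where j = j, OF that] that by (simp add: h Lj.moment_eq flip: ennreal_plus)
  qed (auto simp: h B Lj.moment_quasi_mono)
  then show ?thesis by (rule that)
qed

lemma moment_eq_mean_norm: "integrable_process M (L j) \<Longrightarrow> 0 \<le> r \<Longrightarrow> L.moment j r = ennreal (mean_norm j r)"
  using L.integrable_iff_moment[of r j] by (simp add: mean_norm_def integrable_process_def max_def less_top)

lemma mean_norm_increment:
  "(\<integral>\<^sup>+ \<omega>. ennreal (mean_norm j (\<Theta> 1 \<omega> $ j - \<Theta> 0 \<omega> $ j)) \<partial>M) = (\<integral>\<^sup>+ \<omega>. ennreal (mean_norm j (\<Theta> 1 \<omega> $ j)) \<partial>M)"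
  by (rule nn_integral_cong_AE) (use T.start_zero in eventually_elim, simp)

definition jump_moment :: "'d \<Rightarrow> ennreal" where
  "jump_moment j = (\<integral>\<^sup>+ \<theta>. L.moment j (max 0 (\<theta> $ j)) * indicator {\<theta>. 1 < norm \<theta>} \<theta> \<partial>levy_measure M \<Theta>)"

lemma coord_measurable [measurable]: "(\<lambda>y :: real ^ 'd. y $ j) \<in> borel_measurable borel"
  by (intro borel_measurable_continuous_onI continuous_intros)

lemma moment_coord_measurable [measurable]:
  "(\<lambda>\<theta> :: real ^ 'd. L.moment j (max 0 (\<theta> $ j))) \<in> borel_measurable borel"
  by (rule measurable_compose[OF coord_measurable moment_measurable])

lemma jump_moment_eq:
  "jump_moment j = (\<integral>\<^sup>+ \<omega>. (\<integral>\<^sup>+ \<theta>. L.moment j (max 0 (\<theta> $ j)) * indicator {\<theta>. 1 < norm \<theta>} \<theta> \<partial>T.jumps \<omega>) \<partial>M)"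
  unfolding jump_moment_def by (rule T.nn_integral_levy_measure) measurable

lemma jump_moment_mean_norm:
  assumes "integrable_process M (L j)"
  shows "jump_moment j =
    (\<integral>\<^sup>+ \<omega>. (\<integral>\<^sup>+ \<theta>. ennreal (mean_norm j (max 0 (\<theta> $ j))) * indicator {\<theta>. 1 < norm \<theta>} \<theta> \<partial>T.jumps \<omega>) \<partial>M)"
  unfolding jump_moment_eq by (simp add: moment_eq_mean_norm[OF assms])

text \<open>If \<open>L j\<close> is not integrable, then almost surely \<open>\<Theta> $ j\<close> vanishes and has no jumps, so the
  jump moment is \<open>0\<close>; otherwise \<open>E |X j 1|\<close> controls it.\<close>
lemma jump_moment_finite_if_integrable_X:
  assumes int: "integrable_process M (X j)"
  shows "jump_moment j < \<infinity>"
proof (cases "integrable_process M (L j)")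
  case True
  obtain B where B: "quasi_subadditive (mean_norm j) B" by (rule mean_norm_quasi_subadditive[OF True]) (rule that)
  have "(\<integral>\<^sup>+ \<omega>. ennreal (mean_norm j (\<Theta> 1 \<omega> $ j)) \<partial>M) = (\<integral>\<^sup>+ \<omega>. L.moment j (\<Theta> 1 \<omega> $ j) \<partial>M)"
    by (intro nn_integral_cong) (simp add: moment_eq_mean_norm[OF True] \<Theta>_nonneg)
  also have "\<dots> < \<infinity>" using int integrable_X_iff[of 1 j] by (simp add: integrable_process_def)
  finally show ?thesis
    unfolding jump_moment_mean_norm[OF True]
    by (intro T.jump_moment_finite[OF B]) (simp_all add: mean_norm_increment)
next
  case False
  have "jump_moment j = (\<integral>\<^sup>+ \<omega>. 0 \<partial>M)"
    unfolding jump_moment_eq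
  proof (rule nn_integral_cong_AE)
    show "AE \<omega> in M. (\<integral>\<^sup>+ \<theta>. L.moment j (max 0 (\<theta> $ j)) * indicator {\<theta>. 1 < norm \<theta>} \<theta> \<partial>T.jumps \<omega>) = 0"
      using integrable_X_dichotomy[OF int False] AE_space
    proof eventually_elim
      case (elim \<omega>)
      have zero: "path_jump (\<lambda>t. \<Theta> t \<omega>) s $ j = 0" if "0 < s" for s
      proof -
        have "(\<lambda>n. T.\<xi> n (nat \<lceil>real n * s\<rceil> - 1) \<omega> $ j) \<longlonglongrightarrow> path_jump (\<lambda>t. \<Theta> t \<omega>) s $ j"
          by (intro tendsto_vec_nth cadlag_grid_increment_tendsto_jump T.cadlag_X elim that)
        moreover have "T.\<xi> n i \<omega> $ j = 0" for n i using elim(1) by (simp add: grid_increment_def)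
        ultimately show ?thesis by (simp add: LIMSEQ_const_iff)
      qed
      have N: "{y :: real ^ 'd. y $ j \<noteq> 0} \<in> sets borel" by measurable
      have "{s. 0 < s \<and> s \<le> 1 \<and> path_jump (\<lambda>t. \<Theta> t \<omega>) s \<noteq> 0 \<and> path_jump (\<lambda>t. \<Theta> t \<omega>) s \<in> {y. y $ j \<noteq> 0}} = {}"
        using zero by auto
      then have "emeasure (T.jumps \<omega>) {y. y $ j \<noteq> 0} = 0"
        by (simp only: emeasure_jump_measure[OF N] emeasure_empty)
      then have "AE y in T.jumps \<omega>. y $ j = 0"
        by (intro AE_I'[of "{y. y $ j \<noteq> 0}"]) (auto simp: null_sets_def)
      then have "(\<integral>\<^sup>+ \<theta>. L.moment j (max 0 (\<theta> $ j)) * indicator {\<theta>. 1 < norm \<theta>} \<theta> \<partial>T.jumps \<omega>) = (\<integral>\<^sup>+ \<theta>. 0 \<partial>T.jumps \<omega>)"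
        by (rule nn_integral_cong_AE[OF AE_mp[OF _ AE_I2]]) (simp add: L.moment_0)
      then show ?case by simp
    qed
  qed
  then show ?thesis by simp
qed

text \<open>The comparison with the jumps settles time \<open>1\<close>. Subadditivity and stationarity of \<open>\<Theta>\<close> extend this to integer times,
  and quasi-monotonicity to all times.\<close>
lemma integrable_X_if_jump_moment_finite:
  assumes int: "integrable_process M (L j)" and J: "jump_moment j < \<infinity>"
  shows "integrable_process M (X j)"
proof -
  obtain B where B: "quasi_subadditive (mean_norm j) B" by (rule mean_norm_quasi_subadditive[OF int]) (rule that)
  interpret h: quasi_subadditive "mean_norm j" B by (rule B)
  define I where "I t = (\<integral>\<^sup>+ \<omega>. ennreal (mean_norm j (\<Theta> t \<omega> $ j)) \<partial>M)" for t
  have I1: "I 1 < \<infinity>"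
    unfolding I_def mean_norm_increment[symmetric]
    using J unfolding jump_moment_mean_norm[OF int] by (intro T.moment_finite_if_jump_moment_finite[OF B]) simp_all
  have In: "I (real n) < \<infinity>" for n
  proof (induction n)
    case 0
    have "I 0 = (\<integral>\<^sup>+ \<omega>. 0 \<partial>M)"
      unfolding I_def by (rule nn_integral_cong_AE) (use T.start_zero in eventually_elim, simp add: h.zero)
    then show ?case by simp
  next
    case (Suc n)
    have [measurable]: "(\<lambda>\<omega>. \<Theta> (real n) \<omega> $ j) \<in> borel_measurable M" "(\<lambda>\<omega>. \<Theta> (real (Suc n)) \<omega> $ j) \<in> borel_measurable M"
      by (intro T.measurable_coord; simp)+
    have "I (real (Suc n)) \<le> (\<integral>\<^sup>+ \<omega>. ennreal (mean_norm j (\<Theta> (real n) \<omega> $ j)) +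
        ennreal (mean_norm j ((\<Theta> (real (Suc n)) \<omega> - \<Theta> (real n) \<omega>) $ j)) \<partial>M)"
      unfolding I_def
    proof (rule nn_integral_mono)
      fix \<omega> assume \<omega>: "\<omega> \<in> space M"
      have p: "0 \<le> \<Theta> (real n) \<omega> $ j" "0 \<le> (\<Theta> (real (Suc n)) \<omega> - \<Theta> (real n) \<omega>) $ j"
        using \<Theta>_nonneg[OF \<omega>] T.mono_coord[OF \<omega>, of "real n" "real (Suc n)" j] by auto
      show "ennreal (mean_norm j (\<Theta> (real (Suc n)) \<omega> $ j)) \<le> ennreal (mean_norm j (\<Theta> (real n) \<omega> $ j)) +
        ennreal (mean_norm j ((\<Theta> (real (Suc n)) \<omega> - \<Theta> (real n) \<omega>) $ j))"
        using h.subadditive[OF p] h.nonneg[OF p(1)] h.nonneg[OF p(2)]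
        by (simp add: ennreal_leI flip: ennreal_plus)
    qed
    also have "\<dots> = I (real n) + (\<integral>\<^sup>+ \<omega>. ennreal (mean_norm j ((\<Theta> (real (Suc n)) \<omega> - \<Theta> (real n) \<omega>) $ j)) \<partial>M)"
      unfolding I_def by (subst nn_integral_add) auto
    also have "(\<integral>\<^sup>+ \<omega>. ennreal (mean_norm j ((\<Theta> (real (Suc n)) \<omega> - \<Theta> (real n) \<omega>) $ j)) \<partial>M) = I 1"
      unfolding I_def
      using T.nn_integral_increment[of "real n" "real (Suc n)" "\<lambda>y. ennreal (mean_norm j (y $ j))"] by simp
    finally show ?case using Suc I1 by (simp add: less_top le_less_trans)
  qed
  show ?thesis
    unfolding integrable_process_def
  proof (intro allI impI)
    fix t :: real assume t: "0 \<le> t"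
    obtain n where n: "t \<le> real n" using real_arch_simple by blast
    have [measurable]: "(\<lambda>\<omega>. \<Theta> (real n) \<omega> $ j) \<in> borel_measurable M" by (intro T.measurable_coord) simp
    have "(\<integral>\<^sup>+ \<omega>. L.moment j (\<Theta> t \<omega> $ j) \<partial>M) \<le> (\<integral>\<^sup>+ \<omega>. 2 * ennreal (mean_norm j (\<Theta> (real n) \<omega> $ j)) \<partial>M)"
    proof (rule nn_integral_mono)
      fix \<omega> assume \<omega>: "\<omega> \<in> space M"
      have "mean_norm j (\<Theta> t \<omega> $ j) \<le> 2 * mean_norm j (\<Theta> (real n) \<omega> $ j)"
        by (intro h.quasi_mono \<Theta>_nonneg T.mono_coord \<omega> t n)
      then have "ennreal (mean_norm j (\<Theta> t \<omega> $ j)) \<le> ennreal (2 * mean_norm j (\<Theta> (real n) \<omega> $ j))" by (rule ennreal_leI)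
      also have "\<dots> = 2 * ennreal (mean_norm j (\<Theta> (real n) \<omega> $ j))"
        using h.nonneg[OF \<Theta>_nonneg[OF \<omega>, of "real n" j]] by (subst ennreal_mult) auto
      finally show "L.moment j (\<Theta> t \<omega> $ j) \<le> 2 * ennreal (mean_norm j (\<Theta> (real n) \<omega> $ j))"
        by (simp add: moment_eq_mean_norm[OF int] \<Theta>_nonneg[OF \<omega> t])
    qed
    also have "\<dots> = 2 * I (real n)" unfolding I_def by (rule nn_integral_cmult) measurable
    also have "\<dots> < \<infinity>" using In by (simp add: ennreal_mult_less_top)
    finally show "integrable M (X j t)" by (simp add: integrable_X_iff t)
  qed
qed

lemma integrable_X_if_integrable_\<Theta>:
  assumes L: "integrable_process M (L j)" and T: "integrable_process M (\<lambda>t \<omega>. \<Theta> t \<omega> $ j)"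
  shows "integrable_process M (X j)"
  unfolding integrable_process_def
proof (intro allI impI)
  fix t :: real assume t: "0 \<le> t"
  obtain B where B: "quasi_subadditive (mean_norm j) B" by (rule mean_norm_quasi_subadditive[OF L]) (rule that)
  interpret h: quasi_subadditive "mean_norm j" B by (rule B)
  have int: "integrable M (\<lambda>\<omega>. B * (1 + \<Theta> t \<omega> $ j))" using T t by (auto simp: integrable_process_def)
  have "(\<integral>\<^sup>+ \<omega>. L.moment j (\<Theta> t \<omega> $ j) \<partial>M) \<le> (\<integral>\<^sup>+ \<omega>. ennreal (norm (B * (1 + \<Theta> t \<omega> $ j))) \<partial>M)"
  proof (rule nn_integral_mono)
    fix \<omega> assume "\<omega> \<in> space M"
    then have "0 \<le> \<Theta> t \<omega> $ j" using t by (rule \<Theta>_nonneg)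
    then show "L.moment j (\<Theta> t \<omega> $ j) \<le> ennreal (norm (B * (1 + \<Theta> t \<omega> $ j)))"
      using h.linear_bound[of "\<Theta> t \<omega> $ j"] by (auto simp: moment_eq_mean_norm[OF L] intro!: ennreal_leI)
  qed
  also have "\<dots> < \<infinity>" using int unfolding integrable_iff_bounded by (rule conjunct2)
  finally show "integrable M (X j t)" by (simp add: integrable_X_iff t)
qed

lemma mean_X_eq:
  assumes L: "integrable_process M (L j)" and t: "0 \<le> t" and X: "integrable M (X j t)"
  shows "(\<integral> \<omega>. X j t \<omega> \<partial>M) = (\<integral> \<omega>. \<Theta> t \<omega> $ j *\<^sub>R (\<integral> \<omega>. L j 1 \<omega> \<partial>M) \<partial>M)"
proof -
  interpret Lj: integrable_levy M "L j" by unfold_locales (rule L)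
  show ?thesis
    unfolding mean_X[OF t X] using t
    by (intro Bochner_Integration.integral_cong refl Lj.mean_linear \<Theta>_nonneg)
qed

text \<open>With \<open>m = E L j 1\<close>, \<open>E |X j t| \<ge> norm m * E (\<Theta> t $ j)\<close>. At a time where the last factor is infinite this
  leaves only \<open>m = 0\<close>, and then the mean of \<open>X j\<close> vanishes at all times.\<close>
lemma mean_zero_X:
  assumes X: "integrable_process M (X j)" and T: "\<not> integrable_process M (\<lambda>t \<omega>. \<Theta> t \<omega> $ j)"
  shows "mean_zero_process M (X j)"
proof -
  have L: "integrable_process M (L j)"
  proof (rule ccontr)
    assume "\<not> integrable_process M (L j)"
    from integrable_X_dichotomy[OF X this] have ae: "AE \<omega> in M. \<forall>t\<ge>0. \<Theta> t \<omega> $ j = 0" .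
    have "integrable M (\<lambda>\<omega>. \<Theta> t \<omega> $ j)" if "0 \<le> t" for t
    proof -
      have "integrable M (\<lambda>\<omega>. \<Theta> t \<omega> $ j) \<longleftrightarrow> integrable M (\<lambda>\<omega>. 0 :: real)"
        using ae T.measurable_coord[OF that] that by (intro integrable_cong_AE) auto
      then show ?thesis by simp
    qed
    then show False using T by (simp add: integrable_process_def)
  qed
  interpret Lj: integrable_levy M "L j" by unfold_locales (rule L)
  define m where "m = (\<integral> \<omega>. L j 1 \<omega> \<partial>M)"
  obtain t where t: "0 \<le> t" "\<not> integrable M (\<lambda>\<omega>. \<Theta> t \<omega> $ j)"
    using T by (auto simp: integrable_process_def)
  have [measurable]: "(\<lambda>\<omega>. \<Theta> t \<omega> $ j) \<in> borel_measurable M" using t(1) by (rule T.measurable_coord)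
  have inf: "(\<integral>\<^sup>+ \<omega>. ennreal (\<Theta> t \<omega> $ j) \<partial>M) = \<infinity>"
  proof -
    have "(\<integral>\<^sup>+ \<omega>. ennreal (\<Theta> t \<omega> $ j) \<partial>M) = (\<integral>\<^sup>+ \<omega>. ennreal (norm (\<Theta> t \<omega> $ j)) \<partial>M)"
      using t(1) by (intro nn_integral_cong) (simp add: \<Theta>_nonneg)
    then show ?thesis using t(2) by (simp add: integrable_iff_bounded not_less top_unique)
  qed
  have "ennreal (norm m) * (\<integral>\<^sup>+ \<omega>. ennreal (\<Theta> t \<omega> $ j) \<partial>M) = (\<integral>\<^sup>+ \<omega>. ennreal (norm m) * ennreal (\<Theta> t \<omega> $ j) \<partial>M)"
    by (rule nn_integral_cmult[symmetric]) measurable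
  also have "\<dots> \<le> (\<integral>\<^sup>+ \<omega>. L.moment j (\<Theta> t \<omega> $ j) \<partial>M)"
  proof (rule nn_integral_mono)
    fix \<omega> assume "\<omega> \<in> space M"
    then have pos: "0 \<le> \<Theta> t \<omega> $ j" using t(1) by (rule \<Theta>_nonneg)
    have "norm (\<integral> \<omega>'. L j (\<Theta> t \<omega> $ j) \<omega>' \<partial>M) = \<Theta> t \<omega> $ j * norm m"
      unfolding m_def using pos by (subst Lj.mean_linear) auto
    then have "norm m * \<Theta> t \<omega> $ j \<le> (\<integral> \<omega>'. norm (L j (\<Theta> t \<omega> $ j) \<omega>') \<partial>M)"
      using Lj.norm_mean_le[of "\<Theta> t \<omega> $ j"] by (simp add: mult.commute)
    then show "ennreal (norm m) * ennreal (\<Theta> t \<omega> $ j) \<le> L.moment j (\<Theta> t \<omega> $ j)"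
      using pos by (simp add: Lj.moment_eq ennreal_leI flip: ennreal_mult)
  qed
  also have "\<dots> < \<infinity>" using X t(1) integrable_X_iff[OF t(1), of j] by (simp add: integrable_process_def)
  finally have "m = 0" unfolding inf by (auto simp: ennreal_mult_top split: if_splits)
  then show ?thesis
    using X mean_X_eq[OF L] by (auto simp: mean_zero_process_def integrable_process_def m_def)
qed

text \<open>The jumps of nondecreasing paths are nonnegative. This makes the values of \<open>L\<close> at negative times
  invisible to the integral against the Levy measure.\<close>
lemma levy_measure_nonneg: "AE \<theta> in levy_measure M \<Theta>. \<forall>j. 0 \<le> \<theta> $ j"
proof -
  let ?N = "{\<theta> :: real ^ 'd. \<exists>j. \<theta> $ j < 0}"
  have N: "?N \<in> sets borel" by measurable
  have "emeasure (levy_measure M \<Theta>) ?N = (\<integral>\<^sup>+ \<omega>. emeasure (T.jumps \<omega>) ?N \<partial>M)"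
    using N by (rule T.emeasure_levy_measure)
  also have "\<dots> = (\<integral>\<^sup>+ \<omega>. 0 \<partial>M)"
  proof (rule nn_integral_cong)
    fix \<omega> assume "\<omega> \<in> space M"
    then have "{s. 0 < s \<and> s \<le> 1 \<and> path_jump (\<lambda>t. \<Theta> t \<omega>) s \<noteq> 0 \<and> path_jump (\<lambda>t. \<Theta> t \<omega>) s \<in> ?N} = {}"
      using T.jump_nonneg by (auto simp: not_less[symmetric])
    then show "emeasure (T.jumps \<omega>) ?N = 0" by (simp only: emeasure_jump_measure[OF N] emeasure_empty)
  qed
  finally show ?thesis using N by (intro AE_I'[of ?N]) (auto simp: null_sets_def not_le)
qed

lemma levy_integral_finite_iff:
  "(\<integral>\<^sup>+ \<theta>\<in>{\<theta>. norm \<theta> > 1}. (\<integral>\<^sup>+ \<omega>. norm (multi_time L \<theta> \<omega>) \<partial>M) \<partial>levy_measure M \<Theta>) < \<infinity>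
    \<longleftrightarrow> (\<forall>j. jump_moment j < \<infinity>)" (is "?I < \<infinity> \<longleftrightarrow> _")
proof safe
  have lower: "jump_moment j \<le> ?I" for j
    unfolding jump_moment_def
  proof (rule nn_integral_mono_AE)
    show "AE \<theta> in levy_measure M \<Theta>. L.moment j (max 0 (\<theta> $ j)) * indicator {\<theta>. 1 < norm \<theta>} \<theta> \<le>
        (\<integral>\<^sup>+ \<omega>. norm (multi_time L \<theta> \<omega>) \<partial>M) * indicator {\<theta>. 1 < norm \<theta>} \<theta>"
      using levy_measure_nonneg
    proof eventually_elim
      case (elim \<theta>)
      then have "L.moment j (max 0 (\<theta> $ j)) \<le> (\<integral>\<^sup>+ \<omega>. norm (multi_time L \<theta> \<omega>) \<partial>M)"
        unfolding L.moment_def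
        by (intro nn_integral_mono ennreal_leI)
          (use Finite_Cartesian_Product.norm_nth_le[of "multi_time L \<theta> _" j] in \<open>simp add: multi_time_def max_def\<close>)
      then show ?case by (rule mult_right_mono) simp
    qed
  qed
  show "jump_moment j < \<infinity>" if "?I < \<infinity>" for j using lower[of j] that by simp
  have "?I \<le> (\<integral>\<^sup>+ \<theta>. (\<Sum>j\<in>UNIV. L.moment j (max 0 (\<theta> $ j)) * indicator {\<theta>. 1 < norm \<theta>} \<theta>) \<partial>levy_measure M \<Theta>)"
  proof (rule nn_integral_mono_AE)
    show "AE \<theta> in levy_measure M \<Theta>. (\<integral>\<^sup>+ \<omega>. norm (multi_time L \<theta> \<omega>) \<partial>M) * indicator {\<theta>. 1 < norm \<theta>} \<theta> \<le>
        (\<Sum>j\<in>UNIV. L.moment j (max 0 (\<theta> $ j)) * indicator {\<theta>. 1 < norm \<theta>} \<theta>)"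
      using levy_measure_nonneg
    proof eventually_elim
      case (elim \<theta>)
      then have \<theta>: "max 0 (\<theta> $ j) = \<theta> $ j" for j by (simp add: max_def)
      have "(\<integral>\<^sup>+ \<omega>. norm (multi_time L \<theta> \<omega>) \<partial>M) \<le> (\<integral>\<^sup>+ \<omega>. (\<Sum>j\<in>UNIV. ennreal (norm (L j (\<theta> $ j) \<omega>))) \<partial>M)"
        by (intro nn_integral_mono)
          (use norm_vec_le_sum[of "multi_time L \<theta> _"] in \<open>simp add: multi_time_def ennreal_leI\<close>)
      also have "\<dots> = (\<Sum>j\<in>UNIV. L.moment j (max 0 (\<theta> $ j)))"
      proof -
        have [measurable]: "L j (\<theta> $ j) \<in> borel_measurable M" for j using elim by (intro L.measurable_Y) auto
        show ?thesis by (subst nn_integral_sum) (simp_all add: L.moment_def \<theta>)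
      qed
      finally show ?case by (simp add: mult_right_mono flip: sum_distrib_right)
    qed
  qed
  also have "\<dots> = (\<Sum>j\<in>UNIV. jump_moment j)"
    unfolding jump_moment_def by (subst nn_integral_sum) auto
  finally have upper: "?I \<le> (\<Sum>j\<in>UNIV. jump_moment j)" .
  assume "\<forall>j. jump_moment j < \<infinity>"
  then have "(\<Sum>j\<in>UNIV. jump_moment j) < \<infinity>" by simp
  with upper show "?I < \<infinity>" by (rule le_less_trans)
qed

lemma integrable_subordinated_iff:
  "integrable_process M (subordinated L \<Theta>) \<longleftrightarrow> (\<forall>j. integrable_process M (X j))"
proof -
  have "integrable M (subordinated L \<Theta> t) \<longleftrightarrow> (\<forall>j. integrable M (X j t))" for t
    by (subst integrable_vec_iff) (simp add: subordinated_def multi_time_def)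
  then show ?thesis by (auto simp: integrable_process_def)
qed

lemma integrable_joint_iff:
  "integrable_process M (joint_process L) \<longleftrightarrow> (\<forall>j. integrable_process M (L j))"
proof -
  have "integrable M (joint_process L t) \<longleftrightarrow> (\<forall>j. integrable M (L j t))" for t
    by (subst integrable_vec_iff) (simp add: joint_process_def)
  then show ?thesis by (auto simp: integrable_process_def)
qed

lemma integrable_L_if_integrable_X:
  assumes X: "integrable_process M (X j)" and nt: "nontrivial_process M (\<lambda>t \<omega>. \<Theta> t \<omega> $ j)"
  shows "integrable_process M (L j)"
proof (rule ccontr)
  assume "\<not> integrable_process M (L j)"
  from integrable_X_dichotomy[OF X this] have ae: "AE \<omega> in M. \<forall>t\<ge>0. \<Theta> t \<omega> $ j = 0" .
  let ?N = "{\<omega> \<in> space M. \<exists>t\<ge>0. \<Theta> t \<omega> $ j \<noteq> 0}"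
  have pos: "measure M ?N > 0" using nt by (simp add: nontrivial_process_def)
  then have "?N \<in> sets M" using measure_notin_sets[of ?N M] by fastforce
  then have "emeasure M ?N = 0" using ae by (subst (asm) AE_iff_measurable[OF _ refl]) auto
  with pos show False by (simp add: measure_def)
qed

end

section \<open>The integrability theorem\<close>

theorem theorem3p10:
  fixes M :: "'a measure"
    and H :: "'d::finite \<Rightarrow> 'h::{real_inner, banach, second_countable_topology} set"
    and L :: "'d \<Rightarrow> real \<Rightarrow> 'a \<Rightarrow> 'h"
    and \<Theta> :: "real \<Rightarrow> 'a \<Rightarrow> real ^ 'd"
  assumes "prob_space M"
    and "\<And>j. subspace (H j)" and "\<And>j. closed (H j)"
    and "\<And>j t \<omega>. t \<ge> 0 \<Longrightarrow> \<omega> \<in> space M \<Longrightarrow> L j t \<omega> \<in> H j"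
    and "\<And>j. levy_process M (L j)"
    and "prob_space.indep_vars M (\<lambda>_. path_space) (\<lambda>j. process_path (L j)) UNIV"
    and "levy_process M \<Theta>"
    and "\<And>j. subordinator M (\<lambda>t \<omega>. \<Theta> t \<omega> $ j)"
    and "indep_processes M (joint_process L) \<Theta>"
    and "nontrivial_process M \<Theta>"
  shows
    "((\<forall>j. nontrivial_process M (\<lambda>t \<omega>. \<Theta> t \<omega> $ j)) \<longrightarrow>
        (integrable_process M (subordinated L \<Theta>) \<longleftrightarrow>
         integrable_process M (joint_process L) \<and>
         (\<integral>\<^sup>+ \<theta>\<in>{\<theta>. norm \<theta> > 1}. (\<integral>\<^sup>+ \<omega>. norm (multi_time L \<theta> \<omega>) \<partial>M) \<partial>levy_measure M \<Theta>) < \<infinity>)) \<and>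
     (integrable_process M (joint_process L) \<and>
        (\<integral>\<^sup>+ \<theta>\<in>{\<theta>. norm \<theta> > 1}. (\<integral>\<^sup>+ \<omega>. norm (multi_time L \<theta> \<omega>) \<partial>M) \<partial>levy_measure M \<Theta>) < \<infinity> \<longrightarrow>
        integrable_process M (subordinated L \<Theta>)) \<and>
     (integrable_process M (subordinated L \<Theta>) \<longrightarrow>
        (\<integral>\<^sup>+ \<theta>\<in>{\<theta>. norm \<theta> > 1}. (\<integral>\<^sup>+ \<omega>. norm (multi_time L \<theta> \<omega>) \<partial>M) \<partial>levy_measure M \<Theta>) < \<infinity>) \<and>
     (integrable_process M (joint_process L) \<and> integrable_process M \<Theta> \<longrightarrow>
        integrable_process M (subordinated L \<Theta>) \<and>
        integral\<^sup>L M (subordinated L \<Theta> 1) =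
          coord_prod (integral\<^sup>L M (\<Theta> 1)) (integral\<^sup>L M (joint_process L 1))) \<and>
     (\<forall>j. integrable_process M (\<lambda>t \<omega>. subordinated L \<Theta> t \<omega> $ j) \<and>
          \<not> integrable_process M (\<lambda>t \<omega>. \<Theta> t \<omega> $ j) \<longrightarrow>
        mean_zero_process M (\<lambda>t \<omega>. subordinated L \<Theta> t \<omega> $ j))"
proof -
  interpret prob_space M by fact
  interpret S: subordination M \<Theta> L
  proof
    show "\<Theta> s \<omega> $ j \<le> \<Theta> t \<omega> $ j" if "\<omega> \<in> space M" "0 \<le> s" "s \<le> t" for \<omega> s t j
      using assms(8)[of j] that by (auto simp: subordinator_def mono_on_def)
    show "0 \<le> \<Theta> t \<omega> $ j" if "\<omega> \<in> space M" "0 \<le> t" for \<omega> t j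
      using assms(8)[of j] that by (auto simp: subordinator_def)
  qed (use assms in auto)
  have coord: "(\<lambda>t \<omega>. subordinated L \<Theta> t \<omega> $ j) = S.X j" for j
    by (simp add: subordinated_def multi_time_def)
  have mean: "integral\<^sup>L M (subordinated L \<Theta> 1) =
      coord_prod (integral\<^sup>L M (\<Theta> 1)) (integral\<^sup>L M (joint_process L 1))"
    if L: "integrable_process M (joint_process L)" and T: "integrable_process M \<Theta>"
      and X: "integrable_process M (subordinated L \<Theta>)"
  proof (simp only: vec_eq_iff, rule allI)
    fix j
    have nth: "integral\<^sup>L M f $ i = (\<integral> x. f x $ i \<partial>M)" if "integrable M f" for f :: "'a \<Rightarrow> 'c::{banach, second_countable_topology} ^ 'd" and i
      using integral_bounded_linear[OF bounded_linear_vec_nth that] by simp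
    have int: "integrable M (subordinated L \<Theta> 1)" "integrable M (\<Theta> 1)" "integrable M (joint_process L 1)"
      using L T X by (auto simp: integrable_process_def)
    have Lj: "integrable_process M (L j)" using L S.integrable_joint_iff by blast
    have "integrable_process M (S.X j)" using X S.integrable_subordinated_iff by blast
    then have Xj: "integrable M (S.X j 1)" by (simp add: integrable_process_def)
    have "integral\<^sup>L M (subordinated L \<Theta> 1) $ j = (\<integral> \<omega>. S.X j 1 \<omega> \<partial>M)"
      by (simp add: nth[OF int(1)]) (simp add: subordinated_def multi_time_def)
    also have "\<dots> = (\<integral> \<omega>. \<Theta> 1 \<omega> $ j *\<^sub>R (\<integral> \<omega>. L j 1 \<omega> \<partial>M) \<partial>M)"
      by (rule S.mean_X_eq[OF Lj _ Xj]) simp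
    also have "\<dots> = (\<integral> \<omega>. \<Theta> 1 \<omega> $ j \<partial>M) *\<^sub>R (\<integral> \<omega>. L j 1 \<omega> \<partial>M)"
      using int(2) integrable_vec_iff by (intro integral_scaleR_left) blast
    also have "\<dots> = coord_prod (integral\<^sup>L M (\<Theta> 1)) (integral\<^sup>L M (joint_process L 1)) $ j"
      by (simp add: coord_prod_def nth[OF int(2)] nth[OF int(3)]) (simp add: joint_process_def)
    finally show "integral\<^sup>L M (subordinated L \<Theta> 1) $ j =
        coord_prod (integral\<^sup>L M (\<Theta> 1)) (integral\<^sup>L M (joint_process L 1)) $ j" .
  qed
  have \<Theta>_coord: "integrable_process M (\<lambda>t \<omega>. \<Theta> t \<omega> $ j)" if "integrable_process M \<Theta>" for j
    using that integrable_vec_iff by (auto simp: integrable_process_def)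
  have jumps: "\<forall>j. S.jump_moment j < \<infinity>" if "integrable_process M (subordinated L \<Theta>)"
    using that unfolding S.integrable_subordinated_iff by (blast intro: S.jump_moment_finite_if_integrable_X)
  have X: "integrable_process M (subordinated L \<Theta>)"
    if "integrable_process M (joint_process L)" "\<forall>j. S.jump_moment j < \<infinity>"
    unfolding S.integrable_subordinated_iff
    using that by (intro allI S.integrable_X_if_jump_moment_finite) (auto simp: S.integrable_joint_iff)
  have L: "integrable_process M (joint_process L)"
    if "\<forall>j. nontrivial_process M (\<lambda>t \<omega>. \<Theta> t \<omega> $ j)" "integrable_process M (subordinated L \<Theta>)"
    unfolding S.integrable_joint_iff
    using that by (intro allI S.integrable_L_if_integrable_X) (auto simp: S.integrable_subordinated_iff)
  have X': "integrable_process M (subordinated L \<Theta>)"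
    if "integrable_process M (joint_process L)" "integrable_process M \<Theta>"
    unfolding S.integrable_subordinated_iff
    using that \<Theta>_coord by (intro allI S.integrable_X_if_integrable_\<Theta>) (auto simp: S.integrable_joint_iff)
  show ?thesis
    unfolding S.levy_integral_finite_iff coord
  proof (intro conjI impI allI; (elim conjE)?)
    assume nt: "\<forall>j. nontrivial_process M (\<lambda>t \<omega>. \<Theta> t \<omega> $ j)"
    show "integrable_process M (subordinated L \<Theta>) \<longleftrightarrow>
      integrable_process M (joint_process L) \<and> (\<forall>j. S.jump_moment j < \<infinity>)"
    proof
      assume "integrable_process M (subordinated L \<Theta>)"
      then show "integrable_process M (joint_process L) \<and> (\<forall>j. S.jump_moment j < \<infinity>)"
        using L[OF nt] jumps by simp
    qed (elim conjE, rule X)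
  next
    fix j
    assume "integrable_process M (S.X j)" "\<not> integrable_process M (\<lambda>t \<omega>. \<Theta> t \<omega> $ j)"
    then show "mean_zero_process M (S.X j)" by (rule S.mean_zero_X)
  next
    assume "integrable_process M (joint_process L)" "\<forall>j. S.jump_moment j < \<infinity>"
    then show "integrable_process M (subordinated L \<Theta>)" by (rule X)
  next
    fix j
    assume "integrable_process M (subordinated L \<Theta>)"
    then show "S.jump_moment j < \<infinity>" using jumps by blast
  next
    assume L\<Theta>: "integrable_process M (joint_process L)" "integrable_process M \<Theta>"
    show "integrable_process M (subordinated L \<Theta>)" by (rule X'[OF L\<Theta>])
    then show "integral\<^sup>L M (subordinated L \<Theta> 1) =
        coord_prod (integral\<^sup>L M (\<Theta> 1)) (integral\<^sup>L M (joint_process L 1))"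
      by (rule mean[OF L\<Theta>])
  qed
qed

end
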